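(* Let $\delta>0$. \begin{enumerate} \item There exists an EMSO sentence $\phi$ with exactly one monadic (set) variable such that, for every $\alpha\in(0,\frac{1}{2}-\delta)$, the sequence ${\sf P}(G(n,n^{-\alpha})\models\phi)$ does not converge as $n\to\infty$. \item There exists an EMSO sentence $\phi$ such that, for every $\alpha\in(0,1-\delta)$, the sequence ${\sf P}(G(n,n^{-\alpha})\models\phi)$ does not converge as $n\to\infty$. \end{enumerate}
   Context: $G(n,p)$ denotes the binomial random graph on vertex set $\{1,\dots,n\}$ in which each pair of vertices is joined by an edge independently with probability $p$. Sentences of the first order (FO) language of graphs are built from the relations $\sim$ (adjacency) and $=$, logical connectives, vertex variables, quantifiers $\forall,\exists$ and parentheses. Monadic second order (MSO) sentences additionally use variables $X,Y,\dots$ interpreted as sets of vertices (unary predicates), which may be quantified. An existential monadic second order (EMSO) sentence is one of the form $\exists X_1\ldots\exists X_m\,\varphi(X_1,\dots,X_m)$ where $\varphi$ is a FO formula using the unary predicates $X_1,\dots,X_m$; $m$ is the number of monadic variables. $G\models\phi$ means $\phi$ is true on the graph $G$. *)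

theory Defs
  imports "HOL-Probability.Probability"
begin

text \<open>A graph is a pair of a vertex set and a set of edges, each edge being a two-element
  set of vertices.\<close>

type_synonym 'v graph = "'v set \<times> 'v set set"

abbreviation verts :: "'v graph \<Rightarrow> 'v set" where
  "verts G \<equiv> fst G"

abbreviation edges :: "'v graph \<Rightarrow> 'v set set" where
  "edges G \<equiv> snd G"

definition vertex_pairs :: "'v set \<Rightarrow> 'v set set" where
  "vertex_pairs V = {e. e \<subseteq> V \<and> card e = 2}"

definition binomial_graph :: "nat \<Rightarrow> real \<Rightarrow> nat graph pmf" where
  "binomial_graph n p =
     map_pmf (\<lambda>f. ({1..n}, {e \<in> vertex_pairs {1..n}. f e}))
       (Pi_pmf (vertex_pairs {1..n}) False (\<lambda>_. bernoulli_pmf p))"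

text \<open>Vertex variables and set variables are two separate families, both named by natural
  numbers. The first argument of \<^term>\<open>Mem\<close> is a vertex variable and the second a set variable.\<close>

datatype mso =
    Adj nat nat
  | Equal nat nat
  | Mem nat nat
  | Neg mso
  | Conj mso mso
  | Disj mso mso
  | Impl mso mso
  | Iff mso mso
  | Forall nat mso
  | Exists nat mso
  | ForallSet nat mso
  | ExistsSet nat mso

text \<open>Set quantifiers range over subsets of the vertex set. Adjacency is irreflexive
  because a singleton is never an edge.\<close>

primrec sat :: "'v graph \<Rightarrow> (nat \<Rightarrow> 'v) \<Rightarrow> (nat \<Rightarrow> 'v set) \<Rightarrow> mso \<Rightarrow> bool" where
  "sat G a A (Adj x y) \<longleftrightarrow> {a x, a y} \<in> edges G"
| "sat G a A (Equal x y) \<longleftrightarrow> a x = a y"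
| "sat G a A (Mem x X) \<longleftrightarrow> a x \<in> A X"
| "sat G a A (Neg \<phi>) \<longleftrightarrow> \<not> sat G a A \<phi>"
| "sat G a A (Conj \<phi> \<psi>) \<longleftrightarrow> sat G a A \<phi> \<and> sat G a A \<psi>"
| "sat G a A (Disj \<phi> \<psi>) \<longleftrightarrow> sat G a A \<phi> \<or> sat G a A \<psi>"
| "sat G a A (Impl \<phi> \<psi>) \<longleftrightarrow> (sat G a A \<phi> \<longrightarrow> sat G a A \<psi>)"
| "sat G a A (Iff \<phi> \<psi>) \<longleftrightarrow> (sat G a A \<phi> \<longleftrightarrow> sat G a A \<psi>)"
| "sat G a A (Forall x \<phi>) \<longleftrightarrow> (\<forall>v\<in>verts G. sat G (a(x := v)) A \<phi>)"
| "sat G a A (Exists x \<phi>) \<longleftrightarrow> (\<exists>v\<in>verts G. sat G (a(x := v)) A \<phi>)"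
| "sat G a A (ForallSet X \<phi>) \<longleftrightarrow> (\<forall>S\<in>Pow (verts G). sat G a (A(X := S)) \<phi>)"
| "sat G a A (ExistsSet X \<phi>) \<longleftrightarrow> (\<exists>S\<in>Pow (verts G). sat G a (A(X := S)) \<phi>)"

primrec free_vars :: "mso \<Rightarrow> nat set" where
  "free_vars (Adj x y) = {x, y}"
| "free_vars (Equal x y) = {x, y}"
| "free_vars (Mem x X) = {x}"
| "free_vars (Neg \<phi>) = free_vars \<phi>"
| "free_vars (Conj \<phi> \<psi>) = free_vars \<phi> \<union> free_vars \<psi>"
| "free_vars (Disj \<phi> \<psi>) = free_vars \<phi> \<union> free_vars \<psi>"
| "free_vars (Impl \<phi> \<psi>) = free_vars \<phi> \<union> free_vars \<psi>"
| "free_vars (Iff \<phi> \<psi>) = free_vars \<phi> \<union> free_vars \<psi>"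
| "free_vars (Forall x \<phi>) = free_vars \<phi> - {x}"
| "free_vars (Exists x \<phi>) = free_vars \<phi> - {x}"
| "free_vars (ForallSet X \<phi>) = free_vars \<phi>"
| "free_vars (ExistsSet X \<phi>) = free_vars \<phi>"

primrec free_set_vars :: "mso \<Rightarrow> nat set" where
  "free_set_vars (Adj x y) = {}"
| "free_set_vars (Equal x y) = {}"
| "free_set_vars (Mem x X) = {X}"
| "free_set_vars (Neg \<phi>) = free_set_vars \<phi>"
| "free_set_vars (Conj \<phi> \<psi>) = free_set_vars \<phi> \<union> free_set_vars \<psi>"
| "free_set_vars (Disj \<phi> \<psi>) = free_set_vars \<phi> \<union> free_set_vars \<psi>"
| "free_set_vars (Impl \<phi> \<psi>) = free_set_vars \<phi> \<union> free_set_vars \<psi>"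
| "free_set_vars (Iff \<phi> \<psi>) = free_set_vars \<phi> \<union> free_set_vars \<psi>"
| "free_set_vars (Forall x \<phi>) = free_set_vars \<phi>"
| "free_set_vars (Exists x \<phi>) = free_set_vars \<phi>"
| "free_set_vars (ForallSet X \<phi>) = free_set_vars \<phi> - {X}"
| "free_set_vars (ExistsSet X \<phi>) = free_set_vars \<phi> - {X}"

definition sentence :: "mso \<Rightarrow> bool" where
  "sentence \<phi> \<longleftrightarrow> free_vars \<phi> = {} \<and> free_set_vars \<phi> = {}"

text \<open>First-order formulas over adjacency, equality and unary predicates: the set variables
  may occur but are not quantified.\<close>

primrec first_order :: "mso \<Rightarrow> bool" where
  "first_order (Adj x y) \<longleftrightarrow> True"
| "first_order (Equal x y) \<longleftrightarrow> True"
| "first_order (Mem x X) \<longleftrightarrow> True"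
| "first_order (Neg \<phi>) \<longleftrightarrow> first_order \<phi>"
| "first_order (Conj \<phi> \<psi>) \<longleftrightarrow> first_order \<phi> \<and> first_order \<psi>"
| "first_order (Disj \<phi> \<psi>) \<longleftrightarrow> first_order \<phi> \<and> first_order \<psi>"
| "first_order (Impl \<phi> \<psi>) \<longleftrightarrow> first_order \<phi> \<and> first_order \<psi>"
| "first_order (Iff \<phi> \<psi>) \<longleftrightarrow> first_order \<phi> \<and> first_order \<psi>"
| "first_order (Forall x \<phi>) \<longleftrightarrow> first_order \<phi>"
| "first_order (Exists x \<phi>) \<longleftrightarrow> first_order \<phi>"
| "first_order (ForallSet X \<phi>) \<longleftrightarrow> False"
| "first_order (ExistsSet X \<phi>) \<longleftrightarrow> False"

text \<open>Since the whole formula is a sentence, the matrix \<^term>\<open>\<psi>\<close> mentions no set variables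
  besides the \<^term>\<open>m\<close> quantified ones.\<close>

definition emso_sentence :: "nat \<Rightarrow> mso \<Rightarrow> bool" where
  "emso_sentence m \<phi> \<longleftrightarrow> sentence \<phi> \<and>
     (\<exists>Xs \<psi>. length Xs = m \<and> distinct Xs \<and> first_order \<psi> \<and> \<phi> = foldr ExistsSet Xs \<psi>)"

text \<open>For a sentence the assignments are irrelevant, so quantifying over all of them,
  including values outside the vertex set, is harmless and also covers the empty graph.\<close>

definition models :: "'v graph \<Rightarrow> mso \<Rightarrow> bool" (infix "\<Turnstile>" 50) where
  "G \<Turnstile> \<phi> \<longleftrightarrow> (\<forall>a A. sat G a A \<phi>)"

lemma sat_cong:
  assumes "\<And>x. x \<in> free_vars \<phi> \<Longrightarrow> a x = b x"
    and "\<And>X. X \<in> free_set_vars \<phi> \<Longrightarrow> A X = B X"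
  shows "sat G a A \<phi> \<longleftrightarrow> sat G b B \<phi>"
  using assms
proof (induction \<phi> arbitrary: a b A B)
  case (Neg \<phi>)
  then show ?case by (metis sat.simps(4) free_vars.simps(4) free_set_vars.simps(4))
next
  case (Conj \<phi> \<psi>)
  have "sat G a A \<phi> = sat G b B \<phi>" by (rule Conj.IH(1)) (simp_all add: Conj.prems)
  moreover have "sat G a A \<psi> = sat G b B \<psi>" by (rule Conj.IH(2)) (simp_all add: Conj.prems)
  ultimately show ?case by simp
next
  case (Disj \<phi> \<psi>)
  have "sat G a A \<phi> = sat G b B \<phi>" by (rule Disj.IH(1)) (simp_all add: Disj.prems)
  moreover have "sat G a A \<psi> = sat G b B \<psi>" by (rule Disj.IH(2)) (simp_all add: Disj.prems)
  ultimately show ?case by simp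
next
  case (Impl \<phi> \<psi>)
  have "sat G a A \<phi> = sat G b B \<phi>" by (rule Impl.IH(1)) (simp_all add: Impl.prems)
  moreover have "sat G a A \<psi> = sat G b B \<psi>" by (rule Impl.IH(2)) (simp_all add: Impl.prems)
  ultimately show ?case by simp
next
  case (Iff \<phi> \<psi>)
  have "sat G a A \<phi> = sat G b B \<phi>" by (rule Iff.IH(1)) (simp_all add: Iff.prems)
  moreover have "sat G a A \<psi> = sat G b B \<psi>" by (rule Iff.IH(2)) (simp_all add: Iff.prems)
  ultimately show ?case by simp
next
  case (Forall x \<phi>)
  have "sat G (a(x := v)) A \<phi> = sat G (b(x := v)) B \<phi>" for v
    by (rule Forall.IH) (use Forall.prems in auto)
  then show ?case by simp
next
  case (Exists x \<phi>)
  have "sat G (a(x := v)) A \<phi> = sat G (b(x := v)) B \<phi>" for v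
    by (rule Exists.IH) (use Exists.prems in auto)
  then show ?case by simp
next
  case (ForallSet X \<phi>)
  have "sat G a (A(X := S)) \<phi> = sat G b (B(X := S)) \<phi>" for S
    by (rule ForallSet.IH) (use ForallSet.prems in auto)
  then show ?case by simp
next
  case (ExistsSet X \<phi>)
  have "sat G a (A(X := S)) \<phi> = sat G b (B(X := S)) \<phi>" for S
    by (rule ExistsSet.IH) (use ExistsSet.prems in auto)
  then show ?case by simp
qed simp_all

lemma models_iff_sat:
  assumes "sentence \<phi>"
  shows "G \<Turnstile> \<phi> \<longleftrightarrow> sat G a A \<phi>"
  using assms sat_cong[of \<phi>] unfolding models_def sentence_def by blast

end

theory Submission
  imports Defs "HOL-Real_Asymp.Real_Asymp"
begin

text \<open>One sentence with \<open>r\<close> set variables works for every exponent \<open>\<alpha> < r / (r + 1)\<close>. Taking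
  \<open>r = 1\<close>, respectively \<open>r \<ge> 1 / \<delta>\<close>, gives the two parts.

  It asserts the existence of forests of depth \<open>r\<close>, given by the set variables, whose roots \<open>x\<close> lie in
  \<open>J\<close> blocks and have about \<open>n powr \<alpha>\<close> leaves each. A vertex \<open>u\<close> is related to \<open>x\<close> if it is adjacent to
  a leaf below \<open>x\<close>; every vertex \<open>u\<close> thus codes a set of roots. In \<open>G(n, n powr (- \<alpha>))\<close> this relation
  is essentially a random bipartite graph of constant density, whatever \<open>\<alpha>\<close> is, because
  paths of length \<open>r + 1\<close> through suitable layers are available exactly if \<open>\<alpha> < r / (r + 1)\<close>.

  The sentence says that almost all vertices code different sets, so that \<open>2 ^ (J k)\<close> is at least about
  \<open>n\<close> if each block has at most \<open>k\<close> roots; that every subset of a block is coded, so that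
  \<open>2 ^ k \<le> n\<close>; and that each block is a double power set, so that its size has the form
  \<open>2 ^ 2 ^ a\<close>. Thus some number \<open>2 ^ 2 ^ a\<close> lies roughly between \<open>log n / J\<close> and \<open>log n\<close>. As
  these numbers grow by squaring, there are infinitely many \<open>n\<close> for which no graph on \<open>n\<close> vertices
  satisfies the sentence. For \<open>n = 2 ^ (6 (r + 1) k)\<close> with \<open>k = 2 ^ 2 ^ a\<close>, on the other hand, a
  greedy embedding finds the forest with probability at least \<open>1 / 2\<close> once \<open>a\<close> is large.\<close>

section \<open>Separating and shattering, and the encoded structure\<close>

text \<open>The bound \<open>r / (r + 1)\<close> comes from counting vertices. A node on layer
  \<open>j + 1\<close> must be adjacent to one of the \<open>n powr (j * \<alpha> / r)\<close> nodes
  of its tree on layer \<open>j\<close>, so about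
  \<open>n powr (\<alpha> - j * \<alpha> / r)\<close> candidates are spent on it. A tree has
  \<open>n powr ((j + 1) * \<alpha> / r)\<close> such nodes, so every layer costs about
  \<open>n powr (\<alpha> + \<alpha> / r)\<close> vertices per tree, up to logarithmic factors. This
  is less than \<open>n\<close> just if \<open>\<alpha> < r / (r + 1)\<close>.

  A forest with \<open>r + 1\<close> layers gets by with \<open>r\<close> set variables because
  roots and leaves share one; adjacency to parameter vertices tells them apart.

  The obstacle on the random side is dependence: the forest is found by looking at edges, and these
  are no longer random afterwards. Hence the disjoint pools of candidates, a reserve of vertices
  that the embedding never touches, and the exemption of layer \<open>r - 1\<close> and of the
  parameters from the separation condition.\<close>

definition separates :: "'w set \<Rightarrow> 'z set \<Rightarrow> ('w \<Rightarrow> 'z \<Rightarrow> bool) \<Rightarrow> bool" where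
  "separates W Z R \<longleftrightarrow> (\<forall>z\<in>Z. \<forall>z'\<in>Z. z \<noteq> z' \<longrightarrow> (\<exists>w\<in>W. R w z \<noteq> R w z'))"

text \<open>Subsets of \<open>W\<close> cannot be quantified in a first-order matrix. Coding the
  empty set and closing the coded sets under insertion of one element has the same effect for finite
  \<open>W\<close>, by induction on the set to be coded.\<close>

definition shatters :: "'w set \<Rightarrow> 'z set \<Rightarrow> ('w \<Rightarrow> 'z \<Rightarrow> bool) \<Rightarrow> bool" where
  "shatters W Z R \<longleftrightarrow> (\<exists>z\<in>Z. \<forall>w\<in>W. \<not> R w z) \<and>
     (\<forall>z\<in>Z. \<forall>w\<in>W. \<exists>z'\<in>Z. R w z' \<and> (\<forall>w'\<in>W. w' \<noteq> w \<longrightarrow> R w' z' = R w' z))"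

lemma separates_card_le:
  assumes "finite W" "separates W Z R"
  shows "card Z \<le> 2 ^ card W"
proof -
  have "inj_on (\<lambda>z. {w \<in> W. R w z}) Z"
    using assms(2) unfolding separates_def inj_on_def by blast
  moreover have "(\<lambda>z. {w \<in> W. R w z}) ` Z \<subseteq> Pow W" by auto
  ultimately show ?thesis
    using card_inj_on_le[of _ Z "Pow W"] assms(1) by (simp add: card_Pow)
qed

lemma shatters_trace:
  assumes "finite W" "shatters W Z R" "X \<subseteq> W"
  shows "\<exists>z\<in>Z. {w \<in> W. R w z} = X"
proof -
  have "finite X" using assms finite_subset by blast
  then show ?thesis using assms(3)
  proof (induction X)
    case empty
    then show ?case using assms(2) unfolding shatters_def by auto
  next
    case (insert w X)
    then obtain z where z: "z \<in> Z" "{w \<in> W. R w z} = X" by auto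
    moreover have "w \<in> W" using insert by auto
    ultimately obtain z' where "z' \<in> Z" "R w z'" "\<forall>w'\<in>W. w' \<noteq> w \<longrightarrow> R w' z' = R w' z"
      using assms(2) unfolding shatters_def by blast
    then show ?case using z \<open>w \<in> W\<close> by (intro bexI[of _ z']) auto
  qed
qed

lemma shatters_card_ge:
  assumes "finite W" "finite Z" "shatters W Z R"
  shows "2 ^ card W \<le> card Z"
proof -
  have "Pow W \<subseteq> (\<lambda>z. {w \<in> W. R w z}) ` Z"
    using shatters_trace[OF assms(1,3)] by blast
  then have "card (Pow W) \<le> card Z" using assms(2) by (rule surj_card_le[rotated])
  then show ?thesis using assms(1) by (simp add: card_Pow)
qed

lemma shattersI:
  assumes "\<And>X. X \<subseteq> W \<Longrightarrow> \<exists>z\<in>Z. {w \<in> W. R w z} = X"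
  shows "shatters W Z R"
  unfolding shatters_def
proof (intro conjI ballI)
  show "\<exists>z\<in>Z. \<forall>w\<in>W. \<not> R w z" using assms[of "{}"] by auto
next
  fix z w assume "z \<in> Z" "w \<in> W"
  then obtain z' where "z' \<in> Z" "{v \<in> W. R v z'} = insert w {v \<in> W. R v z}"
    using assms[of "insert w {v \<in> W. R v z}"] by auto
  then show "\<exists>z'\<in>Z. R w z' \<and> (\<forall>w'\<in>W. w' \<noteq> w \<longrightarrow> R w' z' = R w' z)"
    by (intro bexI[of _ z']) blast+
qed

section \<open>The structure encoded in a graph by sets and parameters\<close>

definition adjacent :: "'v graph \<Rightarrow> 'v \<Rightarrow> 'v \<Rightarrow> bool" where
  "adjacent G u v \<longleftrightarrow> {u, v} \<in> edges G"

definition marked :: "'v graph \<Rightarrow> (nat \<Rightarrow> 'v set) \<Rightarrow> (nat \<Rightarrow> 'v) \<Rightarrow> nat \<Rightarrow> 'v set" where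
  "marked G A v \<tau> = {s \<in> verts G. s \<in> A 0 \<and> adjacent G s (v \<tau>)}"

text \<open>Roots and leaves both live in \<open>A 0\<close>, which is how \<open>r + 1\<close>
  layers fit into \<open>r\<close> set variables: roots have a neighbour among the first
  \<open>J\<close> parameters, leaves have none among all \<open>3 * J\<close>. The vertices of
  \<open>A 0\<close> marked by later parameters are the lower levels of the double power
  sets.\<close>

definition layer :: "'v graph \<Rightarrow> (nat \<Rightarrow> 'v set) \<Rightarrow> (nat \<Rightarrow> 'v) \<Rightarrow> nat \<Rightarrow> nat \<Rightarrow> nat \<Rightarrow> 'v set" where
  "layer G A v J r j =
     (if j = 0 then (\<Union>i<J. marked G A v i)
      else if j = r then {s \<in> verts G. s \<in> A 0 \<and> (\<forall>\<tau><3*J. \<not> adjacent G s (v \<tau>))}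
      else {s \<in> verts G. s \<in> A j})"

text \<open>The start \<open>y\<close> is unrestricted; the vertices after it run through
  \<open>Q (j - 1)\<close> down to \<open>Q 0\<close>, and the last one is \<open>x\<close>. For
  \<open>Suc r\<close> this is a path of \<open>r + 1\<close> edges whose first step enters the
  leaves.\<close>

primrec reach :: "'v graph \<Rightarrow> (nat \<Rightarrow> 'v set) \<Rightarrow> nat \<Rightarrow> 'v \<Rightarrow> 'v \<Rightarrow> bool" where
  "reach G Q 0 y x \<longleftrightarrow> y = x"
| "reach G Q (Suc j) y x \<longleftrightarrow> (\<exists>w\<in>Q j. adjacent G y w \<and> reach G Q j w x)"

text \<open>\<open>A\<close> codes all subsets of itself by elements of \<open>B\<close>. A set coded by \<open>c\<close> inside \<open>B\<close> is
  transported to \<open>A\<close> by identifying \<open>a\<close> with the element of \<open>B\<close> that codes \<open>{a}\<close>.\<close>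

definition singles_out :: "'b set \<Rightarrow> 'a set \<Rightarrow> ('a \<Rightarrow> 'b \<Rightarrow> bool) \<Rightarrow> 'a \<Rightarrow> 'a \<Rightarrow> bool" where
  "singles_out B A R c a \<longleftrightarrow> (\<exists>x\<in>B. R c x \<and> R a x \<and> (\<forall>a'\<in>A. a' \<noteq> a \<longrightarrow> \<not> R a' x))"

text \<open>The second condition bounds the layer \<open>r - 1\<close>, which the first one has to leave out: its adjacencies
  to the leaves are not random. In the third one, block \<open>i\<close> is the power set of \<open>M (J + i)\<close>, which
  is the power set of \<open>M (2*J + i)\<close>.\<close>

definition encodes :: "'v graph \<Rightarrow> (nat \<Rightarrow> 'v set) \<Rightarrow> (nat \<Rightarrow> 'v) \<Rightarrow> nat \<Rightarrow> nat \<Rightarrow> bool" where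
  "encodes G A v J r \<longleftrightarrow>
     (let Q = layer G A v J r; M = marked G A v; \<rho> = reach G Q (Suc r) in
       separates (Q 0) (verts G - Q (r - 1) - v ` {..<3*J}) (\<lambda>x u. \<rho> u x) \<and>
       (\<forall>z\<in>Q (r - 1). \<exists>y\<in>verts G - Q (r - 1). \<forall>z'\<in>Q (r - 1). adjacent G y z' \<longleftrightarrow> z' = z) \<and>
       (\<forall>i<J. shatters (M i) (verts G) (\<lambda>x u. \<rho> u x) \<and>
          separates (M (J + i)) (M i) \<rho> \<and> shatters (M (J + i)) (M i) \<rho> \<and>
          separates (M (2*J + i)) (M (J + i)) (singles_out (M i) (M (J + i)) \<rho>) \<and>
          shatters (M (2*J + i)) (M (J + i)) (singles_out (M i) (M (J + i)) \<rho>)))"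

section \<open>Counting: numbers of vertices that exclude the encoding\<close>

lemma separates_shatters_card:
  assumes "finite W" "finite Z" "separates W Z R" "shatters W Z R"
  shows "card Z = 2 ^ card W"
  using separates_card_le[OF assms(1,3)] shatters_card_ge[OF assms(1,2,4)] by simp

text \<open>Let \<open>\<kappa> = 2 ^ 2 ^ a\<close>. Block sizes have the form
  \<open>2 ^ 2 ^ b\<close> and are at most the binary logarithm \<open>(J + 1) * \<kappa>\<close> of
  the number of vertices. This is less than \<open>\<kappa> * \<kappa>\<close>, the next number of
  that form, so blocks have at most \<open>\<kappa>\<close> roots. The roots then have at most
  \<open>2 ^ (J * \<kappa>)\<close> traces, which falls short by a factor
  \<open>2 ^ \<kappa>\<close>, while the exempted vertices are covered by a factor
  \<open>6 * J + 2\<close>.\<close>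

lemma not_encodes:
  assumes fin: "finite (verts G)"
    and card: "card (verts G) = 2 ^ ((J + 1) * 2 ^ 2 ^ a)" and big: "6 * J + 2 \<le> 2 ^ 2 ^ a"
  shows "\<not> encodes G A v J r"
proof
  assume enc: "encodes G A v J r"
  define Q where "Q = layer G A v J r"
  define M where "M = marked G A v"
  define \<rho> where "\<rho> = reach G Q (Suc r)"
  define \<kappa> :: nat where "\<kappa> = 2 ^ 2 ^ a"
  define n where "n = card (verts G)"
  note defs = Q_def[symmetric] M_def[symmetric] \<rho>_def[symmetric]
  have enc': "separates (Q 0) (verts G - Q (r - 1) - v ` {..<3*J}) (\<lambda>x u. \<rho> u x) \<and>
       (\<forall>z\<in>Q (r - 1). \<exists>y\<in>verts G - Q (r - 1). \<forall>z'\<in>Q (r - 1). adjacent G y z' \<longleftrightarrow> z' = z) \<and>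
       (\<forall>i<J. shatters (M i) (verts G) (\<lambda>x u. \<rho> u x) \<and>
          separates (M (J + i)) (M i) \<rho> \<and> shatters (M (J + i)) (M i) \<rho> \<and>
          separates (M (2*J + i)) (M (J + i)) (singles_out (M i) (M (J + i)) \<rho>) \<and>
          shatters (M (2*J + i)) (M (J + i)) (singles_out (M i) (M (J + i)) \<rho>))"
    using enc unfolding encodes_def Let_def defs .
  note sep = conjunct1[OF enc']
  note priv = bspec[OF conjunct1[OF conjunct2[OF enc']]]
  note str = conjunct2[OF conjunct2[OF enc'], rule_format]
  have Msub: "M i \<subseteq> verts G" for i unfolding M_def marked_def by auto
  then have Mfin: "finite (M i)" for i using fin finite_subset by blast
  have Qsub: "Q j \<subseteq> verts G" for j
    unfolding Q_def layer_def marked_def by (auto split: if_splits)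
  then have Qfin: "finite (Q j)" for j using fin finite_subset by blast
  have Mcard: "card (M i) \<le> \<kappa>" if "i < J" for i
  proof -
    note str' = str[OF that, THEN conjunct1] str[OF that, THEN conjunct2, THEN conjunct1]
      str[OF that, THEN conjunct2, THEN conjunct2, THEN conjunct1]
      str[OF that, THEN conjunct2, THEN conjunct2, THEN conjunct2, THEN conjunct1]
      str[OF that, THEN conjunct2, THEN conjunct2, THEN conjunct2, THEN conjunct2]
    have "card (M (J + i)) = 2 ^ card (M (2*J + i))"
      by (rule separates_shatters_card[OF Mfin Mfin str'(4,5)])
    moreover have "card (M i) = 2 ^ card (M (J + i))"
      by (rule separates_shatters_card[OF Mfin Mfin str'(2,3)])
    ultimately obtain b where b: "card (M i) = 2 ^ 2 ^ b" by simp
    have "2 ^ card (M i) \<le> card (verts G)"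
      by (rule shatters_card_ge[OF Mfin fin str'(1)])
    then have "(2::nat) ^ card (M i) \<le> 2 ^ ((J + 1) * \<kappa>)" unfolding card \<kappa>_def .
    then have "card (M i) \<le> (J + 1) * \<kappa>" by (rule power_le_imp_le_exp[rotated]) simp
    also have "\<dots> < \<kappa> * \<kappa>" using big unfolding \<kappa>_def[symmetric] by (intro mult_strict_right_mono) auto
    also have "\<dots> = 2 ^ 2 ^ Suc a" by (simp add: \<kappa>_def power2_eq_square[symmetric] power_mult[symmetric] mult.commute)
    finally have "(2::nat) ^ 2 ^ b < 2 ^ 2 ^ Suc a" unfolding b .
    then have "(2::nat) ^ b < 2 ^ Suc a" by (rule power_less_imp_less_exp[rotated]) simp
    then have "b < Suc a" by (rule power_less_imp_less_exp[rotated]) simp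
    then show ?thesis unfolding b \<kappa>_def by (intro power_increasing) auto
  qed
  have "Q 0 = (\<Union>i<J. M i)" unfolding Q_def layer_def M_def by simp
  then have "card (Q 0) \<le> (\<Sum>i<J. card (M i))" by (simp add: card_UN_le)
  also have "\<dots> \<le> (\<Sum>i<J. \<kappa>)" by (intro sum_mono Mcard) auto
  finally have Q0: "card (Q 0) \<le> J * \<kappa>" by simp
  let ?U = "verts G - Q (r - 1) - v ` {..<3*J}"
  have U: "card ?U \<le> 2 ^ (J * \<kappa>)"
    by (rule order_trans[OF separates_card_le[OF Qfin sep] power_increasing[OF Q0]]) simp
  have vc: "card (v ` {..<3*J}) \<le> 3 * J" using card_image_le[of "{..<3*J}" v] by simp
  have cover: "verts G - Q (r - 1) \<subseteq> ?U \<union> v ` {..<3*J}" by auto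
  have VQ: "card (verts G - Q (r - 1)) \<le> 2 ^ (J * \<kappa>) + 3 * J"
    using card_mono[OF _ cover] card_Un_le[of ?U "v ` {..<3*J}"] U vc fin by fastforce
  obtain g where g: "\<And>z. z \<in> Q (r - 1) \<Longrightarrow> g z \<in> verts G - Q (r - 1) \<and>
      (\<forall>z'\<in>Q (r - 1). adjacent G (g z) z' \<longleftrightarrow> z' = z)"
    using priv by metis
  \<comment> \<open>A private neighbour determines its vertex, so layer \<open>r - 1\<close> is no
    larger than its complement, and exempting it costs at most a factor 2.\<close>
  have "inj_on g (Q (r - 1))" using g by (intro inj_onI) metis
  then have "card (Q (r - 1)) \<le> card (verts G - Q (r - 1))"
    using g fin by (intro card_inj_on_le[of g]) auto
  moreover have "card (verts G) = card (verts G - Q (r - 1)) + card (Q (r - 1))"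
    using card_Diff_subset[OF Qfin Qsub] card_mono[OF fin Qsub] by simp
  ultimately have "card (verts G) \<le> 2 * card (verts G - Q (r - 1))" by linarith
  also have "\<dots> \<le> 2 * (2 ^ (J * \<kappa>) + 3 * J)" using VQ by (rule mult_le_mono2)
  also have "\<dots> \<le> (6 * J + 2) * 2 ^ (J * \<kappa>)" by (simp add: algebra_simps)
  also have "\<dots> \<le> \<kappa> * 2 ^ (J * \<kappa>)" using big unfolding \<kappa>_def by (rule mult_le_mono1)
  also have "\<dots> < 2 ^ \<kappa> * 2 ^ (J * \<kappa>)" by (rule mult_strict_right_mono[OF less_exp]) simp
  also have "\<dots> = card (verts G)" unfolding card \<kappa>_def[symmetric] by (simp add: power_add)
  finally show False by simp
qed

section \<open>The sentence\<close>

text \<open>\<open>Equal 0 0\<close> serves as truth. It makes variable 0 free even for an empty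
  list; for \<open>0 < J\<close> this is a parameter and is bound in the prefix.\<close>

definition fm_conj :: "mso list \<Rightarrow> mso" where
  "fm_conj \<phi>s = foldr Conj \<phi>s (Equal 0 0)"

definition fm_disj :: "mso list \<Rightarrow> mso" where
  "fm_disj \<phi>s = foldr Disj \<phi>s (Neg (Equal 0 0))"

lemma sat_fm_conj [simp]: "sat G a A (fm_conj \<phi>s) \<longleftrightarrow> (\<forall>\<phi>\<in>set \<phi>s. sat G a A \<phi>)"
  unfolding fm_conj_def by (induction \<phi>s) auto

lemma sat_fm_disj [simp]: "sat G a A (fm_disj \<phi>s) \<longleftrightarrow> (\<exists>\<phi>\<in>set \<phi>s. sat G a A \<phi>)"
  unfolding fm_disj_def by (induction \<phi>s) auto

lemma free_vars_fm_conj: "free_vars (fm_conj \<phi>s) = insert 0 (\<Union>\<phi>\<in>set \<phi>s. free_vars \<phi>)"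
  unfolding fm_conj_def by (induction \<phi>s) auto

lemma free_vars_fm_disj: "free_vars (fm_disj \<phi>s) = insert 0 (\<Union>\<phi>\<in>set \<phi>s. free_vars \<phi>)"
  unfolding fm_disj_def by (induction \<phi>s) auto

lemma free_set_vars_fm_conj [simp]:
    "free_set_vars (fm_conj \<phi>s) = (\<Union>\<phi>\<in>set \<phi>s. free_set_vars \<phi>)"
  and free_set_vars_fm_disj [simp]:
    "free_set_vars (fm_disj \<phi>s) = (\<Union>\<phi>\<in>set \<phi>s. free_set_vars \<phi>)"
  and first_order_fm_conj [simp]: "first_order (fm_conj \<phi>s) \<longleftrightarrow> (\<forall>\<phi>\<in>set \<phi>s. first_order \<phi>)"
  and first_order_fm_disj [simp]: "first_order (fm_disj \<phi>s) \<longleftrightarrow> (\<forall>\<phi>\<in>set \<phi>s. first_order \<phi>)"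
  unfolding fm_conj_def fm_disj_def by (induction \<phi>s; simp)+

text \<open>The variables below \<open>m\<close> are parameters, \<open>m, \<dots>, m + 9\<close> are scratch variables and
  \<open>m + 10 + j\<close> is the vertex of layer \<open>j\<close> on a path.\<close>

definition fm_separates :: "nat \<Rightarrow> (nat \<Rightarrow> mso) \<Rightarrow> (nat \<Rightarrow> mso) \<Rightarrow> (nat \<Rightarrow> nat \<Rightarrow> mso) \<Rightarrow> mso" where
  "fm_separates m W Z R =
     Forall m (Impl (Z m) (Forall (m+1) (Impl (Z (m+1)) (Impl (Neg (Equal m (m+1)))
       (Exists (m+2) (Conj (W (m+2)) (Neg (Iff (R (m+2) m) (R (m+2) (m+1))))))))))"

definition fm_shatters :: "nat \<Rightarrow> (nat \<Rightarrow> mso) \<Rightarrow> (nat \<Rightarrow> mso) \<Rightarrow> (nat \<Rightarrow> nat \<Rightarrow> mso) \<Rightarrow> mso" where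
  "fm_shatters m W Z R =
     Conj (Exists m (Conj (Z m) (Forall (m+1) (Impl (W (m+1)) (Neg (R (m+1) m))))))
       (Forall m (Impl (Z m) (Forall (m+1) (Impl (W (m+1)) (Exists (m+2) (Conj (Z (m+2))
         (Conj (R (m+1) (m+2)) (Forall (m+3) (Impl (W (m+3)) (Impl (Neg (Equal (m+3) (m+1)))
           (Iff (R (m+3) (m+2)) (R (m+3) m))))))))))))"

definition fm_marked :: "nat \<Rightarrow> nat \<Rightarrow> mso" where
  "fm_marked \<tau> x = Conj (Mem x 0) (Adj x \<tau>)"

definition fm_layer :: "nat \<Rightarrow> nat \<Rightarrow> nat \<Rightarrow> nat \<Rightarrow> mso" where
  "fm_layer J r j x =
     (if j = 0 then fm_disj (map (\<lambda>i. fm_marked i x) [0..<J])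
      else if j = r then Conj (Mem x 0) (fm_conj (map (\<lambda>\<tau>. Neg (Adj x \<tau>)) [0..<3*J]))
      else Mem x j)"

primrec fm_reach :: "nat \<Rightarrow> nat \<Rightarrow> nat \<Rightarrow> nat \<Rightarrow> nat \<Rightarrow> mso" where
  "fm_reach J r 0 y x = Equal y x"
| "fm_reach J r (Suc j) y x = Exists (3*J+10+j)
     (Conj (fm_layer J r j (3*J+10+j)) (Conj (Adj y (3*J+10+j)) (fm_reach J r j (3*J+10+j) x)))"

text \<open>The bound variables start at \<open>m + 4\<close> because this formula is substituted
  for \<open>R\<close> in \<open>fm_separates\<close> and \<open>fm_shatters\<close>, which occupy
  \<open>m\<close> to \<open>m + 3\<close>.\<close>

definition fm_singles_out ::
    "nat \<Rightarrow> (nat \<Rightarrow> mso) \<Rightarrow> (nat \<Rightarrow> mso) \<Rightarrow> (nat \<Rightarrow> nat \<Rightarrow> mso) \<Rightarrow> nat \<Rightarrow> nat \<Rightarrow> mso" where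
  "fm_singles_out m B A R c a =
     Exists (m+4) (Conj (B (m+4)) (Conj (R c (m+4)) (Conj (R a (m+4))
       (Forall (m+5) (Impl (A (m+5)) (Impl (Neg (Equal (m+5) a)) (Neg (R (m+5) (m+4)))))))))"

definition fm_private :: "nat \<Rightarrow> (nat \<Rightarrow> mso) \<Rightarrow> mso" where
  "fm_private m Q =
     Forall m (Impl (Q m) (Exists (m+1) (Conj (Neg (Q (m+1)))
       (Forall (m+2) (Impl (Q (m+2)) (Iff (Adj (m+1) (m+2)) (Equal (m+2) m)))))))"

definition fm_matrix :: "nat \<Rightarrow> nat \<Rightarrow> mso" where
  "fm_matrix J r =
     (let m = 3*J; Q = fm_layer J r; M = fm_marked; \<rho> = fm_reach J r (Suc r) in
       Conj (fm_separates m (Q 0)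
           (\<lambda>x. Conj (Neg (Q (r - 1) x)) (fm_conj (map (\<lambda>\<tau>. Neg (Equal x \<tau>)) [0..<m])))
           (\<lambda>x u. \<rho> u x))
         (Conj (fm_private m (Q (r - 1)))
           (fm_conj (map (\<lambda>i. Conj (fm_shatters m (M i) (\<lambda>x. Equal x x) (\<lambda>x u. \<rho> u x))
             (Conj (Conj (fm_separates m (M (J + i)) (M i) \<rho>) (fm_shatters m (M (J + i)) (M i) \<rho>))
               (Conj (fm_separates m (M (2*J + i)) (M (J + i)) (fm_singles_out m (M i) (M (J + i)) \<rho>))
                 (fm_shatters m (M (2*J + i)) (M (J + i)) (fm_singles_out m (M i) (M (J + i)) \<rho>)))))
             [0..<J]))))"

definition fm_code :: "nat \<Rightarrow> nat \<Rightarrow> mso" where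
  "fm_code J r = foldr ExistsSet [0..<r] (foldr Exists [0..<3*J] (fm_matrix J r))"

text \<open>\<open>defines_set\<close> and \<open>defines_rel\<close>: the meaning of a formula with the parameter values \<open>v\<close> plugged
  in, as long as its free scratch variables avoid those it binds.\<close>

definition defines_set ::
    "'v graph \<Rightarrow> (nat \<Rightarrow> 'v set) \<Rightarrow> (nat \<Rightarrow> 'v) \<Rightarrow> nat \<Rightarrow> (nat \<Rightarrow> mso) \<Rightarrow> 'v set \<Rightarrow> bool" where
  "defines_set G A v m F X \<longleftrightarrow>
     (\<forall>a x. (\<forall>\<tau><m. a \<tau> = v \<tau>) \<longrightarrow> m \<le> x \<longrightarrow> a x \<in> verts G \<longrightarrow> (sat G a A (F x) \<longleftrightarrow> a x \<in> X))"

definition defines_rel ::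
    "'v graph \<Rightarrow> (nat \<Rightarrow> 'v set) \<Rightarrow> (nat \<Rightarrow> 'v) \<Rightarrow> nat \<Rightarrow> nat \<Rightarrow> (nat \<Rightarrow> nat \<Rightarrow> mso) \<Rightarrow> ('v \<Rightarrow> 'v \<Rightarrow> bool) \<Rightarrow> bool"
  where
  "defines_rel G A v m b F R \<longleftrightarrow>
     (\<forall>a x y. (\<forall>\<tau><m. a \<tau> = v \<tau>) \<longrightarrow> x \<in> {m..<m+b} \<longrightarrow> y \<in> {m..<m+b} \<longrightarrow>
        a x \<in> verts G \<longrightarrow> a y \<in> verts G \<longrightarrow> (sat G a A (F x y) \<longleftrightarrow> R (a x) (a y)))"

section \<open>Meaning of the formulas under an assignment\<close>

lemma defines_setD:
  "defines_set G A v m F X \<Longrightarrow> (\<And>\<tau>. \<tau> < m \<Longrightarrow> a \<tau> = v \<tau>) \<Longrightarrow> m \<le> x \<Longrightarrow> a x \<in> verts G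
    \<Longrightarrow> sat G a A (F x) \<longleftrightarrow> a x \<in> X"
  unfolding defines_set_def by blast

lemma defines_relD:
  "defines_rel G A v m b F R \<Longrightarrow> (\<And>\<tau>. \<tau> < m \<Longrightarrow> a \<tau> = v \<tau>) \<Longrightarrow> m \<le> x \<Longrightarrow> x < m + b \<Longrightarrow>
    m \<le> y \<Longrightarrow> y < m + b \<Longrightarrow> a x \<in> verts G \<Longrightarrow> a y \<in> verts G
    \<Longrightarrow> sat G a A (F x y) \<longleftrightarrow> R (a x) (a y)"
  unfolding defines_rel_def by (meson atLeastLessThan_iff)

lemma defines_rel_swap: "defines_rel G A v m b F R \<Longrightarrow> defines_rel G A v m b (\<lambda>x y. F y x) (\<lambda>x y. R y x)"
  unfolding defines_rel_def by blast

lemma defines_rel_mono: "defines_rel G A v m b F R \<Longrightarrow> c \<le> b \<Longrightarrow> defines_rel G A v m c F R"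
  unfolding defines_rel_def by fastforce

lemma sat_fm_separates:
  assumes "defines_set G A v m W W'" "defines_set G A v m Z Z'" "defines_rel G A v m 4 R R'"
    and "W' \<subseteq> verts G" "Z' \<subseteq> verts G" and "\<And>\<tau>. \<tau> < m \<Longrightarrow> a \<tau> = v \<tau>"
  shows "sat G a A (fm_separates m W Z R) \<longleftrightarrow> separates W' Z' R'"
proof -
  have "sat G a A (fm_separates m W Z R) \<longleftrightarrow>
      (\<forall>z\<in>verts G. z \<in> Z' \<longrightarrow> (\<forall>z'\<in>verts G. z' \<in> Z' \<longrightarrow> z \<noteq> z' \<longrightarrow>
        (\<exists>w\<in>verts G. w \<in> W' \<and> R' w z \<noteq> R' w z')))"
    unfolding fm_separates_def using assms(6)
    by (simp add: defines_setD[OF assms(1)] defines_setD[OF assms(2)] defines_relD[OF assms(3)]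
      cong: ball_cong bex_cong conj_cong imp_cong)
  then show ?thesis unfolding separates_def using assms(4,5) by blast
qed

lemma sat_fm_shatters:
  assumes "defines_set G A v m W W'" "defines_set G A v m Z Z'" "defines_rel G A v m 4 R R'"
    and "W' \<subseteq> verts G" "Z' \<subseteq> verts G" and "\<And>\<tau>. \<tau> < m \<Longrightarrow> a \<tau> = v \<tau>"
  shows "sat G a A (fm_shatters m W Z R) \<longleftrightarrow> shatters W' Z' R'"
proof -
  have "sat G a A (fm_shatters m W Z R) \<longleftrightarrow>
      (\<exists>z\<in>verts G. z \<in> Z' \<and> (\<forall>w\<in>verts G. w \<in> W' \<longrightarrow> \<not> R' w z)) \<and>
      (\<forall>z\<in>verts G. z \<in> Z' \<longrightarrow> (\<forall>w\<in>verts G. w \<in> W' \<longrightarrow> (\<exists>z'\<in>verts G. z' \<in> Z' \<and> R' w z' \<and>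
        (\<forall>w'\<in>verts G. w' \<in> W' \<longrightarrow> w' \<noteq> w \<longrightarrow> R' w' z' = R' w' z))))"
    unfolding fm_shatters_def using assms(6)
    by (simp add: defines_setD[OF assms(1)] defines_setD[OF assms(2)] defines_relD[OF assms(3)]
      cong: ball_cong bex_cong conj_cong imp_cong)
  moreover have "(\<exists>z\<in>verts G. z \<in> Z' \<and> (\<forall>w\<in>verts G. w \<in> W' \<longrightarrow> \<not> R' w z)) \<longleftrightarrow> (\<exists>z\<in>Z'. \<forall>w\<in>W'. \<not> R' w z)"
    using assms(4,5) by blast
  moreover have "(\<forall>w'\<in>verts G. w' \<in> W' \<longrightarrow> w' \<noteq> w \<longrightarrow> R' w' z' = R' w' z) \<longleftrightarrow>
      (\<forall>w'\<in>W'. w' \<noteq> w \<longrightarrow> R' w' z' = R' w' z)" for w z z'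
    using assms(4) by blast
  moreover have "(\<forall>w\<in>verts G. w \<in> W' \<longrightarrow> P w) \<longleftrightarrow> (\<forall>w\<in>W'. P w)" "(\<forall>z\<in>verts G. z \<in> Z' \<longrightarrow> P z) \<longleftrightarrow> (\<forall>z\<in>Z'. P z)"
      "(\<exists>z\<in>verts G. z \<in> Z' \<and> P z) \<longleftrightarrow> (\<exists>z\<in>Z'. P z)" for P
    using assms(4,5) by blast+
  ultimately show ?thesis unfolding shatters_def by simp
qed


lemma sat_fm_private:
  assumes "defines_set G A v m Q Q'" "Q' \<subseteq> verts G" "\<And>\<tau>. \<tau> < m \<Longrightarrow> a \<tau> = v \<tau>"
  shows "sat G a A (fm_private m Q) \<longleftrightarrow>
    (\<forall>z\<in>Q'. \<exists>y\<in>verts G - Q'. \<forall>z'\<in>Q'. adjacent G y z' \<longleftrightarrow> z' = z)"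
proof -
  have "sat G a A (fm_private m Q) \<longleftrightarrow> (\<forall>z\<in>verts G. z \<in> Q' \<longrightarrow> (\<exists>y\<in>verts G. y \<notin> Q' \<and>
      (\<forall>z'\<in>verts G. z' \<in> Q' \<longrightarrow> adjacent G y z' = (z' = z))))"
    unfolding fm_private_def using assms(3)
    by (simp add: defines_setD[OF assms(1)] adjacent_def
      cong: ball_cong bex_cong conj_cong imp_cong)
  then show ?thesis using assms(2) by blast
qed

text \<open>The window shrinks from 6 to 4: its two top variables are bound here, and only the
  remaining four may be passed as arguments.\<close>

lemma defines_singles_out:
  assumes "defines_set G A v m B B'" "defines_set G A v m C C'" "defines_rel G A v m 6 R R'"
    and "B' \<subseteq> verts G" "C' \<subseteq> verts G"
  shows "defines_rel G A v m 4 (fm_singles_out m B C R) (singles_out B' C' R')"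
  unfolding defines_rel_def
proof (intro allI impI)
  fix a x y
  assume a: "\<forall>\<tau><m. a \<tau> = v \<tau>" and xy: "x \<in> {m..<m + 4}" "y \<in> {m..<m + 4}"
    and V: "a x \<in> verts G" "a y \<in> verts G"
  have "sat G a A (fm_singles_out m B C R x y) \<longleftrightarrow>
      (\<exists>z\<in>verts G. z \<in> B' \<and> R' (a x) z \<and> R' (a y) z \<and>
        (\<forall>c\<in>verts G. c \<in> C' \<longrightarrow> c \<noteq> a y \<longrightarrow> \<not> R' c z))"
    unfolding fm_singles_out_def using a xy V
    by (simp add: defines_setD[OF assms(1)] defines_setD[OF assms(2)] defines_relD[OF assms(3)]
      cong: ball_cong bex_cong conj_cong imp_cong)
  then show "sat G a A (fm_singles_out m B C R x y) = singles_out B' C' R' (a x) (a y)"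
    unfolding singles_out_def using assms(4,5) by blast
qed

lemma defines_marked:
  assumes "\<tau> < m" shows "defines_set G A v m (fm_marked \<tau>) (marked G A v \<tau>)"
  using assms unfolding defines_set_def fm_marked_def marked_def adjacent_def by auto

lemma defines_layer:
  assumes "m = 3 * J" shows "defines_set G A v m (fm_layer J r j) (layer G A v J r j)"
  using assms unfolding defines_set_def fm_layer_def layer_def fm_marked_def marked_def adjacent_def
  by auto

lemma layer_subset: "layer G A v J r j \<subseteq> verts G"
  unfolding layer_def marked_def by auto

text \<open>Path variables are bound in descending order. The current endpoint \<open>y\<close> is
  thus a scratch variable or a path variable above all those still to be bound, and no later
  quantifier captures it.\<close>

lemma sat_fm_reach:
  assumes "\<And>\<tau>. \<tau> < 3*J \<Longrightarrow> a \<tau> = v \<tau>" "x \<in> {3*J..<3*J+10}" "y \<in> {3*J..<3*J+10} \<union> {3*J+10+j..}"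
    and "a x \<in> verts G" "a y \<in> verts G"
  shows "sat G a A (fm_reach J r j y x) \<longleftrightarrow> reach G (layer G A v J r) j (a y) (a x)"
  using assms
proof (induction j arbitrary: y a)
  case 0
  then show ?case by simp
next
  case (Suc j)
  let ?w = "3*J+10+j"
  have ne: "y \<noteq> ?w" "x \<noteq> ?w" using Suc.prems(2,3) by auto
  have "sat G (a(?w := w)) A (fm_reach J r j ?w x) \<longleftrightarrow> reach G (layer G A v J r) j w (a x)"
    if "w \<in> verts G" for w
    using Suc.prems that ne by (subst Suc.IH) auto
  moreover have "sat G (a(?w := w)) A (fm_layer J r j ?w) \<longleftrightarrow> w \<in> layer G A v J r j"
    if "w \<in> verts G" for w
    using defines_setD[OF defines_layer[OF refl], of J "a(?w := w)" v ?w G A r j] Suc.prems(1) that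
    by simp
  ultimately show ?case
    using ne layer_subset[of G A v J r j] by (auto simp: adjacent_def)
qed

lemma defines_reach:
  "defines_rel G A v (3*J) 10 (fm_reach J r j) (reach G (layer G A v J r) j)"
  unfolding defines_rel_def
proof (intro allI impI)
  fix a x y
  assume "\<forall>\<tau><3*J. a \<tau> = v \<tau>" "x \<in> {3*J..<3*J+10}" "y \<in> {3*J..<3*J+10}"
    "a x \<in> verts G" "a y \<in> verts G"
  then show "sat G a A (fm_reach J r j x y) = reach G (layer G A v J r) j (a x) (a y)"
    by (intro sat_fm_reach) auto
qed

lemma sat_fm_matrix:
  assumes a: "\<And>\<tau>. \<tau> < 3*J \<Longrightarrow> a \<tau> = v \<tau>"
  shows "sat G a A (fm_matrix J r) \<longleftrightarrow> encodes G A v J r"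
proof -
  define m where "m = 3 * J"
  define Q where "Q = layer G A v J r"
  define M where "M = marked G A v"
  define \<rho> where "\<rho> = reach G Q (Suc r)"
  define \<rho>' where "\<rho>' = fm_reach J r (Suc r)"
  note defs = m_def[symmetric] Q_def[symmetric] M_def[symmetric] \<rho>_def[symmetric] \<rho>'_def[symmetric]
  have a': "\<And>\<tau>. \<tau> < m \<Longrightarrow> a \<tau> = v \<tau>" using a m_def by simp
  have DQ: "defines_set G A v m (fm_layer J r j) (Q j)" for j
    unfolding m_def Q_def by (rule defines_layer) simp
  have DM: "defines_set G A v m (fm_marked \<tau>) (M \<tau>)" if "\<tau> < m" for \<tau>
    unfolding M_def by (rule defines_marked[OF that])
  have D10: "defines_rel G A v m 10 \<rho>' \<rho>"
    unfolding m_def Q_def \<rho>_def \<rho>'_def by (rule defines_reach)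
  note D4 = defines_rel_mono[OF D10, of 4, simplified] and D6 = defines_rel_mono[OF D10, of 6, simplified]
  have Qs: "Q j \<subseteq> verts G" for j unfolding Q_def by (rule layer_subset)
  have Ms: "M \<tau> \<subseteq> verts G" for \<tau> unfolding M_def marked_def by auto
  have DV: "defines_set G A v m (\<lambda>x. Equal x x) (verts G)" unfolding defines_set_def by simp
  have DU: "defines_set G A v m (\<lambda>x. Conj (Neg (fm_layer J r (r - 1) x))
      (fm_conj (map (\<lambda>\<tau>. Neg (Equal x \<tau>)) [0..<m]))) (verts G - Q (r - 1) - v ` {..<m})"
    unfolding defines_set_def
  proof (intro allI impI)
    fix b x assume b: "\<forall>\<tau><m. b \<tau> = v \<tau>" and x: "m \<le> x" "b x \<in> verts G"
    have "sat G b A (fm_layer J r (r - 1) x) \<longleftrightarrow> b x \<in> Q (r - 1)"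
      using b x by (intro defines_setD[OF DQ]) auto
    then show "sat G b A (Conj (Neg (fm_layer J r (r - 1) x)) (fm_conj (map (\<lambda>\<tau>. Neg (Equal x \<tau>)) [0..<m])))
      \<longleftrightarrow> b x \<in> verts G - Q (r - 1) - v ` {..<m}"
      using b x by auto
  qed
  have i: "sat G a A (fm_shatters m (fm_marked i) (\<lambda>x. Equal x x) (\<lambda>x u. \<rho>' u x))
        \<longleftrightarrow> shatters (M i) (verts G) (\<lambda>x u. \<rho> u x)"
      "sat G a A (fm_separates m (fm_marked (J + i)) (fm_marked i) \<rho>') \<longleftrightarrow> separates (M (J + i)) (M i) \<rho>"
      "sat G a A (fm_shatters m (fm_marked (J + i)) (fm_marked i) \<rho>') \<longleftrightarrow> shatters (M (J + i)) (M i) \<rho>"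
      "sat G a A (fm_separates m (fm_marked (2*J + i)) (fm_marked (J + i))
          (fm_singles_out m (fm_marked i) (fm_marked (J + i)) \<rho>'))
        \<longleftrightarrow> separates (M (2*J + i)) (M (J + i)) (singles_out (M i) (M (J + i)) \<rho>)"
      "sat G a A (fm_shatters m (fm_marked (2*J + i)) (fm_marked (J + i))
          (fm_singles_out m (fm_marked i) (fm_marked (J + i)) \<rho>'))
        \<longleftrightarrow> shatters (M (2*J + i)) (M (J + i)) (singles_out (M i) (M (J + i)) \<rho>)"
    if "i < J" for i
  proof -
    have lt: "i < m" "J + i < m" "2*J + i < m" using that unfolding m_def by auto
    note S = defines_singles_out[OF DM[OF lt(1)] DM[OF lt(2)] D6 Ms Ms]
    show "sat G a A (fm_shatters m (fm_marked i) (\<lambda>x. Equal x x) (\<lambda>x u. \<rho>' u x))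
        \<longleftrightarrow> shatters (M i) (verts G) (\<lambda>x u. \<rho> u x)"
      by (rule sat_fm_shatters[OF DM[OF lt(1)] DV defines_rel_swap[OF D4] Ms order_refl a'])
    show "sat G a A (fm_separates m (fm_marked (J + i)) (fm_marked i) \<rho>') \<longleftrightarrow> separates (M (J + i)) (M i) \<rho>"
      by (rule sat_fm_separates[OF DM[OF lt(2)] DM[OF lt(1)] D4 Ms Ms a'])
    show "sat G a A (fm_shatters m (fm_marked (J + i)) (fm_marked i) \<rho>') \<longleftrightarrow> shatters (M (J + i)) (M i) \<rho>"
      by (rule sat_fm_shatters[OF DM[OF lt(2)] DM[OF lt(1)] D4 Ms Ms a'])
    show "sat G a A (fm_separates m (fm_marked (2*J + i)) (fm_marked (J + i))
          (fm_singles_out m (fm_marked i) (fm_marked (J + i)) \<rho>'))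
        \<longleftrightarrow> separates (M (2*J + i)) (M (J + i)) (singles_out (M i) (M (J + i)) \<rho>)"
      by (rule sat_fm_separates[OF DM[OF lt(3)] DM[OF lt(2)] S Ms Ms a'])
    show "sat G a A (fm_shatters m (fm_marked (2*J + i)) (fm_marked (J + i))
          (fm_singles_out m (fm_marked i) (fm_marked (J + i)) \<rho>'))
        \<longleftrightarrow> shatters (M (2*J + i)) (M (J + i)) (singles_out (M i) (M (J + i)) \<rho>)"
      by (rule sat_fm_shatters[OF DM[OF lt(3)] DM[OF lt(2)] S Ms Ms a'])
  qed
  have sep: "sat G a A (fm_separates m (fm_layer J r 0) (\<lambda>x. Conj (Neg (fm_layer J r (r - 1) x))
      (fm_conj (map (\<lambda>\<tau>. Neg (Equal x \<tau>)) [0..<m]))) (\<lambda>x u. \<rho>' u x))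
    \<longleftrightarrow> separates (Q 0) (verts G - Q (r - 1) - v ` {..<m}) (\<lambda>x u. \<rho> u x)"
    by (rule sat_fm_separates[OF DQ DU defines_rel_swap[OF D4] Qs _ a']) auto
  have priv: "sat G a A (fm_private m (fm_layer J r (r - 1))) \<longleftrightarrow>
      (\<forall>z\<in>Q (r - 1). \<exists>y\<in>verts G - Q (r - 1). \<forall>z'\<in>Q (r - 1). adjacent G y z' \<longleftrightarrow> z' = z)"
    by (rule sat_fm_private[OF DQ Qs a'])
  show ?thesis
    unfolding fm_matrix_def encodes_def Let_def defs sat.simps(5) sep priv sat_fm_conj
    by (simp add: i atLeast0LessThan) (unfold Ball_def lessThan_iff, rule refl)
qed

section \<open>Free variables and first-order shape of the matrix\<close>

lemma first_order_fm_reach: "first_order (fm_reach J r j y x)"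
  by (induction j arbitrary: y) (auto simp: fm_layer_def fm_marked_def)

lemma free_set_vars_fm_layer: "0 < r \<Longrightarrow> j \<le> r \<Longrightarrow> free_set_vars (fm_layer J r j x) \<subseteq> {..<r}"
  by (auto simp: fm_layer_def fm_marked_def)

lemma free_set_vars_fm_reach: "0 < r \<Longrightarrow> j \<le> Suc r \<Longrightarrow> free_set_vars (fm_reach J r j y x) \<subseteq> {..<r}"
proof (induction j arbitrary: y)
  case (Suc j)
  then show ?case using free_set_vars_fm_layer[of r j J "3*J+10+j"] by simp
qed simp

lemma free_vars_fm_layer: "0 < J \<Longrightarrow> free_vars (fm_layer J r j x) \<subseteq> insert x {..<3*J}"
  by (auto simp: fm_layer_def fm_marked_def free_vars_fm_conj free_vars_fm_disj)

lemma free_vars_fm_reach: "0 < J \<Longrightarrow> free_vars (fm_reach J r j y x) \<subseteq> {y, x} \<union> {..<3*J}"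
proof (induction j arbitrary: y)
  case (Suc j)
  then show ?case using free_vars_fm_layer[of J r j "3*J+10+j"] by fastforce
qed auto

lemma first_order_fm_matrix: "first_order (fm_matrix J r)"
  unfolding fm_matrix_def Let_def fm_separates_def fm_shatters_def fm_private_def fm_singles_out_def
  by (auto simp: first_order_fm_reach fm_layer_def fm_marked_def simp del: fm_reach.simps)

lemma free_set_vars_fm_matrix: "0 < r \<Longrightarrow> free_set_vars (fm_matrix J r) \<subseteq> {..<r}"
  unfolding fm_matrix_def Let_def fm_separates_def fm_shatters_def fm_private_def fm_singles_out_def
  using free_set_vars_fm_reach[of r "Suc r" J] free_set_vars_fm_layer[of r 0 J]
    free_set_vars_fm_layer[of r "r - 1" J]
  by (auto simp: fm_marked_def simp del: fm_reach.simps)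

lemma free_vars_subsetI:
  "free_vars \<phi> \<subseteq> S \<Longrightarrow> free_vars (Neg \<phi>) \<subseteq> S"
  "free_vars \<phi> \<subseteq> S \<Longrightarrow> free_vars \<psi> \<subseteq> S \<Longrightarrow> free_vars (Conj \<phi> \<psi>) \<subseteq> S"
  "free_vars \<phi> \<subseteq> S \<Longrightarrow> free_vars \<psi> \<subseteq> S \<Longrightarrow> free_vars (Impl \<phi> \<psi>) \<subseteq> S"
  "free_vars \<phi> \<subseteq> S \<Longrightarrow> free_vars \<psi> \<subseteq> S \<Longrightarrow> free_vars (Iff \<phi> \<psi>) \<subseteq> S"
  "free_vars \<phi> \<subseteq> insert x S \<Longrightarrow> free_vars (Forall x \<phi>) \<subseteq> S"
  "free_vars \<phi> \<subseteq> insert x S \<Longrightarrow> free_vars (Exists x \<phi>) \<subseteq> S"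
  "x \<in> S \<Longrightarrow> y \<in> S \<Longrightarrow> free_vars (Equal x y) \<subseteq> S"
  "x \<in> S \<Longrightarrow> y \<in> S \<Longrightarrow> free_vars (Adj x y) \<subseteq> S"
  "0 \<in> S \<Longrightarrow> (\<And>i. i \<in> set is \<Longrightarrow> free_vars (F i) \<subseteq> S) \<Longrightarrow> free_vars (fm_conj (map F is)) \<subseteq> S"
  by (auto simp: free_vars_fm_conj)

lemma free_vars_fm_matrix:
  assumes "0 < J" shows "free_vars (fm_matrix J r) \<subseteq> {..<3*J}"
proof -
  have R: "free_vars (fm_reach J r j y x) \<subseteq> S" if "{..<3*J} \<subseteq> S" "y \<in> S" "x \<in> S" for j y x S
    using free_vars_fm_reach[OF assms, of r j y x] that by blast
  have L: "free_vars (fm_layer J r j x) \<subseteq> S" if "{..<3*J} \<subseteq> S" "x \<in> S" for j x S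
    using free_vars_fm_layer[OF assms, of r j x] that by blast
  have M: "free_vars (fm_marked \<tau> x) \<subseteq> S" if "{..<3*J} \<subseteq> S" "\<tau> < 3*J" "x \<in> S" for \<tau> x S
    using that by (auto simp: fm_marked_def)
  show ?thesis
    unfolding fm_matrix_def Let_def fm_separates_def fm_shatters_def fm_private_def fm_singles_out_def
    by (intro free_vars_subsetI R L M) (use assms in auto)
qed

section \<open>The quantifier prefix\<close>

lemma foldr_Exists:
  "sat G a A (foldr Exists xs \<phi>) \<longleftrightarrow>
    (\<exists>b. (\<forall>x. x \<notin> set xs \<longrightarrow> b x = a x) \<and> (\<forall>x\<in>set xs. b x \<in> verts G) \<and> sat G b A \<phi>)"
proof (induction xs arbitrary: a)
  case Nil
  have "b = a" if "\<forall>x. b x = a x" for b using that by auto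
  then show ?case by auto
next
  case (Cons y xs)
  show ?case (is "?l \<longleftrightarrow> ?r")
  proof
    assume ?l
    then obtain v b where b: "v \<in> verts G" "\<forall>x. x \<notin> set xs \<longrightarrow> b x = (a(y := v)) x"
        "\<forall>x\<in>set xs. b x \<in> verts G" "sat G b A \<phi>"
      by (auto simp: Cons.IH)
    then have "b y \<in> verts G" by (cases "y \<in> set xs") auto
    then show ?r using b by (intro exI[of _ b]) auto
  next
    assume ?r
    then obtain b where b: "\<forall>x. x \<notin> set (y # xs) \<longrightarrow> b x = a x" "\<forall>x\<in>set (y # xs). b x \<in> verts G"
        "sat G b A \<phi>" by auto
    then have "sat G (a(y := b y)) A (foldr Exists xs \<phi>)"
      unfolding Cons.IH by (intro exI[of _ b]) auto
    then show ?l using b(2) by auto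
  qed
qed

lemma foldr_ExistsSet:
  "sat G a A (foldr ExistsSet Xs \<phi>) \<longleftrightarrow>
    (\<exists>B. (\<forall>X. X \<notin> set Xs \<longrightarrow> B X = A X) \<and> (\<forall>X\<in>set Xs. B X \<subseteq> verts G) \<and> sat G a B \<phi>)"
proof (induction Xs arbitrary: A)
  case Nil
  have "B = A" if "\<forall>X. B X = A X" for B using that by auto
  then show ?case by auto
next
  case (Cons Y Xs)
  show ?case (is "?l \<longleftrightarrow> ?r")
  proof
    assume ?l
    then obtain S B where B: "S \<subseteq> verts G" "\<forall>X. X \<notin> set Xs \<longrightarrow> B X = (A(Y := S)) X"
        "\<forall>X\<in>set Xs. B X \<subseteq> verts G" "sat G a B \<phi>"
      by (auto simp: Cons.IH)
    then have "B Y \<subseteq> verts G" by (cases "Y \<in> set Xs") auto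
    then show ?r using B by (intro exI[of _ B]) auto
  next
    assume ?r
    then obtain B where B: "\<forall>X. X \<notin> set (Y # Xs) \<longrightarrow> B X = A X" "\<forall>X\<in>set (Y # Xs). B X \<subseteq> verts G"
        "sat G a B \<phi>" by auto
    then have "sat G a (A(Y := B Y)) (foldr ExistsSet Xs \<phi>)"
      unfolding Cons.IH by (intro exI[of _ B]) auto
    then show ?l using B(2) by auto
  qed
qed

lemma free_vars_foldr:
  "free_vars (foldr Exists xs \<phi>) = free_vars \<phi> - set xs"
  "free_vars (foldr ExistsSet Xs \<phi>) = free_vars \<phi>"
  "free_set_vars (foldr Exists xs \<phi>) = free_set_vars \<phi>"
  "free_set_vars (foldr ExistsSet Xs \<phi>) = free_set_vars \<phi> - set Xs"
  "first_order (foldr Exists xs \<phi>) = first_order \<phi>"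
  by (induction xs, auto) (induction Xs, auto)+

lemma emso_sentence_fm_code:
  assumes "0 < J" "0 < r" shows "emso_sentence r (fm_code J r)"
  unfolding emso_sentence_def
proof
  show "sentence (fm_code J r)"
    using free_vars_fm_matrix[OF assms(1), of r] free_set_vars_fm_matrix[OF assms(2), of J]
    unfolding sentence_def fm_code_def by (auto simp: free_vars_foldr)
  show "\<exists>Xs \<psi>. length Xs = r \<and> distinct Xs \<and> first_order \<psi> \<and> fm_code J r = foldr ExistsSet Xs \<psi>"
    unfolding fm_code_def
    by (intro exI[of _ "[0..<r]"] exI[of _ "foldr Exists [0..<3*J] (fm_matrix J r)"])
      (simp add: free_vars_foldr first_order_fm_matrix)
qed

lemma models_fm_code:
  assumes "0 < J" "0 < r"
  shows "G \<Turnstile> fm_code J r \<longleftrightarrow>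
    (\<exists>A v. (\<forall>j<r. A j \<subseteq> verts G) \<and> (\<forall>\<tau><3*J. v \<tau> \<in> verts G) \<and> encodes G A v J r)"
    (is "_ \<longleftrightarrow> ?r")
proof -
  have "G \<Turnstile> fm_code J r \<longleftrightarrow> sat G (\<lambda>_. undefined) (\<lambda>_. {}) (fm_code J r)"
    using emso_sentence_fm_code[OF assms] unfolding emso_sentence_def
    by (intro models_iff_sat) auto
  also have "\<dots> \<longleftrightarrow> ?r" (is "?l \<longleftrightarrow> _")
  proof
    assume ?l
    then obtain B b where B: "\<forall>X\<in>set [0..<r]. B X \<subseteq> verts G" "\<forall>x\<in>set [0..<3*J]. b x \<in> verts G"
      and sat: "sat G b B (fm_matrix J r)"
      unfolding fm_code_def foldr_ExistsSet foldr_Exists by blast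
    have "encodes G B b J r" using sat sat_fm_matrix[of J b b G B r] by blast
    then show ?r using B by (intro exI[of _ B] exI[of _ b]) simp
  next
    assume ?r
    then obtain A v where Av: "\<forall>j<r. A j \<subseteq> verts G" "\<forall>\<tau><3*J. v \<tau> \<in> verts G" "encodes G A v J r"
      by blast
    \<comment> \<open>The prefix changes only the variables it quantifies, so the witnesses have to
      agree with the starting assignment elsewhere. The truncation preserves \<open>encodes\<close>,
      which depends on \<open>A j\<close> for \<open>j < r\<close> and on \<open>v \<tau>\<close>
      for \<open>\<tau> < 3 * J\<close>.\<close>
    let ?A = "\<lambda>j. if j < r then A j else {}" and ?v = "\<lambda>\<tau>. if \<tau> < 3*J then v \<tau> else undefined"
    have lay: "layer G ?A v J r j = layer G A v J r j" if "j \<le> r" for j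
      using that assms(2) unfolding layer_def marked_def by auto
    have "reach G (layer G ?A v J r) j = reach G (layer G A v J r) j" if "j \<le> Suc r" for j
      using that
    proof (induction j)
      case (Suc j)
      then show ?case by (intro ext) (simp add: lay)
    qed (auto intro!: ext)
    moreover have "marked G ?A v = marked G A v"
      using assms(2) unfolding marked_def by (intro ext) simp
    ultimately have "encodes G ?A v J r = encodes G A v J r"
      unfolding encodes_def Let_def by (simp only: lay le0 diff_le_self le_refl)
    then have "encodes G ?A v J r" using Av(3) by blast
    then have "sat G ?v ?A (fm_matrix J r)" by (subst sat_fm_matrix[of J ?v v G ?A r]) simp_all
    then have "sat G (\<lambda>_. undefined) ?A (foldr Exists [0..<3*J] (fm_matrix J r))"
      unfolding foldr_Exists using Av(2) by (intro exI[of _ ?v]) simp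
    then show ?l
      unfolding fm_code_def foldr_ExistsSet using Av(1) by (intro exI[of _ ?A]) simp
  qed
  finally show ?thesis .
qed

section \<open>Independence in products of Bernoulli variables\<close>

definition depends_on :: "'e set \<Rightarrow> (('e \<Rightarrow> bool) \<Rightarrow> bool) \<Rightarrow> bool" where
  "depends_on I E \<longleftrightarrow> (\<forall>f g. (\<forall>e\<in>I. f e = g e) \<longrightarrow> E f = E g)"

lemma depends_onI: "(\<And>f g. (\<And>e. e \<in> I \<Longrightarrow> f e = g e) \<Longrightarrow> E f \<Longrightarrow> E g) \<Longrightarrow> depends_on I E"
  unfolding depends_on_def by metis

lemma depends_onD: "depends_on I E \<Longrightarrow> (\<And>e. e \<in> I \<Longrightarrow> f e = g e) \<Longrightarrow> E f = E g"
  unfolding depends_on_def by blast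

lemma depends_on_Not: "depends_on I E \<Longrightarrow> depends_on I (\<lambda>f. \<not> E f)"
  unfolding depends_on_def by blast

lemma depends_on_Ball: "(\<And>x. x \<in> X \<Longrightarrow> depends_on (I x) (E x)) \<Longrightarrow> depends_on (\<Union>x\<in>X. I x) (\<lambda>f. \<forall>x\<in>X. E x f)"
  unfolding depends_on_def by (metis UN_I)

lemma prob_union_le: "measure_pmf.prob M {x. P x \<or> Q x} \<le> measure_pmf.prob M {x. P x} + measure_pmf.prob M {x. Q x}"
proof -
  have "{x. P x \<or> Q x} = {x. P x} \<union> {x. Q x}" by auto
  then show ?thesis by (simp add: measure_Un_le)
qed

lemma prob_Bex_le:
  assumes "finite X" "\<And>x. x \<in> X \<Longrightarrow> measure_pmf.prob M {f. E x f} \<le> \<epsilon> x"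
  shows "measure_pmf.prob M {f. \<exists>x\<in>X. E x f} \<le> (\<Sum>x\<in>X. \<epsilon> x)"
proof -
  have "{f. \<exists>x\<in>X. E x f} = (\<Union>x\<in>X. {f. E x f})" by auto
  then have "measure_pmf.prob M {f. \<exists>x\<in>X. E x f} \<le> (\<Sum>x\<in>X. measure_pmf.prob M {f. E x f})"
    using measure_pmf.finite_measure_subadditive_finite[OF assms(1), of "\<lambda>x. {f. E x f}" M] by simp
  also have "\<dots> \<le> (\<Sum>x\<in>X. \<epsilon> x)" by (rule sum_mono[OF assms(2)])
  finally show ?thesis .
qed

lemma prob_Bex_disjoint:
  assumes "finite X" "\<And>x y f. x \<in> X \<Longrightarrow> y \<in> X \<Longrightarrow> E x f \<Longrightarrow> E y f \<Longrightarrow> x = y"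
  shows "measure_pmf.prob M {f. \<exists>x\<in>X. E x f} = (\<Sum>x\<in>X. measure_pmf.prob M {f. E x f})"
proof -
  have "{f. \<exists>x\<in>X. E x f} = (\<Union>x\<in>X. {f. E x f})" by auto
  moreover have "disjoint_family_on (\<lambda>x. {f. E x f}) X"
    using assms(2) unfolding disjoint_family_on_def by blast
  ultimately show ?thesis
    using measure_pmf.finite_measure_finite_Union[OF assms(1), of "\<lambda>x. {f. E x f}" M] by simp
qed

lemma prob_Not: "measure_pmf.prob M {f. \<not> E f} = 1 - measure_pmf.prob M {f. E f}"
proof -
  have "{f. \<not> E f} = UNIV - {f. E f}" by auto
  then show ?thesis using measure_pmf.prob_compl[of "{f. E f}" M] by simp
qed

locale bernoulli_product =
  fixes A :: "'e set" and p :: real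
  assumes finite_A: "finite A" and p01: "0 \<le> p" "p \<le> 1"
begin

definition M :: "('e \<Rightarrow> bool) pmf" where
  "M = Pi_pmf A False (\<lambda>_. bernoulli_pmf p)"

definition pr :: "(('e \<Rightarrow> bool) \<Rightarrow> bool) \<Rightarrow> real" where
  "pr E = measure_pmf.prob M {f. E f}"

lemma pr_nonneg [simp]: "0 \<le> pr E" and pr_le_1 [simp]: "pr E \<le> 1"
  unfolding pr_def by simp_all

lemma pr_Not: "pr (\<lambda>f. \<not> E f) = 1 - pr E"
  unfolding pr_def by (rule prob_Not)

text \<open>The implication is required only for \<open>f\<close> vanishing off \<open>A\<close>,
  which is almost every \<open>f\<close>. In the graph this makes every edge a pair of
  vertices.\<close>

lemma pr_mono: "(\<And>f. (\<forall>e. e \<notin> A \<longrightarrow> \<not> f e) \<Longrightarrow> E f \<Longrightarrow> F f) \<Longrightarrow> pr E \<le> pr F"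
  unfolding pr_def M_def
  by (intro measure_pmf.finite_measure_mono_AE AE_pmfI)
     (use set_Pi_pmf_subset[OF finite_A, of False "\<lambda>_. bernoulli_pmf p"] in auto)

lemma pr_union_le: "pr (\<lambda>f. E f \<or> F f) \<le> pr E + pr F"
  unfolding pr_def by (rule prob_union_le)

lemma pr_Bex_le:
  "finite X \<Longrightarrow> (\<And>x. x \<in> X \<Longrightarrow> pr (E x) \<le> \<epsilon> x) \<Longrightarrow> pr (\<lambda>f. \<exists>x\<in>X. E x f) \<le> (\<Sum>x\<in>X. \<epsilon> x)"
  unfolding pr_def by (rule prob_Bex_le)

lemma pr_Bex_disjoint:
  "finite X \<Longrightarrow> (\<And>x y f. x \<in> X \<Longrightarrow> y \<in> X \<Longrightarrow> E x f \<Longrightarrow> E y f \<Longrightarrow> x = y) \<Longrightarrow>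
    pr (\<lambda>f. \<exists>x\<in>X. E x f) = (\<Sum>x\<in>X. pr (E x))"
  unfolding pr_def by (rule prob_Bex_disjoint)

text \<open>Splitting the product into the coordinates in \<open>I\<close> and the remaining ones
  turns \<open>E\<close> into an event of the first factor and \<open>F\<close> into one of the
  second.\<close>

lemma pr_conj:
  assumes "depends_on I E" "depends_on J F" "I \<inter> J = {}"
  shows "pr (\<lambda>f. E f \<and> F f) = pr E * pr F"
proof -
  let ?B = "\<lambda>_::'e. bernoulli_pmf p"
  let ?M1 = "Pi_pmf (A \<inter> I) False ?B" and ?M2 = "Pi_pmf (A - I) False ?B"
  define h :: "('e \<Rightarrow> bool) \<times> ('e \<Rightarrow> bool) \<Rightarrow> 'e \<Rightarrow> bool"
    where "h = (\<lambda>(f, g) x. if x \<in> A \<inter> I then f x else g x)"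
  have M: "M = map_pmf h (pair_pmf ?M1 ?M2)"
  proof -
    have "(A \<inter> I) \<union> (A - I) = A" "A \<inter> I \<inter> (A - I) = {}" by auto
    then show ?thesis using Pi_pmf_union[of "A \<inter> I" "A - I" False ?B] finite_A unfolding M_def h_def by simp
  qed
  have supp: "\<not> f e" if "f \<in> set_pmf (Pi_pmf X False ?B)" "e \<notin> X" "X \<subseteq> A" for f e X
    using set_Pi_pmf_subset[of X False ?B] finite_subset[OF that(3) finite_A] that by auto
  have hE: "E (h (f, g)) = E f" and hF: "F (h (f, g)) = F g"
    if "f \<in> set_pmf ?M1" "g \<in> set_pmf ?M2" for f g
    unfolding h_def
    by (rule depends_onD[OF assms(1)] depends_onD[OF assms(2)],
        use supp[OF that(1)] supp[OF that(2)] assms(3) in force)+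
  have split: "pr X = measure_pmf.prob ?M1 Y * measure_pmf.prob ?M2 Z"
    if "\<And>f g. f \<in> set_pmf ?M1 \<Longrightarrow> g \<in> set_pmf ?M2 \<Longrightarrow> X (h (f, g)) \<longleftrightarrow> f \<in> Y \<and> g \<in> Z" for X Y Z
  proof -
    have "pr X = measure_pmf.prob (pair_pmf ?M1 ?M2) ((Y \<inter> set_pmf ?M1) \<times> (Z \<inter> set_pmf ?M2))"
      unfolding pr_def M measure_map_pmf
      by (rule measure_pmf.finite_measure_eq_AE) (use that in \<open>auto intro!: AE_pmfI\<close>)
    also have "\<dots> = measure_pmf.prob ?M1 (Y \<inter> set_pmf ?M1) * measure_pmf.prob ?M2 (Z \<inter> set_pmf ?M2)"
      by (rule measure_pmf_prob_product) (auto intro: countable_subset[OF Int_lower2])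
    finally show ?thesis by (simp add: measure_Int_set_pmf)
  qed
  have "pr (\<lambda>f. E f \<and> F f) = measure_pmf.prob ?M1 {f. E f} * measure_pmf.prob ?M2 {g. F g}"
    by (rule split) (simp only: hE hF mem_Collect_eq)
  moreover have "pr E = measure_pmf.prob ?M1 {f. E f} * measure_pmf.prob ?M2 UNIV"
    by (rule split) (simp only: hE mem_Collect_eq UNIV_I simp_thms)
  moreover have "pr F = measure_pmf.prob ?M1 UNIV * measure_pmf.prob ?M2 {g. F g}"
    by (rule split) (simp only: hF mem_Collect_eq UNIV_I simp_thms)
  ultimately show ?thesis by simp
qed

lemma pr_Ball:
  assumes "finite X" "\<And>x. x \<in> X \<Longrightarrow> depends_on (I x) (E x)"
    and "\<And>x y. x \<in> X \<Longrightarrow> y \<in> X \<Longrightarrow> x \<noteq> y \<Longrightarrow> I x \<inter> I y = {}"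
  shows "pr (\<lambda>f. \<forall>x\<in>X. E x f) = (\<Prod>x\<in>X. pr (E x))"
  using assms
proof (induction X)
  case empty
  then show ?case by (simp add: pr_def)
next
  case (insert x X)
  have "pr (\<lambda>f. E x f \<and> (\<forall>y\<in>X. E y f)) = pr (E x) * pr (\<lambda>f. \<forall>y\<in>X. E y f)"
    by (rule pr_conj[of "I x" _ "\<Union>y\<in>X. I y"]) (use insert in \<open>auto intro!: depends_on_Ball\<close>)
  then show ?case using insert by simp
qed

lemma pr_cylinder:
  assumes "D \<subseteq> A"
  shows "pr (\<lambda>f. \<forall>e\<in>D. f e = g e) = (\<Prod>e\<in>D. if g e then p else 1 - p)"
proof -
  have "pr (\<lambda>f. f e = g e) = (if g e then p else 1 - p)" if "e \<in> A" for e
  proof -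
    have "pr (\<lambda>f. f e = g e) = measure_pmf.prob (map_pmf (\<lambda>f. f e) M) {g e}"
      by (simp add: pr_def vimage_def)
    also have "\<dots> = (if g e then p else 1 - p)"
      unfolding M_def using that finite_A p01 by (simp add: Pi_pmf_component measure_pmf_single)
    finally show ?thesis .
  qed
  moreover have "pr (\<lambda>f. \<forall>e\<in>D. f e = g e) = (\<Prod>e\<in>D. pr (\<lambda>f. f e = g e))"
    by (rule pr_Ball[of D "\<lambda>e. {e}"]) (use assms finite_A finite_subset in \<open>auto intro: depends_onI\<close>)
  ultimately show ?thesis using assms by (simp add: subset_eq)
qed

lemma pr_none_le:
  assumes "finite X" "\<And>x. x \<in> X \<Longrightarrow> depends_on (I x) (E x)"
    and "\<And>x y. x \<in> X \<Longrightarrow> y \<in> X \<Longrightarrow> x \<noteq> y \<Longrightarrow> I x \<inter> I y = {}"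
    and "\<And>x. x \<in> X \<Longrightarrow> \<pi> \<le> pr (E x)"
  shows "pr (\<lambda>f. \<forall>x\<in>X. \<not> E x f) \<le> exp (- \<pi> * card X)"
proof -
  have "pr (\<lambda>f. \<forall>x\<in>X. \<not> E x f) = (\<Prod>x\<in>X. pr (\<lambda>f. \<not> E x f))"
    by (rule pr_Ball[OF assms(1) depends_on_Not[OF assms(2)] assms(3)])
  also have "\<dots> \<le> (\<Prod>x\<in>X. exp (- \<pi>))"
  proof (intro prod_mono conjI)
    fix x assume "x \<in> X"
    then have "1 - pr (E x) \<le> 1 + - \<pi>" using assms(4) by simp
    also have "\<dots> \<le> exp (- \<pi>)" by (rule exp_ge_add_one_self)
    finally show "pr (\<lambda>f. \<not> E x f) \<le> exp (- \<pi>)" unfolding pr_Not .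
  qed simp
  also have "\<dots> = exp (- \<pi> * card X)" by (simp add: exp_of_nat_mult[symmetric] mult.commute)
  finally show ?thesis .
qed

text \<open>Deferred decisions: \<open>E q\<close> says that an exploration ends with outcome \<open>q\<close>, having looked only at the
  coordinates \<open>I q\<close>.\<close>

lemma pr_deferred:
  assumes "finite X" "0 \<le> \<epsilon>" "\<And>q. q \<in> X \<Longrightarrow> depends_on (I q) (E q)"
    and "\<And>q. q \<in> X \<Longrightarrow> \<exists>J. depends_on J (F q) \<and> I q \<inter> J = {}"
    and "\<And>q. q \<in> X \<Longrightarrow> pr (F q) \<le> \<epsilon>"
    and "\<And>q q' f. q \<in> X \<Longrightarrow> q' \<in> X \<Longrightarrow> E q f \<Longrightarrow> E q' f \<Longrightarrow> q = q'"
  shows "pr (\<lambda>f. \<exists>q\<in>X. E q f \<and> F q f) \<le> \<epsilon>"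
proof -
  have "pr (\<lambda>f. \<exists>q\<in>X. E q f \<and> F q f) = (\<Sum>q\<in>X. pr (\<lambda>f. E q f \<and> F q f))"
    by (rule pr_Bex_disjoint) (use assms in auto)
  also have "\<dots> = (\<Sum>q\<in>X. pr (E q) * pr (F q))"
    by (intro sum.cong refl) (metis assms(3,4) pr_conj)
  also have "\<dots> \<le> (\<Sum>q\<in>X. pr (E q) * \<epsilon>)"
    by (intro sum_mono mult_left_mono assms(5)) auto
  also have "\<dots> = pr (\<lambda>f. \<exists>q\<in>X. E q f) * \<epsilon>"
    by (subst pr_Bex_disjoint) (use assms in \<open>auto simp: sum_distrib_right\<close>)
  also have "\<dots> \<le> 1 * \<epsilon>" by (intro mult_right_mono assms(2)) simp
  finally show ?thesis by simp
qed

end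

section \<open>Greedy embedding\<close>

lemma doubleton_in_vertex_pairs: "u \<in> V \<Longrightarrow> v \<in> V \<Longrightarrow> u \<noteq> v \<Longrightarrow> {u, v} \<in> vertex_pairs V"
  unfolding vertex_pairs_def by auto

lemma finite_vertex_pairs: "finite V \<Longrightarrow> finite (vertex_pairs V)"
  unfolding vertex_pairs_def by (rule finite_subset[of _ "Pow V"]) auto

locale random_graph =
  fixes n :: nat and p :: real
  assumes p_bounds: "0 \<le> p" "p \<le> 1"
begin

sublocale bernoulli_product "vertex_pairs {1..n}" p
  using p_bounds by unfold_locales (auto intro: finite_vertex_pairs)

lemma pr_no_neighbour:
  assumes "T \<subseteq> {1..n}" "v \<in> {1..n}" "v \<notin> T"
  shows "pr (\<lambda>f. \<forall>t\<in>T. \<not> f {v, t}) = (1 - p) ^ card T"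
proof -
  have inj: "inj_on (\<lambda>t. {v, t}) T" by (auto simp: inj_on_def doubleton_eq_iff)
  have "(\<lambda>t. {v, t}) ` T \<subseteq> vertex_pairs {1..n}"
    using assms by (auto intro!: doubleton_in_vertex_pairs)
  from pr_cylinder[OF this, of "\<lambda>_. False"] show ?thesis
    by (simp add: card_image[OF inj])
qed

lemma pr_unique_neighbour:
  assumes "N \<subseteq> {1..n}" "B \<subseteq> N" "t \<in> {1..n}" "t \<notin> N"
  shows "pr (\<lambda>f. \<exists>y\<in>B. \<forall>z\<in>N. f {z, t} \<longleftrightarrow> z = y) = card B * (p * (1 - p) ^ (card N - 1))"
proof -
  have fin: "finite N" using finite_subset[OF assms(1)] by simp
  then have finB: "finite B" using finite_subset[OF assms(2)] by simp
  have inj: "inj_on (\<lambda>z. {z, t}) N" by (auto simp: inj_on_def doubleton_eq_iff)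
  have sub: "(\<lambda>z. {z, t}) ` N \<subseteq> vertex_pairs {1..n}"
    using assms by (auto intro!: doubleton_in_vertex_pairs)
  have one: "pr (\<lambda>f. \<forall>z\<in>N. f {z, t} \<longleftrightarrow> z = y) = p * (1 - p) ^ (card N - 1)" if "y \<in> B" for y
  proof -
    have y: "y \<in> N" using that assms by auto
    have eq: "{z, t} = {y, t} \<longleftrightarrow> z = y" for z by (auto simp: doubleton_eq_iff)
    have "pr (\<lambda>f. \<forall>z\<in>N. f {z, t} \<longleftrightarrow> z = y) = (\<Prod>z\<in>N. if z = y then p else 1 - p)"
      using pr_cylinder[OF sub, of "\<lambda>e. e = {y, t}"]
      unfolding Set.ball_simps(9) prod.reindex[OF inj] o_def eq .
    also have "\<dots> = p * (\<Prod>z\<in>N - {y}. if z = y then p else 1 - p)"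
      by (subst prod.remove[OF fin y]) simp
    also have "(\<Prod>z\<in>N - {y}. if z = y then p else 1 - p) = (\<Prod>z\<in>N - {y}. 1 - p)"
      by (rule prod.cong) auto
    also have "\<dots> = (1 - p) ^ (card N - 1)" using y by (simp only: prod_constant card_Diff_singleton)
    finally show ?thesis .
  qed
  have "pr (\<lambda>f. \<exists>y\<in>B. \<forall>z\<in>N. f {z, t} \<longleftrightarrow> z = y) = (\<Sum>y\<in>B. pr (\<lambda>f. \<forall>z\<in>N. f {z, t} \<longleftrightarrow> z = y))"
    by (rule pr_Bex_disjoint[OF finB]) (use assms in blast)
  also have "\<dots> = (\<Sum>y\<in>B. p * (1 - p) ^ (card N - 1))" by (rule sum.cong[OF refl one])
  finally show ?thesis by simp
qed

text \<open>By Bernoulli's inequality the factor \<open>(1 - p) ^ (card N - 1)\<close> is at least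
  \<open>1 - card N * p\<close>, hence at least 1/2.\<close>

lemma pr_unique_neighbour_ge:
  assumes "N \<subseteq> {1..n}" "B \<subseteq> N" "t \<in> {1..n}" "t \<notin> N" "card N * p \<le> 1/2"
  shows "card B * p / 2 \<le> pr (\<lambda>f. \<exists>y\<in>B. \<forall>z\<in>N. f {z, t} \<longleftrightarrow> z = y)"
proof -
  have "(card N - 1) * p \<le> card N * p"
    using p_bounds by (intro mult_right_mono) auto
  then have "1/2 \<le> 1 + real (card N - 1) * (- p)" using assms(5) by simp
  also have "\<dots> \<le> (1 + (- p)) ^ (card N - 1)"
    by (rule Bernoulli_inequality) (use p_bounds in auto)
  finally have "card B * (p * (1/2)) \<le> card B * (p * (1 - p) ^ (card N - 1))"
    using p_bounds by (intro mult_left_mono) auto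
  then show ?thesis using pr_unique_neighbour[OF assms(1-4)] by simp
qed

end

text \<open>Disjoint pools make the embedding injective and keep the pairs examined for one level
  apart from those examined earlier. \<open>chk_small\<close> makes the chance of a unique
  neighbour, lying in \<open>Par c\<close>, at least half the expected number of neighbours in
  \<open>Par c\<close>.\<close>

locale embedding = random_graph +
  fixes C :: "'c set" and lev :: "'c \<Rightarrow> nat" and P :: "'c \<Rightarrow> nat set" and chk Par :: "'c \<Rightarrow> 'c set"
  assumes fin_C: "finite C"
    and P_sub: "c \<in> C \<Longrightarrow> P c \<subseteq> {1..n}"
    and P_ne: "c \<in> C \<Longrightarrow> P c \<noteq> {}"
    and P_disj: "c \<in> C \<Longrightarrow> d \<in> C \<Longrightarrow> c \<noteq> d \<Longrightarrow> P c \<inter> P d = {}"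
    and chk_C: "c \<in> C \<Longrightarrow> chk c \<subseteq> C"
    and chk_lev: "c \<in> C \<Longrightarrow> d \<in> chk c \<Longrightarrow> lev d < lev c"
    and Par_chk: "c \<in> C \<Longrightarrow> Par c \<subseteq> chk c"
    and chk_small: "c \<in> C \<Longrightarrow> card (chk c) * p \<le> 1/2"
begin

text \<open>A candidate \<open>t\<close> for the node \<open>c\<close> is acceptable if, among the images of the nodes in \<open>chk c\<close>, it is
  adjacent to exactly one, and that one is the image of a node in \<open>Par c\<close>. The greedy embedding takes
  the least acceptable vertex of the pool \<open>P c\<close>, so that it is determined by the graph.\<close>

definition acceptable :: "(nat set \<Rightarrow> bool) \<Rightarrow> ('c \<Rightarrow> nat) \<Rightarrow> 'c \<Rightarrow> nat \<Rightarrow> bool" where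
  "acceptable f q c t \<longleftrightarrow> chk c = {} \<or> (\<exists>y\<in>Par c. \<forall>d\<in>chk c. f {q d, t} \<longleftrightarrow> d = y)"

definition greedy :: "nat \<Rightarrow> ('c \<Rightarrow> nat) \<Rightarrow> (nat set \<Rightarrow> bool) \<Rightarrow> bool" where
  "greedy m q f \<longleftrightarrow> (\<forall>c\<in>C. lev c < m \<longrightarrow> q c \<in> P c \<and> acceptable f q c (q c) \<and>
     (\<forall>t\<in>P c. t < q c \<longrightarrow> \<not> acceptable f q c t))"

definition maps :: "nat \<Rightarrow> ('c \<Rightarrow> nat) set" where
  "maps m = PiE {c \<in> C. lev c < m} P"

text \<open>An upper bound for what the exploration reveals: every candidate of a pool counts as
  examined, not only those up to the chosen one.\<close>

definition seen :: "nat \<Rightarrow> ('c \<Rightarrow> nat) \<Rightarrow> nat set set" where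
  "seen m q = {{q d, t} | c d t. c \<in> C \<and> lev c < m \<and> d \<in> chk c \<and> t \<in> P c}"

text \<open>A candidate is acceptable with probability at least \<open>card (Par c) * p / 2\<close>,
  independently for all candidates in the pool. A node without tests cannot fail, its pool being
  nonempty.\<close>

definition failure :: "'c \<Rightarrow> real" where
  "failure c = (if chk c = {} then 0 else exp (- (card (Par c) * p / 2 * card (P c))))"

lemma failure_nonneg: "0 \<le> failure c"
  unfolding failure_def by simp

lemma finite_P: "c \<in> C \<Longrightarrow> finite (P c)" using P_sub finite_subset by blast

lemma finite_maps: "finite (maps m)"
  unfolding maps_def using fin_C finite_P by (intro finite_PiE) auto

lemma mapsD: "q \<in> maps m \<Longrightarrow> c \<in> C \<Longrightarrow> lev c < m \<Longrightarrow> q c \<in> P c"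
  unfolding maps_def by auto

lemma maps_inj: "q \<in> maps m \<Longrightarrow> c \<in> C \<Longrightarrow> d \<in> C \<Longrightarrow> lev c < m \<Longrightarrow> lev d < m \<Longrightarrow> q c = q d \<Longrightarrow> c = d"
  using mapsD[of q m c] mapsD[of q m d] P_disj[of c d] by auto

lemma acceptable_cong: "(\<And>d. d \<in> chk c \<Longrightarrow> q d = q' d) \<Longrightarrow> acceptable f q c t = acceptable f q' c t"
  unfolding acceptable_def by simp

lemma acceptable_depends: "depends_on ((\<lambda>d. {q d, t}) ` chk c) (\<lambda>f. acceptable f q c t)"
  unfolding acceptable_def depends_on_def by simp

lemma greedy_depends: "depends_on (seen m q) (greedy m q)"
proof -
  have "acceptable f q c t = acceptable g q c t"
    if "\<And>e. e \<in> seen m q \<Longrightarrow> f e = g e" "c \<in> C" "lev c < m" "t \<in> P c" for f g c t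
    by (rule depends_onD[OF acceptable_depends]) (use that in \<open>auto simp: seen_def\<close>)
  then show ?thesis unfolding greedy_def by (intro depends_onI) blast
qed

text \<open>Acceptability on a level depends only on the images of lower levels, and the least
  acceptable vertex is unique. Different outcomes are therefore disjoint events, as
  \<open>pr_deferred\<close> requires.\<close>

lemma greedy_unique:
  assumes "q \<in> maps m" "q' \<in> maps m" "greedy m q f" "greedy m q' f" shows "q = q'"
proof -
  have eq: "q c = q' c" if "c \<in> C" "lev c < m" for c
    using that
  proof (induction "lev c" arbitrary: c rule: less_induct)
    case less
    have "acceptable f q c t = acceptable f q' c t" for t
      using less chk_C[OF less(2)] chk_lev[OF less(2)]
      by (intro acceptable_cong) (meson order.strict_trans subsetD)
    then show ?case using assms(3,4) less.prems unfolding greedy_def by (metis linorder_neqE_nat)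
  qed
  show ?thesis
    by (rule PiE_ext[OF assms(1,2)[unfolded maps_def]]) (use eq in auto)
qed

text \<open>With the lower levels fixed, different candidates involve disjoint sets of pairs,
  because the checked images lie outside the pool. So the candidates fail independently.\<close>

lemma pr_no_acceptable:
  assumes q: "q \<in> maps m" and c: "c \<in> C" "lev c = m"
  shows "pr (\<lambda>f. \<forall>t\<in>P c. \<not> acceptable f q c t) \<le> failure c"
proof (cases "chk c = {}")
  case True
  then show ?thesis using P_ne[OF c(1)] unfolding acceptable_def failure_def pr_def by simp
next
  case False
  have lev: "d \<in> C" "lev d < m" if "d \<in> chk c" for d
    using that c chk_C chk_lev by auto
  have out: "q d \<in> {1..n}" "q d \<notin> P c" if "d \<in> chk c" for d
    using mapsD[OF q lev[OF that]] P_sub[OF lev(1)[OF that]] P_disj[OF lev(1)[OF that] c(1)] lev[OF that] c(2)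
    by auto
  have inj: "inj_on q (chk c)" using maps_inj[OF q] lev unfolding inj_on_def by blast
  have "pr (\<lambda>f. \<forall>t\<in>P c. \<not> acceptable f q c t) \<le> exp (- (card (Par c) * p / 2) * card (P c))"
  proof (rule pr_none_le[OF finite_P[OF c(1)] acceptable_depends])
    show "(\<lambda>d. {q d, x}) ` chk c \<inter> (\<lambda>d. {q d, y}) ` chk c = {}"
      if "x \<in> P c" "y \<in> P c" "x \<noteq> y" for x y
      using that out by (auto simp: doubleton_eq_iff)
    fix t assume t: "t \<in> P c"
    have eq: "q d = q y \<longleftrightarrow> d = y" if "y \<in> Par c" "d \<in> chk c" for y d
      using inj_onD[OF inj] that Par_chk[OF c(1)] by blast
    have "(\<exists>y\<in>Par c. \<forall>d\<in>chk c. f {q d, t} \<longleftrightarrow> d = y) \<longleftrightarrow>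
        (\<exists>y\<in>q ` Par c. \<forall>z\<in>q ` chk c. f {z, t} \<longleftrightarrow> z = y)" for f
      by (simp add: eq cong: ball_cong bex_cong)
    then have "acceptable f q c t \<longleftrightarrow> (\<exists>y\<in>q ` Par c. \<forall>z\<in>q ` chk c. f {z, t} \<longleftrightarrow> z = y)" for f
      using False unfolding acceptable_def by auto
    moreover have "card (q ` Par c) * p / 2 \<le> pr (\<lambda>f. \<exists>y\<in>q ` Par c. \<forall>z\<in>q ` chk c. f {z, t} \<longleftrightarrow> z = y)"
      using out t P_sub[OF c(1)] Par_chk[OF c(1)] chk_small[OF c(1)] card_image[OF inj]
      by (intro pr_unique_neighbour_ge) auto
    moreover have "card (q ` Par c) = card (Par c)"
      using card_image[OF inj_on_subset[OF inj Par_chk[OF c(1)]]] .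
    ultimately show "card (Par c) * p / 2 \<le> pr (\<lambda>f. acceptable f q c t)" by simp
  qed
  then show ?thesis using False unfolding failure_def by simp
qed

lemma greedy_extend:
  assumes q: "q \<in> maps m" "greedy m q f"
    and ex: "\<And>c. c \<in> C \<Longrightarrow> lev c = m \<Longrightarrow> \<exists>t\<in>P c. acceptable f q c t"
  shows "\<exists>q\<in>maps (Suc m). greedy (Suc m) q f"
proof -
  define q' where "q' c = (if c \<in> C \<and> lev c = m then LEAST t. t \<in> P c \<and> acceptable f q c t else q c)" for c
  have acc: "acceptable f q' c t = acceptable f q c t" if "c \<in> C" "lev c \<le> m" for c t
    by (rule acceptable_cong) (use that chk_lev[OF that(1)] in \<open>force simp: q'_def\<close>)
  have "q' c \<in> P c \<and> acceptable f q' c (q' c) \<and> (\<forall>t\<in>P c. t < q' c \<longrightarrow> \<not> acceptable f q' c t)"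
    if c: "c \<in> C" "lev c < Suc m" for c
  proof (cases "lev c = m")
    case True
    then have q'c: "q' c = (LEAST t. t \<in> P c \<and> acceptable f q c t)" using c by (simp add: q'_def)
    have "\<exists>t. t \<in> P c \<and> acceptable f q c t" using ex[OF c(1) True] by auto
    then have "q' c \<in> P c \<and> acceptable f q c (q' c)" unfolding q'c by (rule LeastI_ex)
    moreover have "\<not> acceptable f q c t" if "t \<in> P c" "t < q' c" for t
      using not_less_Least[OF that(2)[unfolded q'c]] that(1) by auto
    ultimately show ?thesis using acc c by simp
  next
    case False
    then have "lev c < m" using c by simp
    then show ?thesis using q(2) c acc[OF c(1)] unfolding greedy_def by (simp add: q'_def)
  qed
  moreover have "q' \<in> maps (Suc m)"
    unfolding maps_def
  proof (rule PiE_I)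
    fix c assume "c \<notin> {c \<in> C. lev c < Suc m}"
    then show "q' c = undefined" using q(1) unfolding maps_def q'_def by (auto simp: PiE_def extensional_def)
  qed (use calculation in auto)
  ultimately show ?thesis unfolding greedy_def by blast
qed

text \<open>Candidates of different levels come from different pools, and the image of a lower node
  is no candidate of level \<open>m\<close>. So a pair cannot recur, whichever of its ends is the
  candidate.\<close>

lemma seen_disjoint:
  assumes q: "q \<in> maps m"
  shows "seen m q \<inter> {{q d, t} | c d t. c \<in> C \<and> lev c = m \<and> d \<in> chk c \<and> t \<in> P c} = {}"
proof -
  have False if c: "c \<in> C" "lev c < m" "d \<in> chk c" "t \<in> P c"
    and c': "c' \<in> C" "lev c' = m" "d' \<in> chk c'" "t' \<in> P c'" and eq: "{q d, t} = {q d', t'}" for c d t c' d' t'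
  proof -
    have d: "d \<in> C" "lev d < m"
      using chk_C[OF c(1)] c(3) less_trans[OF chk_lev[OF c(1,3)] c(2)] by auto
    have "q d \<noteq> t'" using mapsD[OF q d] P_disj[OF d(1) c'(1)] c' d by auto
    moreover have "t \<noteq> t'" using P_disj[OF c(1) c'(1)] c c' by auto
    ultimately show False using eq by (auto simp: doubleton_eq_iff)
  qed
  then show ?thesis unfolding seen_def by blast
qed

text \<open>Given the outcome on the levels below \<open>m\<close>, the pairs relevant to level
  \<open>m\<close> are still unexposed. Hence \<open>pr_deferred\<close> bounds the new failures,
  and the bounds add up over the levels.\<close>

lemma pr_no_greedy: "pr (\<lambda>f. \<not> (\<exists>q\<in>maps m. greedy m q f)) \<le> (\<Sum>c\<in>{c \<in> C. lev c < m}. failure c)"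
proof (induction m)
  case 0
  have "(\<lambda>_. undefined) \<in> maps 0" unfolding maps_def by simp
  then have "\<exists>q\<in>maps 0. greedy 0 q f" for f unfolding greedy_def by blast
  then show ?case unfolding pr_def by simp
next
  case (Suc m)
  let ?Cm = "{c \<in> C. lev c = m}"
  let ?F = "\<lambda>q f. \<exists>c\<in>?Cm. \<forall>t\<in>P c. \<not> acceptable f q c t"
  have "pr (\<lambda>f. \<not> (\<exists>q\<in>maps (Suc m). greedy (Suc m) q f)) \<le>
      pr (\<lambda>f. \<not> (\<exists>q\<in>maps m. greedy m q f) \<or> (\<exists>q\<in>maps m. greedy m q f \<and> ?F q f))"
    by (rule pr_mono) (use greedy_extend in blast)
  also have "\<dots> \<le> pr (\<lambda>f. \<not> (\<exists>q\<in>maps m. greedy m q f)) + pr (\<lambda>f. \<exists>q\<in>maps m. greedy m q f \<and> ?F q f)"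
    by (rule pr_union_le)
  also have "pr (\<lambda>f. \<exists>q\<in>maps m. greedy m q f \<and> ?F q f) \<le> (\<Sum>c\<in>?Cm. failure c)"
  proof (rule pr_deferred[OF finite_maps _ greedy_depends _ _ greedy_unique])
    show "0 \<le> (\<Sum>c\<in>?Cm. failure c)" by (simp add: failure_nonneg sum_nonneg)
    fix q assume q: "q \<in> maps m"
    show "pr (?F q) \<le> (\<Sum>c\<in>?Cm. failure c)"
      by (rule pr_Bex_le) (use fin_C pr_no_acceptable[OF q] in auto)
    let ?J = "{{q d, t} | c d t. c \<in> C \<and> lev c = m \<and> d \<in> chk c \<and> t \<in> P c}"
    have "acceptable f q c t = acceptable g q c t"
      if "\<And>e. e \<in> ?J \<Longrightarrow> f e = g e" "c \<in> ?Cm" "t \<in> P c" for f g c t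
      by (rule depends_onD[OF acceptable_depends]) (use that in auto)
    then have "depends_on ?J (?F q)" by (intro depends_onI) blast
    then show "\<exists>J. depends_on J (?F q) \<and> seen m q \<inter> J = {}" using seen_disjoint[OF q] by blast
  qed auto
  also have "pr (\<lambda>f. \<not> (\<exists>q\<in>maps m. greedy m q f)) + (\<Sum>c\<in>?Cm. failure c) \<le>
      (\<Sum>c\<in>{c \<in> C. lev c < m}. failure c) + (\<Sum>c\<in>?Cm. failure c)" using Suc by simp
  also have "\<dots> = (\<Sum>c\<in>{c \<in> C. lev c < m} \<union> ?Cm. failure c)"
    by (rule sum.union_disjoint[symmetric]) (use fin_C in auto)
  also have "{c \<in> C. lev c < m} \<union> ?Cm = {c \<in> C. lev c < Suc m}" by auto
  finally show ?case by simp
qed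

text \<open>\<open>F q\<close> concerns pairs that are unexposed after the whole embedding, so it
  can be estimated as if \<open>q\<close> had been fixed in advance.\<close>

lemma pr_greedy_with:
  assumes "\<And>c. c \<in> C \<Longrightarrow> lev c < m" "0 \<le> \<epsilon>"
    and "\<And>q. q \<in> maps m \<Longrightarrow> \<exists>J. depends_on J (F q) \<and> seen m q \<inter> J = {}"
    and "\<And>q. q \<in> maps m \<Longrightarrow> pr (\<lambda>f. \<not> F q f) \<le> \<epsilon>"
  shows "1 - (\<Sum>c\<in>C. failure c) - \<epsilon> \<le> pr (\<lambda>f. \<exists>q\<in>maps m. greedy m q f \<and> F q f)"
proof -
  have "pr (\<lambda>f. \<not> (\<exists>q\<in>maps m. greedy m q f \<and> F q f)) \<le>
      pr (\<lambda>f. \<not> (\<exists>q\<in>maps m. greedy m q f) \<or> (\<exists>q\<in>maps m. greedy m q f \<and> \<not> F q f))"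
    by (rule pr_mono) blast
  also have "\<dots> \<le> pr (\<lambda>f. \<not> (\<exists>q\<in>maps m. greedy m q f)) + pr (\<lambda>f. \<exists>q\<in>maps m. greedy m q f \<and> \<not> F q f)"
    by (rule pr_union_le)
  also have "pr (\<lambda>f. \<exists>q\<in>maps m. greedy m q f \<and> \<not> F q f) \<le> \<epsilon>"
    by (rule pr_deferred[OF finite_maps assms(2) greedy_depends _ assms(4) greedy_unique])
      (use assms(3) depends_on_Not in blast)+
  also have "{c \<in> C. lev c < m} = C" using assms(1) by auto
  then have "pr (\<lambda>f. \<not> (\<exists>q\<in>maps m. greedy m q f)) \<le> (\<Sum>c\<in>C. failure c)"
    using pr_no_greedy[of m] by simp
  finally show ?thesis unfolding pr_Not by simp
qed

end

section \<open>Forests in the random graph\<close>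

text \<open>\<open>R\<close> is a reserve that meets no pool, so pairs meeting it stay unexposed
  during the embedding. It supplies the code vertices and the private neighbours.\<close>

locale forest = random_graph +
  fixes J k r :: nat and L :: "nat \<Rightarrow> nat" and P :: "nat \<times> nat \<times> nat \<Rightarrow> nat set" and R :: "nat set"
  assumes r_pos: "0 < r" and J_pos: "0 < J" and k_pos: "0 < k"
    and L_0: "L 0 = 1" and L_pos: "\<And>j. 0 < L j"
    and pools: "\<And>c. P c \<subseteq> {1..n} - R" "\<And>c d. c \<noteq> d \<Longrightarrow> P c \<inter> P d = {}"
    and R_sub: "R \<subseteq> {1..n}"
begin

text \<open>Nodes \<open>(0, \<tau>, 0)\<close> are the parameters; \<open>(Suc j, x, l)\<close> is the \<open>l\<close>-th node on layer \<open>j\<close> of the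
  tree with root \<open>(1, x, 0)\<close>. The roots of the \<open>i\<close>-th block are the trees \<open>x\<close> with \<open>x div k = i\<close>.\<close>

definition params :: "(nat \<times> nat \<times> nat) set" where
  "params = (\<lambda>\<tau>. (0, \<tau>, 0)) ` {..<3*J}"

definition level :: "nat \<Rightarrow> (nat \<times> nat \<times> nat) set" where
  "level j = (\<lambda>(x, l). (Suc j, x, l)) ` ({..<J*k} \<times> {..<L j})"

definition tree_level :: "nat \<Rightarrow> nat \<Rightarrow> (nat \<times> nat \<times> nat) set" where
  "tree_level j x = (\<lambda>l. (Suc j, x, l)) ` {..<L j}"

definition nodes :: "(nat \<times> nat \<times> nat) set" where
  "nodes = params \<union> (\<Union>j\<le>r. level j)"

text \<open>A node on layer \<open>j + 1\<close> is tested against layer \<open>j\<close> of all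
  trees, so that its only neighbour there lies in its own tree, and against the parameters, so that
  it has none among them. A root is tested against the parameters alone and gets the one of its
  block.\<close>

fun checked :: "nat \<times> nat \<times> nat \<Rightarrow> (nat \<times> nat \<times> nat) set" where
  "checked (0, x, l) = {}"
| "checked (Suc 0, x, l) = params"
| "checked (Suc (Suc j), x, l) = params \<union> level j"

fun parents :: "nat \<times> nat \<times> nat \<Rightarrow> (nat \<times> nat \<times> nat) set" where
  "parents (0, x, l) = {}"
| "parents (Suc 0, x, l) = {(0, x div k, 0)}"
| "parents (Suc (Suc j), x, l) = tree_level j x"

definition block :: "nat \<Rightarrow> nat set" where
  "block i = {i * k..<(i + 1) * k}"

lemma finite_params: "finite params" unfolding params_def by simp
lemma finite_level: "finite (level j)" unfolding level_def by simp

lemma card_params: "card params = 3 * J"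
  unfolding params_def by (subst card_image) (auto simp: inj_on_def)

lemma card_level: "card (level j) = J * k * L j"
  unfolding level_def by (subst card_image) (auto simp: inj_on_def)

lemma card_tree_level: "card (tree_level j x) = L j"
  unfolding tree_level_def by (subst card_image) (auto simp: inj_on_def)

lemma tree_level_subset: "x < J * k \<Longrightarrow> tree_level j x \<subseteq> level j"
  unfolding tree_level_def level_def by auto

lemma params_nodes: "params \<subseteq> nodes" and level_nodes: "j \<le> r \<Longrightarrow> level j \<subseteq> nodes"
  unfolding nodes_def by auto

lemma tree_level_nodes: "x < J * k \<Longrightarrow> j \<le> r \<Longrightarrow> tree_level j x \<subseteq> nodes"
  using tree_level_subset level_nodes by blast

lemma finite_nodes: "finite nodes"
  unfolding nodes_def using finite_params finite_level by auto

lemma block_iff: "x \<in> block i \<longleftrightarrow> x div k = i"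
proof -
  have "x div k = i \<longleftrightarrow> i \<le> x div k \<and> x div k < i + 1" by auto
  then show ?thesis
    unfolding block_def using k_pos by (simp only: less_eq_div_iff_mult_less_eq div_less_iff_less_mult) simp
qed

lemma block_less: "i < J \<Longrightarrow> x \<in> block i \<Longrightarrow> x < J * k"
  using k_pos by (simp add: block_iff div_less_iff_less_mult[symmetric])

lemma card_block: "card (block i) = k" "finite (block i)"
  unfolding block_def by simp_all

lemma checked_cases:
  assumes "c \<in> nodes"
  obtains "c \<in> params" "checked c = {}" "parents c = {}" "fst c = 0"
  | x where "x < J * k" "c = (Suc 0, x, 0)" "checked c = params" "parents c = {(0, x div k, 0)}" "c \<in> level 0"
  | j x l where "j < r" "x < J * k" "l < L (Suc j)" "c = (Suc (Suc j), x, l)"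
      "checked c = params \<union> level j" "parents c = tree_level j x" "c \<in> level (Suc j)"
proof -
  consider "c \<in> params" | j where "j \<le> r" "c \<in> level j" using assms unfolding nodes_def by auto
  then show ?thesis
  proof cases
    case 1
    then show ?thesis using that(1) unfolding params_def by auto
  next
    case 2
    then show ?thesis
    proof (cases j)
      case 0
      then show ?thesis using 2 that(2) L_0 unfolding level_def by auto
    next
      case (Suc i)
      from 2(2) obtain x l where xl: "c = (Suc j, x, l)" "x < J * k" "l < L j"
        unfolding level_def by auto
      show ?thesis
        by (rule that(3)[of i x l]) (use Suc 2 xl in auto)
    qed
  qed
qed

end

text \<open>\<open>half\<close> is the constant density: a vertex outside the leaves of a given tree
  has no neighbour among them with probability between 1/2 and 4/5. \<open>few\<close> yields the
  smallness condition of the embedding.\<close>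

locale small_forest = forest +
  assumes p_pos: "0 < p"
    and few: "\<And>j. j < r \<Longrightarrow> real (3 * J + J * k * L j) * p \<le> 1/2"
    and pools_ne: "\<And>c. c \<in> nodes \<Longrightarrow> P c \<noteq> {}"
    and half: "1/2 \<le> (1 - p) ^ L r" "(1 - p) ^ L r \<le> 4/5"
begin

lemma few_params: "card params * p \<le> 1/2"
proof -
  have "real (3 * J) * p \<le> real (3 * J + J * k * L 0) * p"
    using p_pos by (intro mult_right_mono) auto
  also have "\<dots> \<le> 1/2" by (rule few[OF r_pos])
  finally show ?thesis unfolding card_params .
qed

sublocale embedding n p nodes fst P checked parents
proof
  show "finite nodes" by (rule finite_nodes)
  fix c assume c: "c \<in> nodes"
  show "P c \<subseteq> {1..n}" using pools(1)[of c] by blast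
  show "P c \<noteq> {}" using pools_ne[OF c] .
  show "P c \<inter> P d = {}" if "c \<noteq> d" for d by (rule pools(2)[OF that])
  from c show "checked c \<subseteq> nodes"
    by (cases rule: checked_cases) (auto simp: nodes_def)
  show "fst d < fst c" if "d \<in> checked c" for d
    using c that by (cases rule: checked_cases) (auto simp: params_def level_def)
  from c show "parents c \<subseteq> checked c"
  proof (cases rule: checked_cases)
    case (2 x)
    then have "x div k < J" by (simp add: less_mult_imp_div_less)
    then show ?thesis using 2 by (auto simp: params_def)
  qed (use tree_level_subset in auto)
  from c show "card (checked c) * p \<le> 1/2"
  proof (cases rule: checked_cases)
    case 2
    then show ?thesis using few_params by simp
  next
    case (3 j x l)
    have "card (checked c) \<le> 3 * J + J * k * L j"
      using card_Un_le[of params "level j"] 3 by (simp add: card_params card_level)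
    then have "card (checked c) * p \<le> real (3 * J + J * k * L j) * p"
      using p_pos by (intro mult_right_mono of_nat_mono) auto
    then show ?thesis using few[OF 3(1)] by linarith
  qed simp
qed

section \<open>Properties of a forest decided by unexposed pairs\<close>

definition graph_of :: "(nat set \<Rightarrow> bool) \<Rightarrow> nat graph" where
  "graph_of f = ({1..n}, {e \<in> vertex_pairs {1..n}. f e})"

definition leaves :: "(nat \<times> nat \<times> nat \<Rightarrow> nat) \<Rightarrow> nat \<Rightarrow> nat set" where
  "leaves q x = q ` tree_level r x"

definition sees :: "(nat \<times> nat \<times> nat \<Rightarrow> nat) \<Rightarrow> (nat set \<Rightarrow> bool) \<Rightarrow> nat \<Rightarrow> nat \<Rightarrow> bool" where
  "sees q f v x \<longleftrightarrow> (\<exists>t\<in>leaves q x. f {v, t})"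

text \<open>The vertices left out are those whose adjacency to the leaves was tested when the leaves
  were placed.\<close>

definition ordinary :: "(nat \<times> nat \<times> nat \<Rightarrow> nat) \<Rightarrow> nat set" where
  "ordinary q = {1..n} - q ` level (r - 1) - q ` params"

definition separated :: "(nat \<times> nat \<times> nat \<Rightarrow> nat) \<Rightarrow> (nat set \<Rightarrow> bool) \<Rightarrow> bool" where
  "separated q f \<longleftrightarrow> (\<forall>v\<in>ordinary q. \<forall>v'\<in>ordinary q. v \<noteq> v' \<longrightarrow> (\<exists>x<J*k. sees q f v x \<noteq> sees q f v' x))"

text \<open>The quantifier over a singleton gives the first conjunct the shape of the event in
  \<open>pr_unique_neighbour_ge\<close>; it says that \<open>a\<close> has the parameter
  \<open>\<tau>\<close> as its only neighbour among the parameters.\<close>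

definition realises :: "(nat \<times> nat \<times> nat \<Rightarrow> nat) \<Rightarrow> (nat set \<Rightarrow> bool) \<Rightarrow> nat \<Rightarrow> nat \<Rightarrow> nat set \<Rightarrow> nat \<Rightarrow> bool" where
  "realises q f i \<tau> X a \<longleftrightarrow> (\<exists>y\<in>{q (0, \<tau>, 0)}. \<forall>z\<in>q ` params. f {z, a} \<longleftrightarrow> z = y) \<and>
     (\<forall>x\<in>block i. sees q f a x \<longleftrightarrow> x \<in> X)"

definition patterned :: "(nat \<times> nat \<times> nat \<Rightarrow> nat) \<Rightarrow> (nat set \<Rightarrow> bool) \<Rightarrow> bool" where
  "patterned q f \<longleftrightarrow> (\<forall>(i, \<tau>, X)\<in>Sigma {..<J} (\<lambda>i. {..<3*J} \<times> Pow (block i)). \<exists>a\<in>R. realises q f i \<tau> X a)"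

definition tagged :: "(nat \<times> nat \<times> nat \<Rightarrow> nat) \<Rightarrow> (nat set \<Rightarrow> bool) \<Rightarrow> bool" where
  "tagged q f \<longleftrightarrow> (\<forall>z\<in>q ` level (r - 1). \<exists>y\<in>R. \<exists>z0\<in>{z}. \<forall>z'\<in>q ` level (r - 1). f {z', y} \<longleftrightarrow> z' = z0)"

context
  fixes q assumes q: "q \<in> maps (Suc (Suc r))"
begin

lemma q_pool: "c \<in> nodes \<Longrightarrow> q c \<in> P c"
proof -
  assume c: "c \<in> nodes"
  then have "fst c < Suc (Suc r)" unfolding nodes_def params_def level_def by auto
  then show "q c \<in> P c" using mapsD[OF q c] by blast
qed

lemma q_range: "c \<in> nodes \<Longrightarrow> q c \<in> {1..n} - R" using q_pool pools(1) by blast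

lemma q_inj: "inj_on q nodes"
  using q_pool pools(2) unfolding inj_on_def by (metis disjoint_iff)

lemma leaves_range: "x < J * k \<Longrightarrow> leaves q x \<subseteq> {1..n} - R"
  unfolding leaves_def using q_range tree_level_nodes[of x r] by blast

lemma leaves_card: "x < J * k \<Longrightarrow> card (leaves q x) = L r"
  unfolding leaves_def using inj_on_subset[OF q_inj tree_level_nodes[of x r]]
  by (simp add: card_image card_tree_level)

lemma leaves_disjoint: "x < J * k \<Longrightarrow> y < J * k \<Longrightarrow> x \<noteq> y \<Longrightarrow> leaves q x \<inter> leaves q y = {}"
proof -
  assume *: "x < J * k" "y < J * k" "x \<noteq> y"
  then have "tree_level r x \<inter> tree_level r y = {}" unfolding tree_level_def by auto
  then show ?thesis unfolding leaves_def
    using inj_on_image_Int[OF q_inj tree_level_nodes[OF *(1) le_refl] tree_level_nodes[OF *(2) le_refl]]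
    by simp
qed

lemma sees_depends: "depends_on ((\<lambda>t. {v, t}) ` leaves q x) (\<lambda>f. sees q f v x)"
  unfolding sees_def depends_on_def by simp

lemma pr_not_sees:
  assumes "x < J * k" "v \<in> {1..n}" "v \<notin> leaves q x"
  shows "pr (\<lambda>f. \<not> sees q f v x) = (1 - p) ^ L r"
  using pr_no_neighbour[of "leaves q x" v] assms leaves_range leaves_card
  unfolding sees_def by auto

text \<open>Two independent events of probability \<open>s\<close> agree with probability
  \<open>1/2 + 2 * (s - 1/2) ^ 2\<close>, which is at most 0.68 for \<open>s\<close> between 1/2 and
  4/5.\<close>

lemma pr_agree:
  assumes x: "x < J * k" and v: "v \<in> {1..n}" "v' \<in> {1..n}" "v \<notin> leaves q x" "v' \<notin> leaves q x" "v \<noteq> v'"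
  shows "pr (\<lambda>f. sees q f v x = sees q f v' x) \<le> 7/10"
proof -
  define s where "s = (1 - p) ^ L r"
  have disj: "(\<lambda>t. {v, t}) ` leaves q x \<inter> (\<lambda>t. {v', t}) ` leaves q x = {}"
    using v by (auto simp: doubleton_eq_iff)
  note ns = pr_not_sees[OF x v(1,3), folded s_def] pr_not_sees[OF x v(2,4), folded s_def]
  have "pr (\<lambda>f. sees q f v x = sees q f v' x) \<le>
      pr (\<lambda>f. (sees q f v x \<and> sees q f v' x) \<or> (\<not> sees q f v x \<and> \<not> sees q f v' x))"
    by (rule pr_mono) blast
  also have "\<dots> \<le> pr (\<lambda>f. sees q f v x \<and> sees q f v' x) + pr (\<lambda>f. \<not> sees q f v x \<and> \<not> sees q f v' x)"
    by (rule pr_union_le)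
  also have "pr (\<lambda>f. sees q f v x \<and> sees q f v' x) = pr (\<lambda>f. sees q f v x) * pr (\<lambda>f. sees q f v' x)"
    by (rule pr_conj[OF sees_depends sees_depends disj])
  also have "\<dots> = (1 - s) * (1 - s)"
  proof -
    have "pr (\<lambda>f. sees q f v x) = 1 - s" "pr (\<lambda>f. sees q f v' x) = 1 - s"
      using ns unfolding pr_Not by linarith+
    then show ?thesis by (simp only:)
  qed
  also have "pr (\<lambda>f. \<not> sees q f v x \<and> \<not> sees q f v' x) = s * s"
    using pr_conj[OF depends_on_Not[OF sees_depends] depends_on_Not[OF sees_depends] disj] ns by simp
  also have "(1 - s) * (1 - s) + s * s \<le> 7/10"
  proof -
    have s: "1/2 \<le> s" "s \<le> 4/5" using half unfolding s_def by simp_all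
    then have "(s - 1/2) * (s - 1/2) \<le> 3/10 * (3/10)" by (intro mult_mono) simp_all
    moreover have "(1 - s) * (1 - s) + s * s = 1/2 + 2 * ((s - 1/2) * (s - 1/2))" by (simp add: field_simps)
    ultimately show ?thesis by simp
  qed
  finally show ?thesis .
qed

text \<open>A union bound over pairs of vertices. For one pair, the comparisons on different trees
  are independent once the at most two trees having one of the vertices as a leaf are dropped; hence
  the exponent \<open>J * k - 2\<close>.\<close>

lemma pr_not_separated: "pr (\<lambda>f. \<not> separated q f) \<le> real n ^ 2 * (7/10) ^ (J * k - 2)"
proof -
  let ?X = "{(v, v'). v \<in> ordinary q \<and> v' \<in> ordinary q \<and> v \<noteq> v'}"
  have one: "pr (\<lambda>f. \<forall>x<J*k. sees q f v x = sees q f v' x) \<le> (7/10) ^ (J * k - 2)"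
    if v: "v \<in> {1..n}" "v' \<in> {1..n}" "v \<noteq> v'" for v v'
  proof -
    define X where "X = {x. x < J * k \<and> v \<notin> leaves q x \<and> v' \<notin> leaves q x}"
    have le1: "card {x. x < J * k \<and> u \<in> leaves q x} \<le> 1" for u
    proof -
      have "x = y" if "x < J * k" "u \<in> leaves q x" "y < J * k" "u \<in> leaves q y" for x y
        using leaves_disjoint[of x y] that by blast
      then show ?thesis by (auto simp: card_le_Suc0_iff_eq)
    qed
    have "{..<J*k} = X \<union> ({x. x < J * k \<and> v \<in> leaves q x} \<union> {x. x < J * k \<and> v' \<in> leaves q x})"
      unfolding X_def by auto
    then have "card {..<J*k} \<le> card X + card ({x. x < J * k \<and> v \<in> leaves q x} \<union> {x. x < J * k \<and> v' \<in> leaves q x})"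
      using card_Un_le by metis
    also have "\<dots> \<le> card X + 2"
      using card_Un_le[of "{x. x < J * k \<and> v \<in> leaves q x}" "{x. x < J * k \<and> v' \<in> leaves q x}"]
        le1[of v] le1[of v'] by linarith
    finally have cX: "J * k - 2 \<le> card X" by simp
    have fX: "finite X" unfolding X_def by simp
    have "pr (\<lambda>f. \<forall>x<J*k. sees q f v x = sees q f v' x) \<le> pr (\<lambda>f. \<forall>x\<in>X. sees q f v x = sees q f v' x)"
      by (rule pr_mono) (auto simp: X_def)
    also have "\<dots> = (\<Prod>x\<in>X. pr (\<lambda>f. sees q f v x = sees q f v' x))"
    proof (rule pr_Ball[OF fX, where I = "\<lambda>x. (\<lambda>t. {v, t}) ` leaves q x \<union> (\<lambda>t. {v', t}) ` leaves q x"])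
      fix x y assume "x \<in> X" "y \<in> X" "x \<noteq> y"
      then show "((\<lambda>t. {v, t}) ` leaves q x \<union> (\<lambda>t. {v', t}) ` leaves q x) \<inter>
          ((\<lambda>t. {v, t}) ` leaves q y \<union> (\<lambda>t. {v', t}) ` leaves q y) = {}"
        using leaves_disjoint[of x y] unfolding X_def by (auto simp: doubleton_eq_iff)
    next
      fix x
      show "depends_on ((\<lambda>t. {v, t}) ` leaves q x \<union> (\<lambda>t. {v', t}) ` leaves q x)
          (\<lambda>f. sees q f v x = sees q f v' x)"
        unfolding sees_def depends_on_def by simp
    qed
    also have "\<dots> \<le> (\<Prod>x\<in>X. 7/10)"
      by (intro prod_mono conjI pr_agree pr_nonneg) (use v in \<open>auto simp: X_def\<close>)
    also have "\<dots> \<le> (7/10) ^ (J * k - 2)"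
      using cX by (simp add: power_decreasing)
    finally show ?thesis .
  qed
  have "?X \<subseteq> {1..n} \<times> {1..n}" unfolding ordinary_def by auto
  from card_mono[OF _ this] have cX: "card ?X \<le> n * n" "finite ?X"
    using finite_subset[OF \<open>?X \<subseteq> {1..n} \<times> {1..n}\<close>] by simp_all
  have "pr (\<lambda>f. \<not> separated q f) \<le> pr (\<lambda>f. \<exists>w\<in>?X. \<forall>x<J*k. sees q f (fst w) x = sees q f (snd w) x)"
    by (rule pr_mono) (auto simp: separated_def)
  also have "\<dots> \<le> (\<Sum>w\<in>?X. (7/10) ^ (J * k - 2))"
  proof (rule pr_Bex_le[OF cX(2)])
    fix w assume "w \<in> ?X"
    then show "pr (\<lambda>f. \<forall>x<J*k. sees q f (fst w) x = sees q f (snd w) x) \<le> (7/10) ^ (J * k - 2)"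
      by (intro one) (auto simp: ordinary_def)
  qed
  also have "\<dots> \<le> real (n * n) * (7/10) ^ (J * k - 2)"
    unfolding sum_constant using cX(1) by (intro mult_right_mono) (auto simp flip: of_nat_mult)
  finally show ?thesis by (simp add: power2_eq_square)
qed

text \<open>The pattern on the parameters has probability at least \<open>p / 2\<close>. Each of the
  \<open>k\<close> roots is seen or missed as prescribed with probability at least 1/5 by
  \<open>half\<close>, and all these events involve different pairs.\<close>

lemma pr_realises:
  assumes i: "i < J" and \<tau>: "\<tau> < 3 * J" and a: "a \<in> R"
  shows "p / 2 * (1/5) ^ k \<le> pr (\<lambda>f. realises q f i \<tau> X a)"
proof -
  let ?s = "\<lambda>x f. sees q f a x \<longleftrightarrow> x \<in> X"
  have a': "a \<in> {1..n}" "a \<notin> leaves q x" if "x \<in> block i" for x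
    using a R_sub leaves_range[OF block_less[OF i that]] by auto
  have aV: "a \<in> {1..n}" "a \<notin> q ` params" using a R_sub q_range params_nodes by auto
  have pq: "q (0, \<tau>, 0) \<in> q ` params" using \<tau> unfolding params_def by blast
  have qp: "q ` params \<subseteq> {1..n}" using q_range params_nodes by blast
  have cp: "card (q ` params) * p \<le> 1/2"
    using card_image[OF inj_on_subset[OF q_inj params_nodes]] few_params by simp
  have pl: "p / 2 \<le> pr (\<lambda>f. \<exists>y\<in>{q (0, \<tau>, 0)}. \<forall>z\<in>q ` params. f {z, a} \<longleftrightarrow> z = y)"
    using pr_unique_neighbour_ge[OF qp, of "{q (0, \<tau>, 0)}" a] pq aV cp by simp
  have disj: "(\<lambda>t. {a, t}) ` leaves q x \<inter> (\<lambda>t. {a, t}) ` leaves q y = {}"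
    if "x \<in> block i" "y \<in> block i" "x \<noteq> y" for x y
    using leaves_disjoint[OF block_less[OF i that(1)] block_less[OF i that(2)] that(3)] a' that
    by (auto simp: doubleton_eq_iff)
  have dep: "depends_on ((\<lambda>t. {a, t}) ` leaves q x) (?s x)" for x
    unfolding sees_def depends_on_def by simp
  have one: "1/5 \<le> pr (?s x)" if "x \<in> block i" for x
  proof -
    have "pr (\<lambda>f. sees q f a x) = 1 - (1 - p) ^ L r" "pr (\<lambda>f. \<not> sees q f a x) = (1 - p) ^ L r"
      using pr_not_sees[OF block_less[OF i that] a'[OF that]] unfolding pr_Not by auto
    then show ?thesis using half by (cases "x \<in> X") simp_all
  qed
  have "(1/5::real) ^ k = (\<Prod>x\<in>block i. 1/5)" by (simp add: card_block)
  also have "\<dots> \<le> (\<Prod>x\<in>block i. pr (?s x))" by (intro prod_mono conjI one) auto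
  also have "\<dots> = pr (\<lambda>f. \<forall>x\<in>block i. ?s x f)"
    by (rule pr_Ball[OF card_block(2) dep disj, symmetric])
  finally have "p / 2 * (1/5) ^ k \<le>
      pr (\<lambda>f. \<exists>y\<in>{q (0, \<tau>, 0)}. \<forall>z\<in>q ` params. f {z, a} \<longleftrightarrow> z = y) * pr (\<lambda>f. \<forall>x\<in>block i. ?s x f)"
    using pl p_pos by (intro mult_mono) auto
  also have "\<dots> = pr (\<lambda>f. realises q f i \<tau> X a)"
    unfolding realises_def
  proof (rule pr_conj[OF _ depends_on_Ball[OF dep], symmetric])
    show "depends_on ((\<lambda>z. {z, a}) ` q ` params) (\<lambda>f. \<exists>y\<in>{q (0, \<tau>, 0)}. \<forall>z\<in>q ` params. f {z, a} \<longleftrightarrow> z = y)"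
      unfolding depends_on_def by simp
    have "q c \<notin> leaves q x" if "c \<in> params" "x \<in> block i" for c x
    proof
      assume "q c \<in> leaves q x"
      then obtain d where d: "d \<in> tree_level r x" "q c = q d" unfolding leaves_def by auto
      then have "c = d"
        using inj_onD[OF q_inj d(2)] that(1) params_nodes tree_level_nodes[OF block_less[OF i that(2)] le_refl]
        by blast
      then show False using that(1) d(1) unfolding params_def tree_level_def by auto
    qed
    then show "(\<lambda>z. {z, a}) ` q ` params \<inter> (\<Union>x\<in>block i. (\<lambda>t. {a, t}) ` leaves q x) = {}"
      using a' by (auto simp: doubleton_eq_iff)
  qed
  finally show ?thesis .
qed

lemma pr_not_patterned: "pr (\<lambda>f. \<not> patterned q f) \<le> real (3 * J\<^sup>2 * 2 ^ k) * exp (- (p / 2 * (1/5) ^ k * card R))"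
proof -
  let ?X = "Sigma {..<J} (\<lambda>i. {..<3*J} \<times> Pow (block i))"
  let ?e = "exp (- (p / 2 * (1/5) ^ k * card R))"
  have fX: "finite ?X" using card_block(2) by auto
  have "card ?X = (\<Sum>i<J. 3 * J * 2 ^ k)"
    using card_block by (subst card_SigmaI) (auto simp: card_cartesian_product card_Pow)
  then have cX: "card ?X = 3 * J\<^sup>2 * 2 ^ k" by (simp add: power2_eq_square)
  have "pr (\<lambda>f. \<not> patterned q f) \<le>
      pr (\<lambda>f. \<exists>w\<in>?X. \<forall>a\<in>R. \<not> realises q f (fst w) (fst (snd w)) (snd (snd w)) a)"
    by (rule pr_mono) (force simp: patterned_def)
  also have "\<dots> \<le> (\<Sum>w\<in>?X. ?e)"
  proof (rule pr_Bex_le[OF fX])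
    fix w assume "w \<in> ?X"
    then obtain i \<tau> X where w: "w = (i, \<tau>, X)" "i < J" "\<tau> < 3 * J" by auto
    \<comment> \<open>Parameters and leaves lie outside the reserve, so every pair relevant to
      \<open>a\<close> meets \<open>R\<close> in \<open>a\<close> alone. This makes different
      \<open>a\<close> independent.\<close>
    let ?I = "\<lambda>a. {e. a \<in> e \<and> e \<inter> R = {a}}"
    have "pr (\<lambda>f. \<forall>a\<in>R. \<not> realises q f i \<tau> X a) \<le> exp (- (p / 2 * (1/5) ^ k) * card R)"
    proof (rule pr_none_le[where I = ?I])
      show "finite R" using R_sub finite_subset by blast
      fix a assume a: "a \<in> R"
      show "p / 2 * (1/5) ^ k \<le> pr (\<lambda>f. realises q f i \<tau> X a)" by (rule pr_realises[OF w(2,3) a])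
      have "{z, a} \<in> ?I a" if "z \<in> q ` params" for z
        using that a q_range params_nodes by auto
      moreover have "{a, t} \<in> ?I a" if "x \<in> block i" "t \<in> leaves q x" for x t
        using that a leaves_range[OF block_less[OF w(2) that(1)]] by auto
      ultimately show "depends_on (?I a) (\<lambda>f. realises q f i \<tau> X a)"
        unfolding realises_def sees_def depends_on_def by simp
    qed auto
    then show "pr (\<lambda>f. \<forall>a\<in>R. \<not> realises q f (fst w) (fst (snd w)) (snd (snd w)) a) \<le> ?e"
      unfolding w(1) by simp
  qed
  also have "\<dots> = real (3 * J\<^sup>2 * 2 ^ k) * ?e" by (simp add: cX)
  finally show ?thesis .
qed

lemma pr_not_tagged: "pr (\<lambda>f. \<not> tagged q f) \<le> real (J * k * L (r - 1)) * exp (- (p / 2 * card R))"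
proof -
  let ?X = "q ` level (r - 1)"
  have nod: "level (r - 1) \<subseteq> nodes" by (rule level_nodes) simp
  have fX: "finite ?X" using finite_level by simp
  have cX: "card ?X = J * k * L (r - 1)"
    using card_image[OF inj_on_subset[OF q_inj nod]] card_level by simp
  have "real (J * k * L (r - 1)) * p \<le> real (3 * J + J * k * L (r - 1)) * p"
    using p_pos by (intro mult_right_mono) simp_all
  also have "\<dots> \<le> 1/2" by (rule few) (use r_pos in simp)
  finally have small: "card ?X * p \<le> 1/2" unfolding cX .
  have "pr (\<lambda>f. \<not> tagged q f) \<le>
      pr (\<lambda>f. \<exists>z\<in>?X. \<forall>y\<in>R. \<not> (\<exists>z0\<in>{z}. \<forall>z'\<in>?X. f {z', y} \<longleftrightarrow> z' = z0))"
    by (rule pr_mono) (auto simp: tagged_def)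
  also have "\<dots> \<le> (\<Sum>z\<in>?X. exp (- (p / 2 * card R)))"
  proof (rule pr_Bex_le[OF fX])
    fix z assume z: "z \<in> ?X"
    have "pr (\<lambda>f. \<forall>y\<in>R. \<not> (\<exists>z0\<in>{z}. \<forall>z'\<in>?X. f {z', y} \<longleftrightarrow> z' = z0)) \<le> exp (- (p / 2) * card R)"
    proof (rule pr_none_le[where I = "\<lambda>y. (\<lambda>z'. {z', y}) ` ?X"])
      show "finite R" using R_sub finite_subset by blast
      fix y assume y: "y \<in> R"
      have out: "?X \<subseteq> {1..n} - R" using q_range nod by blast
      show "p / 2 \<le> pr (\<lambda>f. \<exists>z0\<in>{z}. \<forall>z'\<in>?X. f {z', y} \<longleftrightarrow> z' = z0)"
      proof -
        have "card {z} * p / 2 \<le> pr (\<lambda>f. \<exists>z0\<in>{z}. \<forall>z'\<in>?X. f {z', y} \<longleftrightarrow> z' = z0)"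
          by (rule pr_unique_neighbour_ge[OF _ _ _ _ small]) (use z y out R_sub in blast)+
        moreover have "card {z} * p / 2 = p / 2" by simp
        ultimately show ?thesis by (simp only:)
      qed
      show "depends_on ((\<lambda>z'. {z', y}) ` ?X) (\<lambda>f. \<exists>z0\<in>{z}. \<forall>z'\<in>?X. f {z', y} \<longleftrightarrow> z' = z0)"
        unfolding depends_on_def by simp
      fix y' assume "y' \<in> R" "y \<noteq> y'"
      then show "(\<lambda>z'. {z', y}) ` ?X \<inter> (\<lambda>z'. {z', y'}) ` ?X = {}"
        using y out by (auto simp: doubleton_eq_iff)
    qed
    then show "pr (\<lambda>f. \<forall>y\<in>R. \<not> (\<exists>z0\<in>{z}. \<forall>z'\<in>?X. f {z', y} \<longleftrightarrow> z' = z0)) \<le> exp (- (p / 2 * card R))"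
      by simp
  qed
  also have "\<dots> = real (J * k * L (r - 1)) * exp (- (p / 2 * card R))" by (simp only: sum_constant cX)
  finally show ?thesis .
qed

text \<open>Pairs meeting \<open>R\<close> are never examined. Leaves are not tested against by any
  node, so a pair containing a leaf is examined only while that leaf is placed; its other end is
  then a parameter or in layer \<open>r - 1\<close>, hence not ordinary.\<close>

lemma fresh:
  "\<exists>I. depends_on I (\<lambda>f. separated q f \<and> patterned q f \<and> tagged q f) \<and> seen (Suc (Suc r)) q \<inter> I = {}"
proof -
  let ?I1 = "{{v, t} | v t x. v \<in> ordinary q \<and> x < J * k \<and> t \<in> leaves q x}"
  let ?I = "?I1 \<union> {e. e \<inter> R \<noteq> {}}"
  have sep: "separated q f = separated q g" if "\<And>e. e \<in> ?I \<Longrightarrow> f e = g e" for f g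
  proof -
    have "sees q f v x = sees q g v x" if "v \<in> ordinary q" "x < J * k" for v x
    proof -
      have "f {v, t} = g {v, t}" if "t \<in> leaves q x" for t
        using \<open>v \<in> ordinary q\<close> \<open>x < J * k\<close> that by (intro \<open>\<And>e. e \<in> ?I \<Longrightarrow> f e = g e\<close>) blast
      then show ?thesis unfolding sees_def by simp
    qed
    then show ?thesis unfolding separated_def by (simp cong: ball_cong conj_cong)
  qed
  have pat: "patterned q f = patterned q g" if "\<And>e. e \<in> ?I \<Longrightarrow> f e = g e" for f g
  proof -
    have "realises q f i \<tau> X a = realises q g i \<tau> X a" if a: "a \<in> R" for i \<tau> X a
    proof -
      have e: "f {a, t} = g {a, t}" "f {t, a} = g {t, a}" for t
        using a by (intro \<open>\<And>e. e \<in> ?I \<Longrightarrow> f e = g e\<close>; blast)+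
      show ?thesis unfolding realises_def sees_def by (simp only: e)
    qed
    then have "(\<exists>a\<in>R. realises q f i \<tau> X a) = (\<exists>a\<in>R. realises q g i \<tau> X a)" for i \<tau> X by blast
    then show ?thesis unfolding patterned_def by simp
  qed
  have priv: "tagged q f = tagged q g" if "\<And>e. e \<in> ?I \<Longrightarrow> f e = g e" for f g
  proof -
    have e: "f {z, y} = g {z, y}" if y: "y \<in> R" for y z
      using y by (intro \<open>\<And>e. e \<in> ?I \<Longrightarrow> f e = g e\<close>) blast
    show ?thesis unfolding tagged_def by (intro ball_cong bex_cong refl) (simp only: e)
  qed
  have "depends_on ?I (\<lambda>f. separated q f \<and> patterned q f \<and> tagged q f)"
    unfolding depends_on_def
  proof (intro allI impI)
    fix f g :: "nat set \<Rightarrow> bool"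
    assume *: "\<forall>e\<in>?I. f e = g e"
    have "separated q f = separated q g" "patterned q f = patterned q g" "tagged q f = tagged q g"
      by (rule sep pat priv, rule bspec[OF *], assumption)+
    then show "(separated q f \<and> patterned q f \<and> tagged q f) = (separated q g \<and> patterned q g \<and> tagged q g)"
      by (simp only:)
  qed
  moreover have "e \<notin> ?I" if "e \<in> seen (Suc (Suc r)) q" for e
  proof -
    obtain c d t where c: "e = {q d, t}" "c \<in> nodes" "d \<in> checked c" "t \<in> P c"
      using \<open>e \<in> seen (Suc (Suc r)) q\<close> unfolding seen_def by auto
    have d: "d \<in> nodes" using chk_C[OF c(2)] c(3) by auto
    have eR: "e \<inter> R = {}" using c q_range[OF d] pools(1)[of c] by blast
    have no: False if v: "v \<in> ordinary q" "x < J * k" "u \<in> leaves q x" "{q d, t} = {v, u}" for v x u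
    proof -
      obtain l where l: "l < L r" "u = q (Suc r, x, l)" using v(3) unfolding leaves_def tree_level_def by auto
      have ln: "(Suc r, x, l) \<in> nodes" using tree_level_nodes[OF v(2) le_refl] l unfolding tree_level_def by auto
      have "d \<noteq> (Suc r, x, l)"
        using c(2,3) by (cases rule: checked_cases) (auto simp: params_def level_def)
      then have "q d \<noteq> u" using inj_onD[OF q_inj _ d ln] l by auto
      then have eq: "q d = v" "t = u" using v(4) by (auto simp: doubleton_eq_iff)
      then have "u \<in> P c \<inter> P (Suc r, x, l)" using c(4) q_pool[OF ln] l by auto
      then have "c = (Suc r, x, l)" using pools(2) by blast
      then have "d \<in> params \<union> level (r - 1)" using c(3) r_pos by (cases r) auto
      then show False using v(1) eq unfolding ordinary_def by auto
    qed
    show ?thesis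
    proof
      assume "e \<in> ?I"
      then have "e \<in> ?I1" using eR by simp
      then obtain v u x where *: "e = {v, u}" "v \<in> ordinary q" "x < J * k" "u \<in> leaves q x" by auto
      show False by (rule no[OF *(2-4)]) (simp only: *(1) c(1)[symmetric])
    qed
  qed
  then have "seen (Suc (Suc r)) q \<inter> ?I = {}" by (intro equals0I) (simp only: Int_iff, elim conjE, rule notE)
  ultimately show ?thesis by (intro exI[of _ ?I] conjI)
qed

end

lemma pr_forest_ge:
  assumes root: "\<And>x. x < J * k \<Longrightarrow> E \<le> p / 2 * card (P (Suc 0, x, 0))"
    and layers: "\<And>j x l. j < r \<Longrightarrow> x < J * k \<Longrightarrow> l < L (Suc j) \<Longrightarrow> E \<le> L j * p / 2 * card (P (Suc (Suc j), x, l))"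
  shows "1 - real (card nodes) * exp (- E) - (real n ^ 2 * (7/10) ^ (J * k - 2) +
      real (3 * J\<^sup>2 * 2 ^ k) * exp (- (p / 2 * (1/5) ^ k * card R)) +
      real (J * k * L (r - 1)) * exp (- (p / 2 * card R)))
    \<le> pr (\<lambda>f. \<exists>q\<in>maps (Suc (Suc r)). greedy (Suc (Suc r)) q f \<and> separated q f \<and> patterned q f \<and> tagged q f)"
proof -
  let ?\<epsilon> = "real n ^ 2 * (7/10) ^ (J * k - 2) +
      real (3 * J\<^sup>2 * 2 ^ k) * exp (- (p / 2 * (1/5) ^ k * card R)) +
      real (J * k * L (r - 1)) * exp (- (p / 2 * card R))"
  have "failure c \<le> exp (- E)" if "c \<in> nodes" for c
    using that
  proof (cases rule: checked_cases)
    case 1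
    then show ?thesis unfolding failure_def by simp
  next
    case (2 x)
    then show ?thesis using root[OF 2(1)] unfolding failure_def by simp
  next
    case (3 j x l)
    then show ?thesis using layers[OF 3(1-3)] unfolding failure_def by (simp add: card_tree_level)
  qed
  then have "(\<Sum>c\<in>nodes. failure c) \<le> (\<Sum>c\<in>nodes. exp (- E))" by (rule sum_mono)
  then have fs: "(\<Sum>c\<in>nodes. failure c) \<le> real (card nodes) * exp (- E)" by simp
  have "1 - (\<Sum>c\<in>nodes. failure c) - ?\<epsilon> \<le> pr (\<lambda>f. \<exists>q\<in>maps (Suc (Suc r)). greedy (Suc (Suc r)) q f \<and>
      (separated q f \<and> patterned q f \<and> tagged q f))"
  proof (rule pr_greedy_with)
    show "fst c < Suc (Suc r)" if "c \<in> nodes" for c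
      using that unfolding nodes_def params_def level_def by auto
    show "0 \<le> ?\<epsilon>" by simp
    fix q assume q: "q \<in> maps (Suc (Suc r))"
    show "\<exists>I. depends_on I (\<lambda>f. separated q f \<and> patterned q f \<and> tagged q f) \<and> seen (Suc (Suc r)) q \<inter> I = {}"
      by (rule fresh[OF q])
    have "pr (\<lambda>f. \<not> (separated q f \<and> patterned q f \<and> tagged q f)) \<le>
        pr (\<lambda>f. (\<not> separated q f \<or> \<not> patterned q f) \<or> \<not> tagged q f)"
      by (rule pr_mono) blast
    also have "\<dots> \<le> pr (\<lambda>f. \<not> separated q f \<or> \<not> patterned q f) + pr (\<lambda>f. \<not> tagged q f)"
      by (rule pr_union_le)
    also have "pr (\<lambda>f. \<not> separated q f \<or> \<not> patterned q f) \<le> pr (\<lambda>f. \<not> separated q f) + pr (\<lambda>f. \<not> patterned q f)"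
      by (rule pr_union_le)
    finally show "pr (\<lambda>f. \<not> (separated q f \<and> patterned q f \<and> tagged q f)) \<le> ?\<epsilon>"
      using pr_not_separated[OF q] pr_not_patterned[OF q] pr_not_tagged[OF q] by linarith
  qed
  then show ?thesis using fs by linarith
qed

end

section \<open>Forests encode the structure\<close>

text \<open>The form in which the encoded power sets arise: \<open>h\<close> identifies
  \<open>X\<close> with the subsets of \<open>Y\<close>, and \<open>R\<close> is membership.\<close>

lemma code_separates_shatters:
  assumes h: "bij_betw h X (Pow Y)" and R: "\<And>y x. y \<in> Y \<Longrightarrow> x \<in> X \<Longrightarrow> R (u y) (g x) \<longleftrightarrow> y \<in> h x"
  shows "separates (u ` Y) (g ` X) R" "shatters (u ` Y) (g ` X) R"
proof -
  show "separates (u ` Y) (g ` X) R"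
    unfolding separates_def
  proof (intro ballI impI)
    fix z z' assume "z \<in> g ` X" "z' \<in> g ` X" "z \<noteq> z'"
    then obtain x x' where x: "x \<in> X" "x' \<in> X" "z = g x" "z' = g x'" "x \<noteq> x'" by blast
    then have "h x \<noteq> h x'" using inj_onD[OF bij_betw_imp_inj_on[OF h]] by blast
    moreover have "h x \<subseteq> Y" "h x' \<subseteq> Y" using bij_betwE[OF h] x by blast+
    ultimately obtain y where "y \<in> Y" "(y \<in> h x) \<noteq> (y \<in> h x')" by blast
    then show "\<exists>w\<in>u ` Y. R w z \<noteq> R w z'" using R x by blast
  qed
  show "shatters (u ` Y) (g ` X) R"
  proof (rule shattersI)
    fix W assume W: "W \<subseteq> u ` Y"
    have "{y \<in> Y. u y \<in> W} \<in> h ` X" using bij_betw_imp_surj_on[OF h] by auto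
    then obtain x where x: "x \<in> X" "h x = {y \<in> Y. u y \<in> W}" by force
    then have "{w \<in> u ` Y. R w (g x)} = W" using R W by auto
    then show "\<exists>z\<in>g ` X. {w \<in> u ` Y. R w z} = W" using x(1) by blast
  qed
qed

context small_forest
begin

context
  fixes q f and a :: nat
  assumes q: "q \<in> maps (Suc (Suc r))" and gr: "greedy (Suc (Suc r)) q f"
    and sep: "separated q f" and pat: "patterned q f" and tag: "tagged q f"
    and supp: "\<And>e. f e \<Longrightarrow> e \<in> vertex_pairs {1..n}" and k: "k = 2 ^ 2 ^ a"
begin

abbreviation "G \<equiv> graph_of f"
abbreviation "rt x \<equiv> q (Suc 0, x, 0)"
abbreviation "par \<tau> \<equiv> q (0, \<tau>, 0)"

lemma verts_G: "verts G = {1..n}"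
  unfolding graph_of_def by simp

lemma adjacent_iff: "adjacent G u v \<longleftrightarrow> f {u, v}"
  unfolding adjacent_def graph_of_def using supp by auto

lemma acceptable_q: "c \<in> nodes \<Longrightarrow> acceptable f q c (q c)"
proof -
  assume c: "c \<in> nodes"
  then have "fst c < Suc (Suc r)" unfolding nodes_def params_def level_def by auto
  then show "acceptable f q c (q c)" using gr c unfolding greedy_def by blast
qed

lemma par_node: "\<tau> < 3 * J \<Longrightarrow> (0, \<tau>, 0) \<in> params"
  unfolding params_def by auto

lemma par_inj: "\<tau> < 3 * J \<Longrightarrow> \<tau>' < 3 * J \<Longrightarrow> par \<tau> = par \<tau>' \<longleftrightarrow> \<tau> = \<tau>'"
  using inj_onD[OF q_inj[OF q], of "(0, \<tau>, 0)" "(0, \<tau>', 0)"] par_node[of \<tau>] par_node[of \<tau>'] params_nodes by auto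

lemma params_image: "q ` params = par ` {..<3*J}"
  unfolding params_def by auto

lemma root_node: "x < J * k \<Longrightarrow> (Suc 0, x, 0) \<in> level 0"
  unfolding level_def using L_0 by (auto intro!: image_eqI[of _ _ "(x, 0)"])

lemma level_0_image: "q ` level 0 = rt ` {..<J*k}"
  unfolding level_def using L_0 by force

lemma root_inj: "x < J * k \<Longrightarrow> y < J * k \<Longrightarrow> rt x = rt y \<longleftrightarrow> x = y"
  using inj_onD[OF q_inj[OF q], of "(Suc 0, x, 0)" "(Suc 0, y, 0)"] root_node[of x] root_node[of y] level_nodes[of 0] by auto

lemma div_less: "x < J * k \<Longrightarrow> x div k < J"
  by (simp add: less_mult_imp_div_less)

lemma root_par: "x < J * k \<Longrightarrow> \<tau> < 3 * J \<Longrightarrow> f {rt x, par \<tau>} \<longleftrightarrow> \<tau> = x div k"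
proof -
  assume x: "x < J * k" and \<tau>: "\<tau> < 3 * J"
  have "acceptable f q (Suc 0, x, 0) (rt x)" using acceptable_q root_node[OF x] level_nodes[of 0] by auto
  then have "\<forall>d\<in>params. f {q d, rt x} \<longleftrightarrow> d = (0, x div k, 0)"
    using par_node[OF \<tau>] unfolding acceptable_def by auto
  from bspec[OF this par_node[OF \<tau>]] show ?thesis by (simp add: insert_commute)
qed

lemma layer_node:
  assumes "j < r" "c \<in> tree_level (Suc j) x" "x < J * k"
  shows "\<exists>y\<in>tree_level j x. \<forall>d\<in>params \<union> level j. f {q c, q d} \<longleftrightarrow> d = y"
proof -
  obtain l where c: "c = (Suc (Suc j), x, l)" using assms(2) unfolding tree_level_def by auto
  have "c \<in> nodes" using assms tree_level_nodes[of x "Suc j"] by auto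
  from acceptable_q[OF this] have "\<exists>y\<in>tree_level j x. \<forall>d\<in>params \<union> level j. f {q d, q c} \<longleftrightarrow> d = y"
    using par_node[of 0] J_pos unfolding acceptable_def c by auto
  then show ?thesis by (simp add: insert_commute)
qed

lemma level_trees: "level j = (\<Union>x<J*k. tree_level j x)"
  unfolding level_def tree_level_def by auto

lemma leaf_par: "t \<in> q ` level r \<Longrightarrow> \<tau> < 3 * J \<Longrightarrow> \<not> f {t, par \<tau>}"
proof -
  assume t: "t \<in> q ` level r" and \<tau>: "\<tau> < 3 * J"
  obtain j where j: "r = Suc j" using r_pos by (cases r) auto
  obtain x c where c: "x < J * k" "c \<in> tree_level (Suc j) x" "t = q c" using t unfolding j level_trees by auto
  obtain y where y: "y \<in> tree_level j x" "\<forall>d\<in>params \<union> level j. f {q c, q d} \<longleftrightarrow> d = y"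
    using layer_node[of j c x] c j by auto
  have "(0, \<tau>, 0) \<noteq> y" using y(1) unfolding tree_level_def by auto
  then show ?thesis using y(2) par_node[OF \<tau>] c by auto
qed

text \<open>A node has exactly one neighbour on the layer before it, and this neighbour belongs to
  the same tree. A path towards the roots therefore never changes trees.\<close>

lemma reach_root:
  assumes Q: "\<And>j. j \<le> r \<Longrightarrow> Q j = q ` level j"
  shows "j \<le> r \<Longrightarrow> x < J * k \<Longrightarrow> y < J * k \<Longrightarrow> c \<in> tree_level j y \<Longrightarrow> reach G Q j (q c) (rt x) \<longleftrightarrow> x = y"
proof (induction j arbitrary: c)
  case 0
  then have "c = (Suc 0, y, 0)" using L_0 unfolding tree_level_def by auto
  then show ?case using root_inj[OF 0(2,3)] by auto
next
  case (Suc j)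
  obtain d where d: "d \<in> tree_level j y" "\<forall>e\<in>params \<union> level j. f {q c, q e} \<longleftrightarrow> e = d"
    using layer_node[of j c y] Suc.prems by auto
  have dl: "d \<in> level j" using d(1) tree_level_subset[OF Suc.prems(3)] by auto
  have "reach G Q (Suc j) (q c) (rt x) \<longleftrightarrow> (\<exists>e\<in>level j. f {q c, q e} \<and> reach G Q j (q e) (rt x))"
    using Q[of j] Suc.prems(1) by (simp add: adjacent_iff)
  also have "\<dots> \<longleftrightarrow> reach G Q j (q d) (rt x)" using d(2) dl by auto
  also have "\<dots> \<longleftrightarrow> x = y" by (rule Suc.IH) (use Suc.prems d in auto)
  finally show ?case .
qed

lemma reach_sees:
  assumes Q: "\<And>j. j \<le> r \<Longrightarrow> Q j = q ` level j" and x: "x < J * k"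
  shows "reach G Q (Suc r) u (rt x) \<longleftrightarrow> sees q f u x"
proof -
  have "reach G Q (Suc r) u (rt x) \<longleftrightarrow> (\<exists>c\<in>level r. f {u, q c} \<and> reach G Q r (q c) (rt x))"
    using Q[of r] by (simp add: adjacent_iff)
  also have "\<dots> \<longleftrightarrow> (\<exists>y<J*k. \<exists>c\<in>tree_level r y. f {u, q c} \<and> x = y)"
    using reach_root[of Q r x, OF Q le_refl x] unfolding level_trees by auto
  also have "\<dots> \<longleftrightarrow> sees q f u x" using x unfolding sees_def leaves_def by auto
  finally show ?thesis .
qed

lemma realises_exists:
  assumes "i < J" "\<tau> < 3 * J" "X \<subseteq> block i"
  shows "\<exists>b\<in>R. (\<forall>\<tau>'<3*J. f {b, par \<tau>'} \<longleftrightarrow> \<tau>' = \<tau>) \<and> (\<forall>x\<in>block i. sees q f b x \<longleftrightarrow> x \<in> X)"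
proof -
  have "\<exists>b\<in>R. realises q f i \<tau> X b" using pat assms unfolding patterned_def by auto
  then obtain b where b: "b \<in> R" "\<forall>z\<in>par ` {..<3*J}. f {z, b} \<longleftrightarrow> z = par \<tau>" "\<forall>x\<in>block i. sees q f b x \<longleftrightarrow> x \<in> X"
    unfolding realises_def params_image by auto
  have "f {b, par \<tau>'} \<longleftrightarrow> \<tau>' = \<tau>" if "\<tau>' < 3 * J" for \<tau>'
    using b(2) that par_inj[OF that assms(2)] by (simp add: insert_commute)
  then show ?thesis using b by blast
qed

text \<open>As \<open>k = 2 ^ 2 ^ a\<close>, each block can be identified with the subsets of
  \<open>2 ^ a\<close> points, and these points with the subsets of \<open>a\<close> points.
  Vertices of the reserve realise both codings.\<close>

lemma encodes_forest:
  "\<exists>A v. (\<forall>j<r. A j \<subseteq> {1..n}) \<and> (\<forall>\<tau><3*J. v \<tau> \<in> {1..n}) \<and> encodes G A v J r"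
proof -
  have "\<exists>h. bij_betw h (block i) (Pow {..<2^a :: nat})" for i
    using card_block[of i] k by (intro finite_same_card_bij) (simp_all add: card_Pow)
  then obtain h where h: "\<And>i. bij_betw (h i) (block i) (Pow {..<2^a :: nat})" by metis
  have "\<exists>h'. bij_betw h' {..<2^a :: nat} (Pow {..<a})"
    by (intro finite_same_card_bij) (simp_all add: card_Pow)
  then obtain h' where h': "bij_betw h' {..<2^a :: nat} (Pow {..<a})" by blast
  define realised where "realised X \<tau> i b \<longleftrightarrow> b \<in> R \<and> (\<forall>\<tau>'<3*J. f {b, par \<tau>'} \<longleftrightarrow> \<tau>' = \<tau>) \<and>
      (\<forall>x\<in>block i. sees q f b x \<longleftrightarrow> x \<in> X)" for X \<tau> i b
  have "\<exists>b. i < J \<longrightarrow> realised {x \<in> block i. s \<in> h i x} (J + i) i b" for i s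
    using realises_exists[of i "J + i" "{x \<in> block i. s \<in> h i x}"]
    unfolding realised_def by (cases "i < J") auto
  \<comment> \<open>\<open>\<alpha> i s\<close> represents the point \<open>s\<close>: its trace
    consists of the roots whose set contains \<open>s\<close>.\<close>
  then obtain \<alpha> where "\<And>i s. i < J \<Longrightarrow> realised {x \<in> block i. s \<in> h i x} (J + i) i (\<alpha> i s)"
    by metis
  then have \<alpha>: "\<And>i s. i < J \<Longrightarrow> \<alpha> i s \<in> R"
      "\<And>i s \<tau>. i < J \<Longrightarrow> \<tau> < 3 * J \<Longrightarrow> f {\<alpha> i s, par \<tau>} \<longleftrightarrow> \<tau> = J + i"
      "\<And>i s x. i < J \<Longrightarrow> x \<in> block i \<Longrightarrow> sees q f (\<alpha> i s) x \<longleftrightarrow> s \<in> h i x"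
    by (simp_all add: realised_def)
  \<comment> \<open>A point \<open>e\<close> of the lowest level has to code a set of points
    \<open>s\<close>, but traces consist of roots. Each \<open>s\<close> is represented by the root
    coding \<open>{s}\<close>, as \<open>singles_out\<close> expects.\<close>
  define Y where "Y i e = {x \<in> block i. \<exists>s. h i x = {s} \<and> e \<in> h' s}" for i e
  have "\<exists>b. i < J \<longrightarrow> realised (Y i e) (2*J + i) i b" for i e
    using realises_exists[of i "2*J + i" "Y i e"]
    unfolding realised_def by (cases "i < J") (auto simp: Y_def)
  then obtain \<beta> where "\<And>i e. i < J \<Longrightarrow> realised (Y i e) (2*J + i) i (\<beta> i e)"
    by metis
  then have \<beta>: "\<And>i e. i < J \<Longrightarrow> \<beta> i e \<in> R"
      "\<And>i e \<tau>. i < J \<Longrightarrow> \<tau> < 3 * J \<Longrightarrow> f {\<beta> i e, par \<tau>} \<longleftrightarrow> \<tau> = 2*J + i"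
      "\<And>i e x. i < J \<Longrightarrow> x \<in> block i \<Longrightarrow> sees q f (\<beta> i e) x \<longleftrightarrow> (\<exists>s. h i x = {s} \<and> e \<in> h' s)"
    by (simp_all add: realised_def Y_def)
  \<comment> \<open>The value of \<open>A 0\<close>: roots, leaves and both kinds of code vertices,
    which their adjacency to the parameters tells apart again.\<close>
  define S where "S = rt ` {..<J*k} \<union> q ` level r \<union> (\<Union>i<J. \<alpha> i ` {..<2^a}) \<union> (\<Union>i<J. \<beta> i ` {..<a})"
  define A where "A j = (if j = 0 then S else q ` level j)" for j :: nat
  have V: "q c \<in> {1..n}" "q c \<notin> R" if "c \<in> nodes" for c using q_range[OF q that] by auto
  have SV: "S \<subseteq> {1..n}"
    unfolding S_def using V \<alpha>(1) \<beta>(1) R_sub level_nodes[of 0] level_nodes[of r] root_node by blast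
  have M_iff: "s \<in> marked G A par \<tau> \<longleftrightarrow> s \<in> S \<and> f {s, par \<tau>}" for s \<tau>
    unfolding marked_def verts_G using SV by (auto simp: A_def adjacent_iff)
  have M_cases: "s \<in> marked G A par \<tau> \<longleftrightarrow> (\<exists>x<J*k. s = rt x \<and> \<tau> = x div k) \<or>
      (\<exists>i<J. \<exists>t<2^a. s = \<alpha> i t \<and> \<tau> = J + i) \<or> (\<exists>i<J. \<exists>e<a. s = \<beta> i e \<and> \<tau> = 2*J + i)"
    (is "_ \<longleftrightarrow> ?B") if \<tau>: "\<tau> < 3 * J" for s \<tau>
  proof
    assume "s \<in> marked G A par \<tau>"
    then have "s \<in> S" "f {s, par \<tau>}" unfolding M_iff by auto
    then consider x where "x < J * k" "s = rt x" | "s \<in> q ` level r"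
      | i t where "i < J" "t < 2^a" "s = \<alpha> i t" | i e where "i < J" "e < a" "s = \<beta> i e"
      unfolding S_def by blast
    then show ?B
      using \<open>f {s, par \<tau>}\<close> root_par[OF _ \<tau>] leaf_par[OF _ \<tau>] \<alpha>(2)[OF _ \<tau>] \<beta>(2)[OF _ \<tau>]
      by cases blast+
  next
    assume ?B
    then show "s \<in> marked G A par \<tau>"
      unfolding M_iff S_def using root_par[OF _ \<tau>] \<alpha>(2)[OF _ \<tau>] \<beta>(2)[OF _ \<tau>] by blast
  qed
  have M0: "marked G A par i = rt ` block i" if "i < J" for i
  proof (intro set_eqI)
    fix s
    have "s \<in> marked G A par i \<longleftrightarrow> (\<exists>x<J*k. s = rt x \<and> x div k = i)"
      using M_cases[of i s] that by auto
    also have "\<dots> \<longleftrightarrow> s \<in> rt ` block i"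
      unfolding image_iff Bex_def block_iff using block_less[OF that, unfolded block_iff] by blast
    finally show "s \<in> marked G A par i \<longleftrightarrow> s \<in> rt ` block i" .
  qed
  have M1: "marked G A par (J + i) = \<alpha> i ` {..<2^a}" if "i < J" for i
  proof (intro set_eqI)
    fix s
    have "x div k \<noteq> J + i" if "x < J * k" for x using div_less[OF that] by simp
    moreover have "2 * J + i' \<noteq> J + i" for i' using that by simp
    ultimately have "s \<in> marked G A par (J + i) \<longleftrightarrow> (\<exists>t<2^a. s = \<alpha> i t)"
      using M_cases[of "J + i" s] that by (simp cong: conj_cong) metis
    then show "s \<in> marked G A par (J + i) \<longleftrightarrow> s \<in> \<alpha> i ` {..<2^a}" by auto
  qed
  have M2: "marked G A par (2*J + i) = \<beta> i ` {..<a}" if "i < J" for i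
  proof (intro set_eqI)
    fix s
    have "x div k \<noteq> 2*J + i" if "x < J * k" for x using div_less[OF that] by simp
    moreover have "J + i' \<noteq> 2*J + i" if "i' < J" for i' using that by simp
    ultimately have "s \<in> marked G A par (2*J + i) \<longleftrightarrow> (\<exists>e<a. s = \<beta> i e)"
      using M_cases[of "2*J + i" s] that by (simp cong: conj_cong) metis
    then show "s \<in> marked G A par (2*J + i) \<longleftrightarrow> s \<in> \<beta> i ` {..<a}" by auto
  qed
  have Q: "layer G A par J r j = q ` level j" if j: "j \<le> r" for j
  proof -
    consider "j = 0" | "j = r" "j \<noteq> 0" | "j \<noteq> 0" "j < r" using j le_neq_implies_less by blast
    then show ?thesis
    proof cases
      case 1
      have "(\<Union>i<J. block i) = {..<J*k}"
        using div_less block_less by (auto simp: block_iff)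
      then have "(\<Union>i<J. rt ` block i) = rt ` {..<J*k}" by blast
      then show ?thesis using 1 M0 unfolding layer_def by (simp add: level_0_image)
    next
      case 2
      have "layer G A par J r j = {s \<in> S. \<forall>\<tau><3*J. \<not> f {s, par \<tau>}}"
        unfolding layer_def verts_G using 2 SV by (auto simp: A_def adjacent_iff)
      also have "\<dots> = q ` level r"
      proof (intro equalityI subsetI)
        fix s assume "s \<in> {s \<in> S. \<forall>\<tau><3*J. \<not> f {s, par \<tau>}}"
        then have s: "s \<in> S" "\<And>\<tau>. \<tau> < 3 * J \<Longrightarrow> \<not> f {s, par \<tau>}" by auto
        have "\<exists>\<tau><3*J. f {rt x, par \<tau>}" if "x < J * k" for x
          using root_par[OF that, of "x div k"] div_less[OF that] by (intro exI[of _ "x div k"]) auto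
        moreover have "\<exists>\<tau><3*J. f {\<alpha> i t, par \<tau>}" if "i < J" for i t
          using \<alpha>(2)[OF that, of "J + i" t] that by (intro exI[of _ "J + i"]) auto
        moreover have "\<exists>\<tau><3*J. f {\<beta> i t, par \<tau>}" if "i < J" for i t
          using \<beta>(2)[OF that, of "2*J + i" t] that by (intro exI[of _ "2*J + i"]) auto
        ultimately show "s \<in> q ` level r" using s unfolding S_def by blast
      qed (use leaf_par in \<open>auto simp: S_def\<close>)
      finally show ?thesis using 2 by simp
    next
      case 3
      have "q ` level j \<subseteq> {1..n}" using V level_nodes[OF j] by blast
      then show ?thesis using 3 unfolding layer_def verts_G by (auto simp: A_def)
    qed
  qed
  let ?Q = "layer G A par J r"
  let ?\<rho> = "reach G ?Q (Suc r)"
  have \<rho>: "?\<rho> u (rt x) \<longleftrightarrow> sees q f u x" if "x < J * k" for u x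
    by (rule reach_sees[of ?Q, OF Q that])
  have enc: "encodes G A par J r"
    unfolding encodes_def Let_def
  proof (intro conjI allI impI)
    have "verts G - ?Q (r - 1) - par ` {..<3*J} = ordinary q"
      using Q[of "r - 1"] unfolding ordinary_def params_image verts_G by simp
    moreover have "separates (?Q 0) (ordinary q) (\<lambda>x u. ?\<rho> u x)"
      unfolding separates_def Q[OF le0] level_0_image
    proof (intro ballI impI)
      fix z z' assume "z \<in> ordinary q" "z' \<in> ordinary q" "z \<noteq> z'"
      then obtain x where x: "x < J * k" "sees q f z x \<noteq> sees q f z' x" using sep unfolding separated_def by blast
      then have "?\<rho> z (rt x) \<noteq> ?\<rho> z' (rt x)" using \<rho>[OF x(1)] by simp
      then show "\<exists>w\<in>rt ` {..<J*k}. ?\<rho> z w \<noteq> ?\<rho> z' w" using x(1) by blast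
    qed
    ultimately show "separates (?Q 0) (verts G - ?Q (r - 1) - par ` {..<3*J}) (\<lambda>x u. ?\<rho> u x)" by simp
  next
    have Qr: "?Q (r - 1) = q ` level (r - 1)" by (rule Q) simp
    show "\<forall>z\<in>?Q (r - 1). \<exists>y\<in>verts G - ?Q (r - 1). \<forall>z'\<in>?Q (r - 1). adjacent G y z' = (z' = z)"
      unfolding Qr
    proof
      fix z assume "z \<in> q ` level (r - 1)"
      then obtain y where y: "y \<in> R" "\<forall>z'\<in>q ` level (r - 1). f {z', y} \<longleftrightarrow> z' = z"
        using tag unfolding tagged_def by blast
      have "y \<notin> q ` level (r - 1)" using y(1) V(2) level_nodes[of "r - 1"] by auto
      then show "\<exists>y\<in>verts G - q ` level (r - 1). \<forall>z'\<in>q ` level (r - 1). adjacent G y z' = (z' = z)"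
        unfolding verts_G using y R_sub by (intro bexI[of _ y]) (auto simp: adjacent_iff insert_commute)
    qed
  next
    fix i assume i: "i < J"
    show "shatters (marked G A par i) (verts G) (\<lambda>x u. ?\<rho> u x)"
    proof (rule shattersI)
      fix X assume X: "X \<subseteq> marked G A par i"
      obtain b where b: "b \<in> R" "\<forall>x\<in>block i. sees q f b x \<longleftrightarrow> x \<in> {x \<in> block i. rt x \<in> X}"
        using realises_exists[OF i, of 0 "{x \<in> block i. rt x \<in> X}"] J_pos by auto
      then have "{w \<in> marked G A par i. ?\<rho> b w} = X"
        using X \<rho> block_less[OF i] unfolding M0[OF i] by (auto simp del: reach.simps)
      then show "\<exists>z\<in>verts G. {w \<in> marked G A par i. ?\<rho> z w} = X"
        unfolding verts_G using b(1) R_sub by (intro bexI[of _ b]) auto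
    qed
    have 1: "?\<rho> (\<alpha> i s) (rt x) \<longleftrightarrow> s \<in> h i x" if "x \<in> block i" for s x
      using \<rho>[OF block_less[OF i that]] \<alpha>(3)[OF i that] by simp
    have 2: "?\<rho> (\<beta> i e) (rt x) \<longleftrightarrow> (\<exists>s. h i x = {s} \<and> e \<in> h' s)" if "x \<in> block i" for e x
      using \<rho>[OF block_less[OF i that]] \<beta>(3)[OF i that] by simp
    show "separates (marked G A par (J + i)) (marked G A par i) ?\<rho>"
      "shatters (marked G A par (J + i)) (marked G A par i) ?\<rho>"
      unfolding M0[OF i] M1[OF i] by (rule code_separates_shatters[OF h[of i]], rule 1, assumption)+
    let ?\<sigma> = "singles_out (marked G A par i) (marked G A par (J + i)) ?\<rho>"
    have 3: "?\<sigma> (\<beta> i e) (\<alpha> i s) \<longleftrightarrow> e \<in> h' s" if s: "s \<in> {..<2^a}" for e s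
    proof
      assume "?\<sigma> (\<beta> i e) (\<alpha> i s)"
      then obtain x where x: "x \<in> block i" "?\<rho> (\<beta> i e) (rt x)" "?\<rho> (\<alpha> i s) (rt x)"
        unfolding singles_out_def M0[OF i] by auto
      then show "e \<in> h' s" using 1[OF x(1)] 2[OF x(1)] by (auto simp del: reach.simps)
    next
      assume e: "e \<in> h' s"
      have "{s} \<in> h i ` block i" using bij_betw_imp_surj_on[OF h[of i]] s by auto
      then obtain x where x: "x \<in> block i" "h i x = {s}" by force
      have "\<forall>b\<in>\<alpha> i ` {..<2^a}. b \<noteq> \<alpha> i s \<longrightarrow> \<not> ?\<rho> b (rt x)" using 1[OF x(1)] x(2) by (auto simp del: reach.simps)
      moreover have "?\<rho> (\<alpha> i s) (rt x)" "?\<rho> (\<beta> i e) (rt x)" using 1[OF x(1)] 2[OF x(1)] x(2) e by (auto simp del: reach.simps)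
      ultimately show "?\<sigma> (\<beta> i e) (\<alpha> i s)" unfolding singles_out_def M0[OF i] M1[OF i] using x(1) by blast
    qed
    have "separates (\<beta> i ` {..<a}) (\<alpha> i ` {..<2^a}) ?\<sigma>" "shatters (\<beta> i ` {..<a}) (\<alpha> i ` {..<2^a}) ?\<sigma>"
      by (rule code_separates_shatters[OF h'], rule 3, assumption)+
    then show "separates (marked G A par (2*J + i)) (marked G A par (J + i)) ?\<sigma>"
      "shatters (marked G A par (2*J + i)) (marked G A par (J + i)) ?\<sigma>"
      by (simp_all only: M1[OF i] M2[OF i])
  qed
  have Asub: "A j \<subseteq> {1..n}" if "j < r" for j
    using SV V(1) level_nodes[of j] that unfolding A_def by (cases "j = 0") (simp, auto)
  have parV: "par \<tau> \<in> {1..n}" if "\<tau> < 3 * J" for \<tau>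
    using V(1) par_node[OF that] params_nodes by blast
  show ?thesis
    by (intro exI[of _ A] exI[of _ "\<lambda>\<tau>. par \<tau>"] conjI allI impI, erule Asub, erule parV, rule enc)
qed

end

end

section \<open>Asymptotics\<close>

context small_forest
begin

lemma prob_models_ge:
  assumes k: "k = 2 ^ 2 ^ a"
    and root: "\<And>x. x < J * k \<Longrightarrow> E \<le> p / 2 * card (P (Suc 0, x, 0))"
    and layers: "\<And>j x l. j < r \<Longrightarrow> x < J * k \<Longrightarrow> l < L (Suc j) \<Longrightarrow> E \<le> L j * p / 2 * card (P (Suc (Suc j), x, l))"
  shows "1 - real (card nodes) * exp (- E) - (real n ^ 2 * (7/10) ^ (J * k - 2) +
      real (3 * J\<^sup>2 * 2 ^ k) * exp (- (p / 2 * (1/5) ^ k * card R)) +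
      real (J * k * L (r - 1)) * exp (- (p / 2 * card R)))
    \<le> measure_pmf.prob (binomial_graph n p) {G. G \<Turnstile> fm_code J r}"
proof -
  have "binomial_graph n p = map_pmf graph_of M"
    unfolding binomial_graph_def M_def graph_of_def by simp
  then have "measure_pmf.prob (binomial_graph n p) {G. G \<Turnstile> fm_code J r} = pr (\<lambda>f. graph_of f \<Turnstile> fm_code J r)"
    unfolding pr_def by (simp add: vimage_def)
  also have "\<dots> \<ge> pr (\<lambda>f. \<exists>q\<in>maps (Suc (Suc r)). greedy (Suc (Suc r)) q f \<and> separated q f \<and> patterned q f \<and> tagged q f)"
  proof (rule pr_mono)
    fix f :: "nat set \<Rightarrow> bool"
    assume supp: "\<forall>e. e \<notin> vertex_pairs {1..n} \<longrightarrow> \<not> f e"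
      and "\<exists>q\<in>maps (Suc (Suc r)). greedy (Suc (Suc r)) q f \<and> separated q f \<and> patterned q f \<and> tagged q f"
    then obtain q where q: "q \<in> maps (Suc (Suc r))" "greedy (Suc (Suc r)) q f" "separated q f"
        "patterned q f" "tagged q f" by blast
    have e: "e \<in> vertex_pairs {1..n}" if "f e" for e using supp that by blast
    have V: "verts (graph_of f) = {1..n}" unfolding graph_of_def by simp
    from encodes_forest[OF q e k]
    show "graph_of f \<Turnstile> fm_code J r"
      unfolding models_fm_code[OF J_pos r_pos] V .
  qed
  finally show ?thesis using pr_forest_ge[OF root layers] by linarith
qed

end

lemma prob_models_eq_0:
  assumes "0 < J" "0 < r" "6 * J + 2 \<le> 2 ^ 2 ^ a" and n: "n = 2 ^ ((J + 1) * 2 ^ 2 ^ a)"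
  shows "measure_pmf.prob (binomial_graph n p) {G. G \<Turnstile> fm_code J r} = 0"
proof -
  have "\<not> G \<Turnstile> fm_code J r" if "G \<in> set_pmf (binomial_graph n p)" for G
  proof -
    have "verts G = {1..n}" using that unfolding binomial_graph_def by auto
    then show ?thesis
      using not_encodes[of G J a _ _ r] assms(3) n unfolding models_fm_code[OF assms(1,2)] by simp
  qed
  then show ?thesis by (auto simp: measure_pmf_zero_iff)
qed

section \<open>Choice of sizes and the resulting estimates\<close>

lemma disjoint_pools:
  assumes "finite C" "finite U" "(\<Sum>c\<in>C. s c) \<le> card U"
  shows "\<exists>P. (\<forall>c. P c \<subseteq> U) \<and> (\<forall>c\<in>C. card (P c) = s c) \<and> (\<forall>c d. c \<noteq> d \<longrightarrow> P c \<inter> P d = {})"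
  using assms(1,3)
proof (induction C)
  case empty
  then show ?case by (intro exI[of _ "\<lambda>_. {}"]) auto
next
  case (insert x C)
  obtain P where P: "\<forall>c. P c \<subseteq> U" "\<forall>c\<in>C. card (P c) = s c" "\<forall>c d. c \<noteq> d \<longrightarrow> P c \<inter> P d = {}"
    using insert by auto
  have "card (\<Union>c\<in>C. P c) \<le> (\<Sum>c\<in>C. s c)"
    using card_UN_le[OF insert(1), of P] P(2) by simp
  moreover have "(\<Union>c\<in>C. P c) \<subseteq> U" using P(1) by blast
  ultimately have "s x \<le> card (U - (\<Union>c\<in>C. P c))"
    using insert card_Diff_subset[of "\<Union>c\<in>C. P c" U] finite_subset[OF _ assms(2)] by simp
  then obtain T where T: "T \<subseteq> U - (\<Union>c\<in>C. P c)" "card T = s x"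
    using obtain_subset_with_card_n by metis
  let ?P = "\<lambda>c. if c = x then T else if c \<in> C then P c else {}"
  have "?P c \<inter> ?P d = {}" if "c \<noteq> d" for c d
    using P(3) T(1) that by (auto simp: disjoint_iff)
  then show ?case using P T insert(2) by (intro exI[of _ ?P]) auto
qed

text \<open>The bounds serve, in this order, the pool sizes, \<open>few\<close>, the number of
  leaves, the failures of the embedding, \<open>separated\<close>, \<open>patterned\<close>,
  \<open>tagged\<close>, and the room for the parameters. The upper bound on \<alpha> makes the
  exponent \<open>1 - \<alpha> - \<alpha> / r\<close> positive, and
  \<open>1 - \<alpha> > 1 / (r + 1)\<close> does the same for the exponent of the sixth
  bound.\<close>

lemma eventually_bounds:
  fixes r J :: nat and \<alpha> :: real
  assumes r: "0 < r" and J: "0 < J" and \<alpha>: "0 < \<alpha>" "\<alpha> < r / (r + 1)"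
  shows
   "\<forall>\<^sub>F x::real in at_top. 4 * real (r + 1) * real J * ln x * (2 * x powr \<alpha>) \<le> x"
   "\<forall>\<^sub>F x::real in at_top. (3 * real J + real J * ln x * (2 * x powr (\<alpha> - \<alpha> / r))) * x powr (- \<alpha>) \<le> 1/2"
   "\<forall>\<^sub>F x::real in at_top. 8 \<le> x powr \<alpha>"
   "\<forall>\<^sub>F x::real in at_top. x * exp (- (x powr (1 - \<alpha> - \<alpha> / r) / (32 * real (r + 1) * real J * ln x))) \<le> 1/16"
   "\<forall>\<^sub>F x::real in at_top. 3 / x \<le> 1/16"
   "\<forall>\<^sub>F x::real in at_top. 3 * (real J)\<^sup>2 * x * exp (- (x powr (1 - \<alpha> - 1 / (2 * (real r + 1))) / 4)) \<le> 1/16"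
   "\<forall>\<^sub>F x::real in at_top. x * exp (- (x powr (1 - \<alpha>) / 4)) \<le> 1/16"
   "\<forall>\<^sub>F x::real in at_top. 3 * real J \<le> x / 4 - 1"
proof -
  define \<eta> where "\<eta> = 1 - \<alpha> - \<alpha> / r"
  define \<theta> where "\<theta> = 1 - \<alpha> - 1 / (2 * (real r + 1))"
  define c where "c = 32 * real (r + 1) * real J"
  define b where "b = \<alpha> / r"
  have "\<alpha> * (r + 1) < r" using \<alpha>(2) by (simp add: field_simps)
  then have "\<eta> > 0" unfolding \<eta>_def using r by (simp add: field_simps)
  have b: "b > 0" unfolding b_def using \<alpha> r by simp
  have "1 - \<alpha> > 1 / (real r + 1)" using \<alpha>(2) by (simp add: field_simps)
  moreover have "1 / (real r + 1) > 1 / (2 * (real r + 1))" by (simp add: field_simps)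
  ultimately have "\<theta> > 0" unfolding \<theta>_def by linarith
  have "real r / real (r + 1) \<le> 1" by simp
  then have "\<alpha> < 1" using \<alpha>(2) by linarith
  have c: "c > 0" unfolding c_def using J by simp
  have T: "\<forall>\<^sub>F x in at_top. g x \<le> e" if "(g \<longlongrightarrow> 0) at_top" "e > 0" for g :: "real \<Rightarrow> real" and e
    using order_tendstoD(2)[OF that] by eventually_elim simp
  have T2: "\<forall>\<^sub>F x in at_top. g x \<le> 1/2" and T16: "\<forall>\<^sub>F x in at_top. g x \<le> 1/16"
    if "(g \<longlongrightarrow> 0) at_top" for g :: "real \<Rightarrow> real"
    by (rule T[OF that], simp)+
  have "((\<lambda>x::real. c * ln x * x powr \<alpha> / x) \<longlongrightarrow> 0) at_top"
    using \<open>\<alpha> < 1\<close> \<alpha>(1) c by real_asymp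
  from T[OF this zero_less_numeral[of "num.Bit0 (num.Bit0 num.One)"]] eventually_gt_at_top[of "0::real"]
  show "\<forall>\<^sub>F x::real in at_top. 4 * real (r + 1) * real J * ln x * (2 * x powr \<alpha>) \<le> x"
    by eventually_elim (simp add: c_def field_simps)
  have "((\<lambda>x::real. 3 * real J * x powr (- \<alpha>)) \<longlongrightarrow> 0) at_top"
    using \<alpha>(1) J by real_asymp
  moreover have "((\<lambda>x::real. 2 * real J * ln x * x powr (- b)) \<longlongrightarrow> 0) at_top"
    using b J by real_asymp
  ultimately have "((\<lambda>x::real. 3 * real J * x powr (- \<alpha>) + 2 * real J * ln x * x powr (- b)) \<longlongrightarrow> 0) at_top"
    using tendsto_add by fastforce
  moreover have "(3 * real J + real J * ln x * (2 * x powr (\<alpha> - b))) * x powr (- \<alpha>) =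
      3 * real J * x powr (- \<alpha>) + 2 * real J * ln x * x powr (- b)" for x :: real
    using powr_add[of x "\<alpha> - b" "- \<alpha>"] by (simp add: algebra_simps)
  ultimately have "((\<lambda>x::real. (3 * real J + real J * ln x * (2 * x powr (\<alpha> - b))) * x powr (- \<alpha>)) \<longlongrightarrow> 0) at_top"
    by simp
  from T2[OF this] show "\<forall>\<^sub>F x::real in at_top. (3 * real J + real J * ln x * (2 * x powr (\<alpha> - \<alpha> / r))) * x powr (- \<alpha>) \<le> 1/2"
    unfolding b_def .
  have "filterlim (\<lambda>x::real. x powr \<alpha>) at_top at_top" using \<alpha>(1) by real_asymp
  then show "\<forall>\<^sub>F x::real in at_top. 8 \<le> x powr \<alpha>" unfolding filterlim_at_top by blast
  have "((\<lambda>x::real. x * exp (- (x powr \<eta> / (c * ln x)))) \<longlongrightarrow> 0) at_top"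
    using \<open>\<eta> > 0\<close> c by real_asymp
  from T16[OF this] show "\<forall>\<^sub>F x::real in at_top. x * exp (- (x powr (1 - \<alpha> - \<alpha> / r) / (32 * real (r + 1) * real J * ln x))) \<le> 1/16"
    unfolding \<eta>_def c_def .
  have "((\<lambda>x::real. 3 * (real J)\<^sup>2 * x * exp (- (x powr \<theta> / 4))) \<longlongrightarrow> 0) at_top"
    using \<open>\<theta> > 0\<close> by real_asymp
  from T16[OF this] show "\<forall>\<^sub>F x::real in at_top. 3 * (real J)\<^sup>2 * x * exp (- (x powr (1 - \<alpha> - 1 / (2 * (real r + 1))) / 4)) \<le> 1/16"
    unfolding \<theta>_def .
  have "((\<lambda>x::real. x * exp (- (x powr (1 - \<alpha>) / 4))) \<longlongrightarrow> 0) at_top"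
    using \<open>\<alpha> < 1\<close> by real_asymp
  from T16[OF this] show "\<forall>\<^sub>F x::real in at_top. x * exp (- (x powr (1 - \<alpha>) / 4)) \<le> 1/16" .
  show "\<forall>\<^sub>F x::real in at_top. 3 * real J \<le> x / 4 - 1" by real_asymp
  show "\<forall>\<^sub>F x::real in at_top. 3 / x \<le> 1/16" by real_asymp
qed

text \<open>The number of blocks \<open>J = 36 (r + 1)\<close> is large enough for the \<open>J k\<close> bits of a vertex to separate
  \<open>n = 2 ^ (6 (r + 1) k)\<close> vertices, while \<open>k\<close> is small enough for every pattern on a block of \<open>k\<close> roots
  to be realised.\<close>

lemma prob_models_ge_half:
  fixes r k a n :: nat and \<alpha> :: real
  defines "J \<equiv> 36 * (r + 1)" and "x \<equiv> real n"
  assumes r: "0 < r" and \<alpha>: "0 < \<alpha>" "\<alpha> < r / (r + 1)"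
    and k: "k = 2 ^ 2 ^ a" and n: "n = 2 ^ (6 * (r + 1) * k)"
    and b1: "4 * real (r + 1) * real J * ln x * (2 * x powr \<alpha>) \<le> x"
    and b2: "(3 * real J + real J * ln x * (2 * x powr (\<alpha> - \<alpha> / r))) * x powr (- \<alpha>) \<le> 1/2"
    and b3: "8 \<le> x powr \<alpha>"
    and b4: "x * exp (- (x powr (1 - \<alpha> - \<alpha> / r) / (32 * real (r + 1) * real J * ln x))) \<le> 1/16"
    and b5: "3 / x \<le> 1/16"
    and b6: "3 * (real J)\<^sup>2 * x * exp (- (x powr (1 - \<alpha> - 1 / (2 * (real r + 1))) / 4)) \<le> 1/16"
    and b7: "x * exp (- (x powr (1 - \<alpha>) / 4)) \<le> 1/16"
    and b8: "3 * real J \<le> x / 4 - 1"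
  shows "1/2 \<le> measure_pmf.prob (binomial_graph n (x powr (- \<alpha>))) {G. G \<Turnstile> fm_code J r}"
proof -
  define p where "p = x powr (- \<alpha>)"
  \<comment> \<open>The layers grow by a factor of about \<open>x powr (\<alpha> / r)\<close>. The
    last one is halved so that \<open>p * L r\<close> lies between 1/4 and 1/2, which yields
    \<open>half\<close>. The value 1 beyond \<open>r\<close> keeps \<open>L\<close> positive
    everywhere.\<close>
  define L where "L j = (if j = r then nat \<lfloor>x powr \<alpha> / 2\<rfloor> else if j < r then nat \<lceil>x powr (j * (\<alpha> / r))\<rceil> else 1)" for j
  \<comment> \<open>The pool size on layer \<open>j\<close>: its \<open>J * k * L j\<close> nodes
    use at most \<open>x / (4 * (r + 1))\<close> vertices together, so all \<open>r + 1\<close>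
    layers use at most a quarter of the vertices.\<close>
  define S where "S j = nat \<lfloor>x / (4 * real (r + 1) * real J * real k * real (L j))\<rfloor>" for j
  define N0 where "N0 = (\<lambda>\<tau>. (0::nat, \<tau>::nat, 0::nat)) ` {..<3*J}"
  define N where "N j = (\<lambda>(y, l). (Suc j, y, l)) ` ({..<J*k} \<times> {..<L j})" for j
  define U where "U = {1..n div 2}"
  define R where "R = {n div 2<..n}"
  define C where "C = N0 \<union> (\<Union>j\<le>r. N j)"
  \<comment> \<open>Parameters are subject to no test, so a pool of one vertex suffices for
    them.\<close>
  define s where "s c = (if fst c = 0 then 1 else S (fst c - 1))" for c :: "nat \<times> nat \<times> nat"
  have J: "0 < J" unfolding J_def by simp
  have kp: "0 < k" unfolding k by simp
  have "1 < n" unfolding n by (rule one_less_power) (use kp in auto)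
  then have x1: "1 < x" unfolding x_def by simp
  have lnx: "ln x = real (6 * (r + 1) * k) * ln 2"
    unfolding x_def n by (simp add: ln_realpow)
  have "1/2 \<le> ln (2::real)" using ln2_ge_two_thirds by simp
  then have "real k * 1 \<le> real k * (real (6 * (r + 1)) * ln 2)"
    by (intro mult_left_mono) (simp_all add: algebra_simps, smt (verit) mult_nonneg_nonneg of_nat_0_le_iff)
  \<comment> \<open>This replaces \<open>k\<close> by \<open>ln x\<close>, so that the asymptotic
    bounds concern \<open>x\<close> alone.\<close>
  then have klnx: "real k \<le> ln x" unfolding lnx by (simp add: mult_ac)
  have p: "0 < p" "p \<le> 1" unfolding p_def using x1 \<alpha>(1) by (auto simp: powr_minus powr_le1 inverse_le_1_iff ge_one_powr_ge_zero)
  have Lle: "real (L j) \<le> 2 * x powr (j * (\<alpha> / r))" "1 \<le> L j" "j < r \<Longrightarrow> x powr (j * (\<alpha> / r)) \<le> L j" if j: "j \<le> r" for j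
  proof -
    have y: "1 \<le> x powr (j * (\<alpha> / r))" using x1 \<alpha> by (intro ge_one_powr_ge_zero) auto
    consider "j = r" | "j < r" using j le_neq_implies_less by blast
    then have "real (L j) \<le> 2 * x powr (j * (\<alpha> / r)) \<and> 1 \<le> L j \<and> (j < r \<longrightarrow> x powr (j * (\<alpha> / r)) \<le> L j)"
    proof cases
      case 1
      have "j * (\<alpha> / r) = \<alpha>" using 1 r by simp
      moreover have "real (L r) = of_int \<lfloor>x powr \<alpha> / 2\<rfloor>" "L r = nat \<lfloor>x powr \<alpha> / 2\<rfloor>" unfolding L_def by simp_all
      moreover have "1 \<le> nat \<lfloor>x powr \<alpha> / 2\<rfloor>" using b3 by (simp add: le_nat_iff le_floor_iff)
      moreover have "of_int \<lfloor>x powr \<alpha> / 2\<rfloor> \<le> x powr \<alpha> / 2" by (rule of_int_floor_le)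
      ultimately show ?thesis using 1 b3 by auto
    next
      case 2
      have ceil: "real (nat \<lceil>y\<rceil>) \<le> 2 * y \<and> 1 \<le> nat \<lceil>y\<rceil> \<and> y \<le> real (nat \<lceil>y\<rceil>)" if "1 \<le> y" for y :: real
      proof -
        have "1 \<le> \<lceil>y\<rceil>" "of_int \<lceil>y\<rceil> \<le> y + 1" using that by linarith+
        moreover from this have "real (nat \<lceil>y\<rceil>) = of_int \<lceil>y\<rceil>" "1 \<le> nat \<lceil>y\<rceil>" by linarith+
        ultimately show ?thesis using that le_of_int_ceiling[of y] by linarith
      qed
      have "L j = nat \<lceil>x powr (j * (\<alpha> / r))\<rceil>" unfolding L_def using 2 by simp
      then show ?thesis using ceil[OF y] by (simp only: simp_thms)
    qed
    then show "real (L j) \<le> 2 * x powr (j * (\<alpha> / r))" "1 \<le> L j" "j < r \<Longrightarrow> x powr (j * (\<alpha> / r)) \<le> L j" by auto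
  qed
  have Lmax: "real (L j) \<le> 2 * x powr \<alpha>" if "j \<le> r" for j
  proof -
    have "j * (\<alpha> / r) \<le> r * (\<alpha> / r)" using that \<alpha> by (intro mult_right_mono) auto
    then have "x powr (j * (\<alpha> / r)) \<le> x powr \<alpha>" using r x1 by (intro powr_mono) auto
    then show ?thesis using Lle(1)[OF that] by linarith
  qed
  have Lmax': "real (L j) \<le> 2 * x powr (\<alpha> - \<alpha> / r)" if "j < r" for j
  proof -
    have "real j * (\<alpha> / r) \<le> (real r - 1) * (\<alpha> / r)" using that \<alpha> by (intro mult_right_mono) auto
    also have "\<dots> = \<alpha> - \<alpha> / r" using r by (simp add: field_simps)
    finally have "x powr (j * (\<alpha> / r)) \<le> x powr (\<alpha> - \<alpha> / r)" using x1 by (intro powr_mono) auto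
    then show ?thesis using Lle(1)[of j] that by linarith
  qed
  have JkL: "4 * real (r + 1) * real J * real k * real (L j) \<le> x" if "j \<le> r" for j
  proof -
    have "real k * real (L j) \<le> ln x * (2 * x powr \<alpha>)"
      by (rule mult_mono[OF klnx Lmax[OF that]]) (use x1 in auto)
    then have "4 * real (r + 1) * real J * (real k * real (L j)) \<le> 4 * real (r + 1) * real J * (ln x * (2 * x powr \<alpha>))"
      by (intro mult_left_mono) auto
    then show ?thesis using b1 by (simp only: mult.assoc)
  qed
  have S1: "1 \<le> S j" "real (S j) \<le> x / (4 * real (r + 1) * real J * real k * real (L j))"
      "x / (8 * real (r + 1) * real J * real k * real (L j)) \<le> real (S j)" if "j \<le> r" for j
  proof -
    define D where "D = 4 * real (r + 1) * real J * real k * real (L j)"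
    have D: "0 < D" "D \<le> x" unfolding D_def using JkL[OF that] J kp Lle(2)[OF that] by auto
    define y where "y = x / D"
    have y: "1 \<le> y" unfolding y_def using D by simp
    have S: "S j = nat \<lfloor>y\<rfloor>" unfolding S_def y_def D_def ..
    have f: "1 \<le> \<lfloor>y\<rfloor>" "of_int \<lfloor>y\<rfloor> \<le> y" "y - 1 \<le> of_int \<lfloor>y\<rfloor>" using y by linarith+
    have f': "y / 2 \<le> of_int \<lfloor>y\<rfloor>"
    proof -
      have "(1::real) \<le> of_int \<lfloor>y\<rfloor>" by (rule order_trans[OF _ of_int_le_iff[THEN iffD2, OF f(1)]]) simp
      then show ?thesis using f(3) by argo
    qed
    have rS: "real (S j) = of_int \<lfloor>y\<rfloor>" unfolding S using f(1) by linarith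
    show "1 \<le> S j" unfolding S using f(1) by linarith
    show "real (S j) \<le> x / (4 * real (r + 1) * real J * real k * real (L j))"
      using f(2) unfolding rS y_def D_def .
    have "x / (8 * real (r + 1) * real J * real k * real (L j)) = y / 2" unfolding y_def D_def by simp
    then show "x / (8 * real (r + 1) * real J * real k * real (L j)) \<le> real (S j)" using f' by (simp only: rS)
  qed
  have fin: "finite C" unfolding C_def N0_def N_def by simp
  have cN: "card (N j) = J * k * L j" for j
    unfolding N_def by (subst card_image) (auto simp: inj_on_def)
  have sum: "(\<Sum>c\<in>C. s c) \<le> card U"
  proof -
    have "(\<Sum>c\<in>C. s c) = (\<Sum>c\<in>N0. s c) + (\<Sum>c\<in>(\<Union>j\<le>r. N j). s c)"
      unfolding C_def by (rule sum.union_disjoint) (auto simp: N0_def N_def)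
    also have "(\<Sum>c\<in>(\<Union>j\<le>r. N j). s c) = (\<Sum>j\<le>r. \<Sum>c\<in>N j. s c)"
      by (rule sum.UNION_disjoint) (auto simp: N_def)
    also have "(\<Sum>c\<in>N0. s c) = (\<Sum>c\<in>N0. 1)" by (rule sum.cong) (auto simp: N0_def s_def)
    also have "\<dots> = card N0" by simp
    also have "card N0 \<le> 3 * J" unfolding N0_def using card_image_le[of "{..<3*J}"] by fastforce
    also have "(\<Sum>j\<le>r. \<Sum>c\<in>N j. s c) = (\<Sum>j\<le>r. J * k * L j * S j)"
    proof (rule sum.cong[OF refl])
      fix j
      have "(\<Sum>c\<in>N j. s c) = (\<Sum>c\<in>N j. S j)" by (rule sum.cong) (auto simp: N_def s_def)
      then show "(\<Sum>c\<in>N j. s c) = J * k * L j * S j" by (simp add: cN)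
    qed
    finally have "real (\<Sum>c\<in>C. s c) \<le> real (3 * J + (\<Sum>j\<le>r. J * k * L j * S j))"
      by (simp only: of_nat_le_iff)
    also have "\<dots> = 3 * real J + (\<Sum>j\<le>r. real (J * k * L j) * real (S j))" by simp
    also have "(\<Sum>j\<le>r. real (J * k * L j) * real (S j)) \<le> (\<Sum>j\<le>r. x / (4 * real (r + 1)))"
    proof (rule sum_mono)
      fix j assume "j \<in> {..r}"
      then have j: "j \<le> r" by simp
      define d where "d = real (J * k * L j)"
      have d: "0 < d" unfolding d_def using J kp Lle(2)[OF j] by simp
      have e: "4 * real (r + 1) * real J * real k * real (L j) = 4 * real (r + 1) * d"
        unfolding d_def by simp
      have "d * real (S j) \<le> d * (x / (4 * real (r + 1) * d))"
        by (rule mult_left_mono[OF S1(2)[OF j, unfolded e] less_imp_le[OF d]])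
      also have "\<dots> = x / (4 * real (r + 1))" using d by simp
      finally show "real (J * k * L j) * real (S j) \<le> x / (4 * real (r + 1))" unfolding d_def .
    qed
    also have "(\<Sum>j\<le>r. x / (4 * real (r + 1))) = x / 4" by (simp add: field_simps)
    finally have "real (\<Sum>c\<in>C. s c) \<le> x / 2 - 1" using b8 by linarith
    also have "\<dots> \<le> real (n div 2)" unfolding x_def by linarith
    finally have "(\<Sum>c\<in>C. s c) \<le> n div 2" by (simp only: of_nat_le_iff)
    then show ?thesis unfolding U_def by simp
  qed
  obtain P where P: "\<And>c. P c \<subseteq> U" "\<And>c. c \<in> C \<Longrightarrow> card (P c) = s c" "\<And>c d. c \<noteq> d \<Longrightarrow> P c \<inter> P d = {}"
    using disjoint_pools[OF fin _ sum, unfolded U_def, OF finite_atLeastAtMost] unfolding U_def by metis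
  interpret forest n p J k r L P R
  proof
    show "0 \<le> p" "p \<le> 1" using p by auto
    show "P c \<subseteq> {1..n} - R" for c using P(1)[of c] unfolding U_def R_def by auto
    show "P c \<inter> P d = {}" if "c \<noteq> d" for c d by (rule P(3)[OF that])
    show "0 < L j" for j using Lle(2)[of j] unfolding L_def by (cases "j \<le> r") auto
    show "L 0 = 1" using r x1 unfolding L_def by simp
    show "R \<subseteq> {1..n}" unfolding R_def by auto
  qed (use r J kp in auto)
  have nodes: "nodes = C" unfolding nodes_def params_def level_def C_def N0_def N_def by simp
  have s0: "0 < s c" if "c \<in> C" for c
    using that S1(1) unfolding C_def N0_def N_def s_def by force
  have px: "p * x powr \<alpha> = 1" unfolding p_def using x1 by (simp add: powr_add[symmetric])
  have pL: "1/4 \<le> p * L r" "p * L r \<le> 1/2"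
  proof -
    have "real (L r) = of_int \<lfloor>x powr \<alpha> / 2\<rfloor>" unfolding L_def by simp
    then have "real (L r) \<le> x powr \<alpha> / 2" "x powr \<alpha> / 4 \<le> real (L r)" using b3 by linarith+
    then have "p * L r \<le> p * (x powr \<alpha> / 2)" "p * (x powr \<alpha> / 4) \<le> p * L r"
      using p(1) by (auto intro!: mult_left_mono)
    then show "1/4 \<le> p * L r" "p * L r \<le> 1/2" using px by auto
  qed
  interpret small_forest n p J k r L P R
  proof
    show "0 < p" by (rule p(1))
    show "real (3 * J + J * k * L j) * p \<le> 1/2" if "j < r" for j
    proof -
      have "real k * real (L j) \<le> ln x * (2 * x powr (\<alpha> - \<alpha> / r))"
        by (rule mult_mono[OF klnx Lmax'[OF that]]) (use x1 in auto)
      then have "3 * real J + real J * (real k * real (L j)) \<le> 3 * real J + real J * (ln x * (2 * x powr (\<alpha> - \<alpha> / r)))"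
        by (intro add_left_mono mult_left_mono) auto
      then have "real (3 * J + J * k * L j) * p \<le> (3 * real J + real J * (ln x * (2 * x powr (\<alpha> - \<alpha> / r)))) * p"
        using p(1) by (intro mult_right_mono) (auto simp: mult.assoc)
      then show ?thesis using b2 unfolding p_def by (simp add: mult.assoc)
    qed
    show "P c \<noteq> {}" if "c \<in> nodes" for c
      using P(2)[of c] s0[of c] that unfolding nodes by auto
    have "1/2 \<le> 1 + real (L r) * (- p)" using pL by (simp add: mult.commute)
    also have "\<dots> \<le> (1 + (- p)) ^ L r" by (rule Bernoulli_inequality) (use p in auto)
    finally show "1/2 \<le> (1 - p) ^ L r" by simp
    \<comment> \<open>For the bound 4/5: \<open>(1 + p) ^ L r\<close> is at least 5/4, while its
      product with \<open>(1 - p) ^ L r\<close> is at most 1.\<close>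
    have "(1 + real (L r) * p) * (1 - p) ^ L r \<le> (1 + p) ^ L r * (1 - p) ^ L r"
      by (intro mult_right_mono Bernoulli_inequality) (use p in auto)
    also have "\<dots> = (1 - p * p) ^ L r" by (simp add: power_mult_distrib[symmetric] algebra_simps)
    also have "\<dots> \<le> 1" by (rule power_le_one) (use p mult_mono[of p 1 p 1] in auto)
    finally have "(5/4) * (1 - p) ^ L r \<le> 1"
      using pL(1) mult_right_mono[of "5/4" "1 + real (L r) * p" "(1 - p) ^ L r"] p by (simp add: mult.commute)
    then show "(1 - p) ^ L r \<le> 4/5" by simp
  qed
  \<comment> \<open>In \<open>L j * p / 2 * S (Suc j)\<close> the pool size contributes
    \<open>1 / L (Suc j)\<close>, so one growth factor \<open>x powr (\<alpha> / r)\<close> is lost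
    on every layer. The constant 32 collects 8 from \<open>S\<close>, 2 from the upper bound on
    \<open>L\<close>, and 2 from \<open>p / 2\<close>.\<close>
  define E where "E = x powr (1 - \<alpha> - \<alpha> / r) / (32 * real (r + 1) * real J * real k)"
  define c where "c = real (r + 1) * real J * real k"
  have c: "0 < c" unfolding c_def using J kp by simp
  have x0: "0 < x" using x1 by simp
  have Eroot: "E \<le> p / 2 * card (P (Suc 0, y, 0))" if "y < J * k" for y
  proof -
    have "(Suc 0, y, 0) \<in> N 0" using that L_0 unfolding N_def by (auto intro!: image_eqI[of _ _ "(y, 0)"])
    then have "(Suc 0, y, 0) \<in> C" unfolding C_def by blast
    then have cP: "card (P (Suc 0, y, 0)) = S 0" using P(2) unfolding s_def by simp
    have "E \<le> x powr (1 - \<alpha>) / (16 * c)"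
      unfolding E_def c_def using x1 \<alpha> r J kp
      by (intro frac_le powr_mono) auto
    also have "x powr (1 - \<alpha>) = p * x" unfolding p_def using x0 by (simp add: powr_mult_base mult.commute)
    also have "p * x / (16 * c) = p / 2 * (x / (8 * real (r + 1) * real J * real k * real (L 0)))"
      unfolding c_def by (simp add: L_0)
    also have "\<dots> \<le> p / 2 * S 0" using S1(3)[of 0] p by (intro mult_left_mono) auto
    finally show ?thesis unfolding cP .
  qed
  have Elayers: "E \<le> L j * p / 2 * card (P (Suc (Suc j), y, l))" if j: "j < r" "y < J * k" "l < L (Suc j)" for j y l
  proof -
    have "(Suc (Suc j), y, l) \<in> N (Suc j)" using j unfolding N_def by auto
    then have "(Suc (Suc j), y, l) \<in> C" unfolding C_def using j(1) by fastforce
    then have cP: "card (P (Suc (Suc j), y, l)) = S (Suc j)" using P(2) unfolding s_def by simp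
    define u where "u = x powr (real j * (\<alpha> / r))"
    define w where "w = x powr (\<alpha> / r)"
    have uw: "x powr (real (Suc j) * (\<alpha> / r)) = u * w"
      unfolding u_def w_def by (simp add: powr_add[symmetric] algebra_simps add_divide_distrib)
    have pos: "0 < u" "0 < w" unfolding u_def w_def using x0 by auto
    have "x powr (1 - \<alpha> - \<alpha> / r) = p * x / w"
      unfolding p_def w_def using x0 by (simp add: powr_diff powr_minus powr_add field_simps)
    then have "E = p * x / w / (32 * c)" unfolding E_def c_def by (simp add: mult_ac)
    also have "\<dots> = u * p / 2 * (x / (8 * c * (2 * (u * w))))" using pos c by (simp add: field_simps)
    also have "\<dots> \<le> L j * p / 2 * (x / (8 * c * L (Suc j)))"
    proof (rule mult_mono)
      show "u * p / 2 \<le> L j * p / 2"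
        using Lle(3)[of j] j(1) p unfolding u_def by (intro divide_right_mono mult_right_mono) auto
      have "8 * c * real (L (Suc j)) \<le> 8 * c * (2 * (u * w))"
        using Lle(1)[of "Suc j"] j(1) c unfolding uw by (intro mult_left_mono) auto
      moreover have "0 < 8 * c * real (L (Suc j))" using c Lle(2)[of "Suc j"] j(1) by simp
      ultimately show "x / (8 * c * (2 * (u * w))) \<le> x / (8 * c * L (Suc j))"
        using x0 c pos L_pos by (intro divide_left_mono mult_pos_pos) auto
    qed (use x0 p c pos in auto)
    also have "8 * c * L (Suc j) = 8 * real (r + 1) * real J * real k * real (L (Suc j))" unfolding c_def by simp
    also have "L j * p / 2 * (x / \<dots>) \<le> L j * p / 2 * S (Suc j)"
      using S1(3)[of "Suc j"] j(1) p by (intro mult_left_mono) auto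
    finally show ?thesis unfolding cP .
  qed
  have cR: "x / 2 \<le> card R"
  proof -
    have "card R = n - n div 2" unfolding R_def by simp
    then show ?thesis unfolding x_def by linarith
  qed
  have pR: "x powr (1 - \<alpha>) / 4 \<le> p / 2 * card R"
  proof -
    have "x powr (1 - \<alpha>) = p * x" unfolding p_def using x0 by (simp add: powr_mult_base mult.commute)
    then have "x powr (1 - \<alpha>) / 4 = p / 2 * (x / 2)" by simp
    also have "\<dots> \<le> p / 2 * card R" using cR p by (intro mult_left_mono) auto
    finally show ?thesis .
  qed
  have t0: "real (card nodes) * exp (- E) \<le> 1/16"
  proof -
    have "card nodes \<le> (\<Sum>c\<in>C. s c)"
      unfolding nodes using sum_mono[of C "\<lambda>_. 1" s] s0 by (simp add: Suc_leI)
    then have "card nodes \<le> n" using sum unfolding U_def by simp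
    then have cn: "real (card nodes) \<le> x" unfolding x_def by simp
    have "x powr (1 - \<alpha> - \<alpha> / r) / (32 * real (r + 1) * real J * ln x) \<le> E"
      unfolding E_def using klnx J kp x1 by (intro divide_left_mono mult_left_mono mult_pos_pos) auto
    then have "exp (- E) \<le> exp (- (x powr (1 - \<alpha> - \<alpha> / r) / (32 * real (r + 1) * real J * ln x)))" by simp
    then have "real (card nodes) * exp (- E) \<le> x * exp (- (x powr (1 - \<alpha> - \<alpha> / r) / (32 * real (r + 1) * real J * ln x)))"
      using cn x0 by (intro mult_mono) auto
    then show ?thesis using b4 by linarith
  qed
  have t1: "real n ^ 2 * (7/10) ^ (J * k - 2) \<le> 3/16"
  proof -
    let ?w = "6 * (r + 1) * k"
    have xw: "x = 2 ^ ?w" unfolding x_def n by simp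
    have Jk: "J * k = 6 * ?w" unfolding J_def by simp
    have "2 * 1 \<le> J * k" by (rule mult_le_mono) (use kp in \<open>auto simp: J_def\<close>)
    then have "2 \<le> J * k" by simp
    then have "(7/10::real) ^ (J * k) = (7/10) ^ (J * k - 2) * (7/10) ^ 2"
      by (simp only: power_add[symmetric] le_add_diff_inverse2)
    then have e: "(7/10::real) ^ (J * k - 2) = 100/49 * (7/10) ^ (J * k)" by (simp add: power2_eq_square)
    have "(7/10::real) ^ (J * k) = ((7/10) ^ 6) ^ ?w" unfolding Jk power_mult ..
    \<comment> \<open>The origin of \<open>J\<close>: \<open>J * k\<close> is six times the binary
      logarithm of \<open>n\<close>, and \<open>(7/10) ^ 6 < 1/8\<close>, so agreement on all roots
      has probability of order \<open>1 / x ^ 3\<close>, which beats the \<open>x ^ 2\<close>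
      pairs.\<close>
    also have "\<dots> \<le> (1/8) ^ ?w" by (intro power_mono) (simp_all add: eval_nat_numeral)
    also have "(1/8::real) ^ ?w = 1 / x ^ 3"
      unfolding xw by (simp add: power_one_over power_mult[symmetric] mult.commute[of _ 3]) (simp add: power_mult)
    finally have "x ^ 2 * (7/10) ^ (J * k - 2) \<le> x ^ 2 * (100/49 * (1 / x ^ 3))"
      unfolding e by (intro mult_left_mono) auto
    also have "\<dots> = 100 / 49 / x" using x0 by (simp add: power2_eq_square power3_eq_cube)
    also have "\<dots> \<le> 3 / x" using x0 by (intro divide_right_mono) auto
    finally show ?thesis using b5 unfolding x_def by linarith
  qed
  have t2: "real (3 * J\<^sup>2 * 2 ^ k) * exp (- (p / 2 * (1/5) ^ k * card R)) \<le> 1/16"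
  proof -
    have "(2::real) ^ k \<le> 2 ^ (6 * (r + 1) * k)" by (intro power_increasing) auto
    also have "\<dots> = x" unfolding x_def n by simp
    finally have "3 * (real J)\<^sup>2 * 2 ^ k \<le> 3 * (real J)\<^sup>2 * x" by (intro mult_left_mono) auto
    then have a: "real (3 * J\<^sup>2 * 2 ^ k) \<le> 3 * (real J)\<^sup>2 * x" by simp
    \<comment> \<open>The origin of the factor 6 in the exponent of \<open>n\<close>: it makes this
      power equal to \<open>8 ^ k\<close>, so that the loss of \<open>5 ^ k\<close> uses only half
      of the room in \<open>1 - \<alpha> > 1 / (r + 1)\<close>.\<close>
    have "x powr (1 / (2 * (real r + 1))) = 2 powr (real (6 * (r + 1) * k) * (1 / (2 * (real r + 1))))"
      unfolding x_def n by (simp add: powr_realpow[symmetric] powr_powr)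
    also have "real (6 * (r + 1) * k) * (1 / (2 * (real r + 1))) = real (3 * k)"
      by (simp add: field_simps)
    also have "2 powr real (3 * k) = (8::real) ^ k" by (subst powr_realpow) (simp_all add: power_mult)
    finally have "x powr (1 / (2 * (real r + 1))) = 8 ^ k" .
    moreover have "(5::real) ^ k \<le> 8 ^ k" by (intro power_mono) auto
    ultimately have "5 ^ k \<le> x powr (1 / (2 * (real r + 1)))" by simp
    then have f: "1 / x powr (1 / (2 * (real r + 1))) \<le> (1/5) ^ k"
      unfolding power_one_over by (intro divide_left_mono) (use x0 in auto)
    have "x powr (1 - \<alpha> - 1 / (2 * (real r + 1))) / 4 =
        (1 / x powr (1 / (2 * (real r + 1)))) * (x powr (1 - \<alpha>) / 4)"
      using powr_diff[of x "1 - \<alpha>"] by simp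
    also have "\<dots> \<le> (1/5) ^ k * (p / 2 * card R)"
      using f pR by (intro mult_mono) auto
    finally have "exp (- (p / 2 * (1/5) ^ k * card R)) \<le> exp (- (x powr (1 - \<alpha> - 1 / (2 * (real r + 1))) / 4))"
      by (simp add: mult_ac)
    then have "real (3 * J\<^sup>2 * 2 ^ k) * exp (- (p / 2 * (1/5) ^ k * card R)) \<le>
        3 * (real J)\<^sup>2 * x * exp (- (x powr (1 - \<alpha> - 1 / (2 * (real r + 1))) / 4))"
      using a x0 by (intro mult_mono) auto
    then show ?thesis using b6 by linarith
  qed
  have t3: "real (J * k * L (r - 1)) * exp (- (p / 2 * card R)) \<le> 1/16"
  proof -
    have "1 * real (J * k * L (r - 1)) \<le> 4 * real (r + 1) * real (J * k * L (r - 1))"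
      by (intro mult_right_mono) auto
    also have "\<dots> \<le> x" using JkL[of "r - 1"] by (simp add: mult_ac)
    finally have "real (J * k * L (r - 1)) * exp (- (p / 2 * card R)) \<le> x * exp (- (x powr (1 - \<alpha>) / 4))"
      using pR x0 by (intro mult_mono) auto
    then show ?thesis using b7 by linarith
  qed
  \<comment> \<open>The error terms add up to \<open>6/16\<close>.\<close>
  show ?thesis
    using prob_models_ge[OF k Eroot Elayers] t0 t1 t2 t3 unfolding p_def by linarith
qed

section \<open>Non-convergence\<close>

lemma self_le_double_exp: "(a::nat) \<le> c * 2 ^ 2 ^ a" if "0 < c"
proof -
  have "a < 2 ^ a" by (rule less_exp)
  also have "(2::nat) ^ a < 2 ^ 2 ^ a" by (rule less_exp)
  also have "\<dots> = 1 * 2 ^ 2 ^ a" by simp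
  also have "\<dots> \<le> c * 2 ^ 2 ^ a" using that by (intro mult_right_mono) auto
  finally show ?thesis by simp
qed

lemma filterlim_pow_double_exp:
  assumes "0 < c" shows "filterlim (\<lambda>a. (2::nat) ^ (c * 2 ^ 2 ^ a)) at_top sequentially"
proof (rule filterlim_at_top_mono[OF filterlim_ident])
  have "a \<le> 2 ^ (c * 2 ^ 2 ^ a)" for a :: nat
    using self_le_double_exp[OF assms, of a] less_exp[of "c * 2 ^ 2 ^ a"] by linarith
  then show "\<forall>\<^sub>F a in sequentially. a \<le> 2 ^ (c * 2 ^ 2 ^ a)" by simp
qed

lemma not_convergent_prob:
  assumes r: "0 < r" and \<alpha>: "0 < \<alpha>" "\<alpha> < real r / (real r + 1)"
  shows "\<not> convergent (\<lambda>n. measure_pmf.prob (binomial_graph n (real n powr (- \<alpha>)))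
    {G. G \<Turnstile> fm_code (36 * (r + 1)) r})" (is "\<not> convergent ?f")
proof
  define J where "J = 36 * (r + 1)"
  have J: "0 < J" unfolding J_def by simp
  assume "convergent ?f"
  then obtain l where l: "?f \<longlonglongrightarrow> l" unfolding convergent_def by blast
  define N where "N a = (2::nat) ^ (6 * (r + 1) * 2 ^ 2 ^ a)" for a :: nat
  \<comment> \<open>With \<open>k = 2 ^ 2 ^ a\<close>, these \<open>(J + 1) * k\<close> bits are
    more than \<open>J\<close> blocks of size \<open>k\<close> provide, but too few for a block of
    the next size \<open>k ^ 2\<close>.\<close>
  define N' where "N' a = (2::nat) ^ ((J + 1) * 2 ^ 2 ^ a)" for a :: nat
  have lim: "filterlim N at_top sequentially" "filterlim N' at_top sequentially"
    unfolding N_def N'_def by (rule filterlim_pow_double_exp; simp)+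
  have \<alpha>': "\<alpha> < r / (r + 1)" using \<alpha>(2) by (simp add: add.commute)
  have limr: "filterlim (\<lambda>a. real (N a)) at_top sequentially"
    using filterlim_compose[OF filterlim_real_sequentially lim(1)] .
  note bounds = eventually_bounds[OF r J \<alpha>(1) \<alpha>', THEN eventually_compose_filterlim[OF _ limr]]
  have "\<forall>\<^sub>F a in sequentially. 1/2 \<le> ?f (N a)"
    using bounds
  proof eventually_elim
    case (elim a)
    show ?case
      by (rule prob_models_ge_half[OF r \<alpha>(1) \<alpha>' refl N_def elim[unfolded J_def]])
  qed
  then have "1/2 \<le> l"
    by (rule tendsto_lowerbound[OF filterlim_compose[OF l lim(1)]]) simp
  have "\<forall>\<^sub>F a in sequentially. 6 * J + 2 \<le> a" by (rule eventually_ge_at_top)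
  then have "\<forall>\<^sub>F a in sequentially. ?f (N' a) = 0"
  proof eventually_elim
    case (elim a)
    then have "6 * J + 2 \<le> 2 ^ 2 ^ a" using self_le_double_exp[of 1 a] by simp
    from prob_models_eq_0[OF J r this N'_def] show ?case unfolding J_def .
  qed
  then have "l = 0"
    by (intro LIMSEQ_unique[OF filterlim_compose[OF l lim(2)]] tendsto_eventually)
  then show False using \<open>1/2 \<le> l\<close> by simp
qed

theorem theorem1:
  fixes \<delta> :: real
  assumes "\<delta> > 0"
  shows "(\<exists>\<phi>. emso_sentence 1 \<phi> \<and>
            (\<forall>\<alpha>\<in>{0<..<1/2 - \<delta>}.
               \<not> convergent (\<lambda>n. measure_pmf.prob (binomial_graph n (real n powr (- \<alpha>))) {G. G \<Turnstile> \<phi>})))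
       \<and> (\<exists>m \<phi>. emso_sentence m \<phi> \<and>
            (\<forall>\<alpha>\<in>{0<..<1 - \<delta>}.
               \<not> convergent (\<lambda>n. measure_pmf.prob (binomial_graph n (real n powr (- \<alpha>))) {G. G \<Turnstile> \<phi>})))"
proof
  show "\<exists>\<phi>. emso_sentence 1 \<phi> \<and> (\<forall>\<alpha>\<in>{0<..<1/2 - \<delta>}.
      \<not> convergent (\<lambda>n. measure_pmf.prob (binomial_graph n (real n powr (- \<alpha>))) {G. G \<Turnstile> \<phi>}))"
  proof (intro exI[of _ "fm_code (36 * (1 + 1)) 1"] conjI ballI)
    show "emso_sentence 1 (fm_code (36 * (1 + 1)) 1)" by (rule emso_sentence_fm_code) auto
    fix \<alpha> assume "\<alpha> \<in> {0<..<1/2 - \<delta>}"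
    then show "\<not> convergent (\<lambda>n. measure_pmf.prob (binomial_graph n (real n powr (- \<alpha>)))
        {G. G \<Turnstile> fm_code (36 * (1 + 1)) 1})"
      using assms by (intro not_convergent_prob) auto
  qed
  obtain r where "1 / \<delta> < real r" using reals_Archimedean2 by blast
  moreover have "0 < 1 / \<delta>" using assms by simp
  ultimately have r: "0 < real r" "1 / \<delta> < real r" by linarith+
  have "1 / (real r + 1) < \<delta>" using assms r by (simp add: field_simps)
  moreover have "1 - 1 / (real r + 1) = real r / (real r + 1)" by (simp add: field_simps)
  ultimately have le: "1 - \<delta> \<le> real r / (real r + 1)" by linarith
  show "\<exists>m \<phi>. emso_sentence m \<phi> \<and> (\<forall>\<alpha>\<in>{0<..<1 - \<delta>}.
      \<not> convergent (\<lambda>n. measure_pmf.prob (binomial_graph n (real n powr (- \<alpha>))) {G. G \<Turnstile> \<phi>}))"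
  proof (intro exI[of _ r] exI[of _ "fm_code (36 * (r + 1)) r"] conjI ballI)
    show "emso_sentence r (fm_code (36 * (r + 1)) r)" using r by (intro emso_sentence_fm_code) auto
    fix \<alpha> assume "\<alpha> \<in> {0<..<1 - \<delta>}"
    then show "\<not> convergent (\<lambda>n. measure_pmf.prob (binomial_graph n (real n powr (- \<alpha>)))
        {G. G \<Turnstile> fm_code (36 * (r + 1)) r})"
      using r le by (intro not_convergent_prob) auto
  qed
qed

end
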